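(* The formal series $Z^\circ(q,\mathbf t)$, $\mathbf t=(t_0,t_1,t_2,\dots)$, satisfies $$\frac{\partial Z^\circ}{\partial q}=\frac12\sum_{i,j}(i+j)t_it_j\,\partial_{i+j-1}Z^\circ+\frac12\sum_{i,j}(i+1)(j+1)t_{i+j+3}\,\partial_i\partial_jZ^\circ+\frac{t_0^2}{2},$$ with $Z^\circ(0,\mathbf t)=0$, where $\partial_i=\partial/\partial t_i$ and the sums run over $i,j\ge0$ (the $i=j=0$ term of the first sum being $0$).
   Context: A ribbon graph $R$ is a finite set $XR$ (half-edges) with permutations $s_0,s_1,s_2$ of $XR$ such that $s_1$ is an involution without fixed points and $s_2s_1s_0=\mathrm{id}$. The sets $X_0R,X_1R,X_2R$ of orbits of $s_0,s_1,s_2$ are the vertices, edges and boundary components of $R$; $[e]_i$ is the orbit of $e\in XR$ under $s_i$; the degree of a vertex is its number of half-edges. $R$ is connected if $\langle s_0,s_1,s_2\rangle$ acts transitively on $XR$, and then its genus $g$ is defined by $2-2g=\#X_0R-\#X_1R+\#X_2R$. A direction is a map $\epsilon:XR\to\{\pm1\}$ with $\epsilon\circ s_2=\epsilon$ and $\epsilon\circ s_1=-\epsilon$; a directed ribbon graph is $R^\circ=(R,\epsilon)$. As $\epsilon$ is constant on boundary components, these split into positive and negative ones. $R^\circ$ is of type $(g,n^+,n^-)$ if it is connected of genus $g$ with $n^+$ positive boundary components labelled $1,\dots,n^+$ and $n^-$ negative ones labelled $1,\dots,n^-$; isomorphisms are bijections of half-edges commuting with all $s_i$ and preserving $\epsilon$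 and the labels, and $\mathrm{Aut}(R^\circ)$ is the corresponding automorphism group. A metric is a map $m:X_1R\to\mathbb R_{>0}$; the length of $\beta\in X_2R$ is $\sum_{e\in XR,\,[e]_2=\beta}m_{[e]_1}$. For $L^\pm\in\mathbb R_{>0}^{n^\pm}$ with $\sum_iL_i^+=\sum_jL_j^-$, $\mathrm{Met}(R^\circ,L)$ is the set of metrics whose positive (negative) boundary lengths are $L^+$ (resp. $L^-$). It lies in an affine space directed by the kernel $K_R\subset\mathbb R^{X_1R}$ of the linear boundary-length map $\mathbb R^{X_1R}\to\mathbb R^{X_2R}$, and it carries the Lebesgue measure for which $K_R\cap\mathbb Z^{X_1R}$ has covolume one (counting measure if $K_R=0$). Put $$V_{g,n^+,n^-}(L^+|L^-)=\sum_{R^\circ}\frac{1}{\#\mathrm{Aut}(R^\circ)}\mathrm{vol}(\mathrm{Met}(R^\circ,L)),$$ the sum being over isomorphism classes of directed ribbon graphs of type $(g,n^+,n^-)$ all of whose vertices have degree $4$. For $g\ge0,n\ge1$, $2g-1+n\ge1$, set $V^\circ_{g,n}(L)=V_{g,n,1}(L\,|\,\sum_iL_i)$ for $L\in\mathbb R_{>0}^n$; this is a symmetric homogeneous polynomial of degree $4g-2+n$. Write $V^\circ_{g,n}(L)=\sum_{\alpha}c(\alpha)\prod_iL_i^{\alpha_i}$, over $\alpha\in\mathbb Z_{\ge0}^n$ with $\sum_i\alpha_i=4g-2+n$ (so $g,n$ are determined by $\alpha$). By symmetry $c(\alpha)$ depends only on $\mu=(\mu(0),\mu(1),\dots)$,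 where $\mu(i)$ is the number of entries of $\alpha$ equal to $i$; write $c(\mu)=c(\alpha)$, $d(\mu)=\sum_ii\mu(i)$, $n(\mu)=\sum_i\mu(i)$, and $c(\mu)=0$ if $\mu$ does not arise from such a pair $(g,n)$. Then $$Z^\circ(q,\mathbf t)=\sum_\mu\frac{q^{\frac{d(\mu)+n(\mu)}2}\prod_i(i!)^{\mu(i)}t_i^{\mu(i)}}{\prod_i\mu(i)!}\,c(\mu),$$ the sum being over finitely supported $\mu:\mathbb Z_{\ge0}\to\mathbb Z_{\ge0}$. *)

theory Defs
  imports
    "HOL-Analysis.Analysis"
    "HOL-Combinatorics.Orbits"
    "HOL-Library.Groups_Big_Fun"
    "HOL-Library.Poly_Mapping"
begin

section \<open>Directed ribbon graphs\<close>

text \<open>The permutations of the half-edges are total functions that are the identity off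
  \<open>half_edges\<close> (library notion \<open>permutes\<close>). The values of \<open>dir\<close> off the half-edges and of
  \<open>label\<close> off the boundary components are irrelevant: isomorphisms ignore them.\<close>

record 'a ribbon =
  half_edges :: "'a set"
  s0 :: "'a \<Rightarrow> 'a"
  s1 :: "'a \<Rightarrow> 'a"
  s2 :: "'a \<Rightarrow> 'a"

record 'a dribbon = "'a ribbon" +
  dir :: "'a \<Rightarrow> int"
  label :: "'a set \<Rightarrow> nat"

definition ribbon_graph :: "('a, 'b) ribbon_scheme \<Rightarrow> bool" where
  "ribbon_graph R \<longleftrightarrow>
     finite (half_edges R) \<and>
     s0 R permutes half_edges R \<and> s1 R permutes half_edges R \<and> s2 R permutes half_edges R \<and>
     (\<forall>x\<in>half_edges R. s1 R (s1 R x) = x \<and> s1 R x \<noteq> x) \<and>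
     s2 R \<circ> s1 R \<circ> s0 R = id"

definition vertices :: "('a, 'b) ribbon_scheme \<Rightarrow> 'a set set" where
  "vertices R = orbit (s0 R) ` half_edges R"

definition edges :: "('a, 'b) ribbon_scheme \<Rightarrow> 'a set set" where
  "edges R = orbit (s1 R) ` half_edges R"

definition boundaries :: "('a, 'b) ribbon_scheme \<Rightarrow> 'a set set" where
  "boundaries R = orbit (s2 R) ` half_edges R"

definition moves :: "('a, 'b) ribbon_scheme \<Rightarrow> ('a \<times> 'a) set" where
  "moves R = {(x, s x) | s x. s \<in> {s0 R, s1 R, s2 R} \<and> x \<in> half_edges R}"

definition connected_ribbon :: "('a, 'b) ribbon_scheme \<Rightarrow> bool" where
  "connected_ribbon R \<longleftrightarrow>
     (\<forall>x\<in>half_edges R. \<forall>y\<in>half_edges R. (x, y) \<in> (moves R \<union> (moves R)\<inverse>)\<^sup>*)"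

definition has_genus :: "('a, 'b) ribbon_scheme \<Rightarrow> nat \<Rightarrow> bool" where
  "has_genus R g \<longleftrightarrow>
     2 - 2 * int g = int (card (vertices R)) - int (card (edges R)) + int (card (boundaries R))"

definition direction :: "('a, 'b) dribbon_scheme \<Rightarrow> bool" where
  "direction R \<longleftrightarrow>
     (\<forall>x\<in>half_edges R. dir R x \<in> {1, -1} \<and> dir R (s2 R x) = dir R x \<and> dir R (s1 R x) = - dir R x)"

definition pos_boundaries :: "('a, 'b) dribbon_scheme \<Rightarrow> 'a set set" where
  "pos_boundaries R = orbit (s2 R) ` {x \<in> half_edges R. dir R x = 1}"

definition neg_boundaries :: "('a, 'b) dribbon_scheme \<Rightarrow> 'a set set" where
  "neg_boundaries R = orbit (s2 R) ` {x \<in> half_edges R. dir R x = -1}"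

definition has_type :: "('a, 'b) dribbon_scheme \<Rightarrow> nat \<Rightarrow> nat \<Rightarrow> nat \<Rightarrow> bool" where
  "has_type R g np nm \<longleftrightarrow>
     ribbon_graph R \<and> direction R \<and> connected_ribbon R \<and> has_genus R g \<and>
     bij_betw (label R) (pos_boundaries R) {1..np} \<and>
     bij_betw (label R) (neg_boundaries R) {1..nm}"

definition is_iso :: "('a \<Rightarrow> 'b) \<Rightarrow> 'a dribbon \<Rightarrow> 'b dribbon \<Rightarrow> bool" where
  "is_iso \<phi> R S \<longleftrightarrow>
     bij_betw \<phi> (half_edges R) (half_edges S) \<and>
     (\<forall>x\<in>half_edges R.
        \<phi> (s0 R x) = s0 S (\<phi> x) \<and> \<phi> (s1 R x) = s1 S (\<phi> x) \<and> \<phi> (s2 R x) = s2 S (\<phi> x) \<and>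
        dir S (\<phi> x) = dir R x) \<and>
     (\<forall>\<beta>\<in>boundaries R. label S (\<phi> ` \<beta>) = label R \<beta>)"

definition Aut :: "'a dribbon \<Rightarrow> ('a \<Rightarrow> 'a) set" where
  "Aut R = {\<phi>. \<phi> permutes half_edges R \<and> is_iso \<phi> R R}"

text \<open>Every finite ribbon graph is isomorphic to one whose half-edges are natural numbers, so
  isomorphism classes are taken among those.\<close>

definition quartic_graphs :: "nat \<Rightarrow> nat \<Rightarrow> nat \<Rightarrow> nat dribbon set" where
  "quartic_graphs g np nm = {R. has_type R g np nm \<and> (\<forall>v\<in>vertices R. card v = 4)}"

definition iso_rel :: "nat \<Rightarrow> nat \<Rightarrow> nat \<Rightarrow> (nat dribbon \<times> nat dribbon) set" where
  "iso_rel g np nm =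
     {(R, S). R \<in> quartic_graphs g np nm \<and> S \<in> quartic_graphs g np nm \<and> (\<exists>\<phi>. is_iso \<phi> R S)}"


section \<open>Metrics and volumes\<close>

text \<open>The space of real functions on the edges is realised as the functions on all sets of
  half-edges that vanish off the edges.\<close>

definition edge_vectors :: "('a, 'b) ribbon_scheme \<Rightarrow> ('a set \<Rightarrow> real) set" where
  "edge_vectors R = {m. \<forall>e. e \<notin> edges R \<longrightarrow> m e = 0}"

definition blength :: "('a, 'b) ribbon_scheme \<Rightarrow> ('a set \<Rightarrow> real) \<Rightarrow> 'a set \<Rightarrow> real" where
  "blength R m \<beta> = (\<Sum>x | x \<in> half_edges R \<and> orbit (s2 R) x = \<beta>. m (orbit (s1 R) x))"

definition length_kernel :: "('a, 'b) ribbon_scheme \<Rightarrow> ('a set \<Rightarrow> real) set" where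
  "length_kernel R = {m \<in> edge_vectors R. \<forall>\<beta>\<in>boundaries R. blength R m \<beta> = 0}"

definition affine_Met ::
  "('a, 'b) dribbon_scheme \<Rightarrow> (nat \<Rightarrow> real) \<Rightarrow> (nat \<Rightarrow> real) \<Rightarrow> ('a set \<Rightarrow> real) set" where
  "affine_Met R Lp Lm =
     {m \<in> edge_vectors R.
        (\<forall>\<beta>\<in>pos_boundaries R. blength R m \<beta> = Lp (label R \<beta>)) \<and>
        (\<forall>\<beta>\<in>neg_boundaries R. blength R m \<beta> = Lm (label R \<beta>))}"

definition Met ::
  "('a, 'b) dribbon_scheme \<Rightarrow> (nat \<Rightarrow> real) \<Rightarrow> (nat \<Rightarrow> real) \<Rightarrow> ('a set \<Rightarrow> real) set" where
  "Met R Lp Lm = {m \<in> affine_Met R Lp Lm. \<forall>e\<in>edges R. m e > 0}"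

definition integer_kernel :: "('a, 'b) ribbon_scheme \<Rightarrow> ('a set \<Rightarrow> real) set" where
  "integer_kernel R = {m \<in> length_kernel R. \<forall>e. m e \<in> \<int>}"

text \<open>\<open>b 0, \<dots>, b (d - 1)\<close> is a basis, over the integers, of the free abelian group
  \<open>integer_kernel R\<close>. As the length map is defined over the rationals, such a \<open>b\<close> is also a basis
  of the real vector space \<open>length_kernel R\<close>.\<close>

definition lattice_basis ::
  "('a, 'b) ribbon_scheme \<Rightarrow> nat \<Rightarrow> (nat \<Rightarrow> 'a set \<Rightarrow> real) \<Rightarrow> bool" where
  "lattice_basis R d b \<longleftrightarrow>
     (\<forall>i<d. b i \<in> integer_kernel R) \<and>
     bij_betw (\<lambda>z e. \<Sum>i<d. of_int (z i) * b i e)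
       ({..<d} \<rightarrow>\<^sub>E (UNIV :: int set)) (integer_kernel R)"

text \<open>The Lebesgue measure on the affine space for which the lattice has covolume one is the image
  of the standard Lebesgue measure under the coordinates \<open>x \<mapsto> m + (\<Sum>i<d. x i * b i)\<close> given by a
  base point \<open>m\<close> of the affine space and a lattice basis \<open>b\<close>; it depends on neither choice.
  For \<open>d = 0\<close> the product measure is the unit mass on a point, i.e. counting measure. When the
  affine space is empty so is \<open>Met R Lp Lm\<close>, and the value is 0.\<close>

definition vol_Met :: "('a, 'b) dribbon_scheme \<Rightarrow> (nat \<Rightarrow> real) \<Rightarrow> (nat \<Rightarrow> real) \<Rightarrow> real" where
  "vol_Met R Lp Lm =
     (let (d, b) = (SOME (d, b). lattice_basis R d b);
          m = (SOME m. m \<in> affine_Met R Lp Lm)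
      in measure (\<Pi>\<^sub>M i\<in>{..<d}. lborel)
           {x \<in> {..<d} \<rightarrow>\<^sub>E UNIV. (\<lambda>e. m e + (\<Sum>i<d. x i * b i e)) \<in> Met R Lp Lm})"

text \<open>The lengths are indexed by the labels \<open>1, \<dots>, np\<close> and \<open>1, \<dots>, nm\<close>. A graph in
  \<open>quartic_graphs g np nm\<close> has \<open>4 * (2 * g + np + nm - 2)\<close> half-edges, so the sum is over a finite
  set of classes; the summand does not depend on the chosen representative.\<close>

definition V :: "nat \<Rightarrow> nat \<Rightarrow> nat \<Rightarrow> (nat \<Rightarrow> real) \<Rightarrow> (nat \<Rightarrow> real) \<Rightarrow> real" where
  "V g np nm Lp Lm =
     (\<Sum>C \<in> quartic_graphs g np nm // iso_rel g np nm.
        let R = (SOME R. R \<in> C) in 1 / real (card (Aut R)) * vol_Met R Lp Lm)"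

definition Vo :: "nat \<Rightarrow> nat \<Rightarrow> (nat \<Rightarrow> real) \<Rightarrow> real" where
  "Vo g n L = V g n 1 L (\<lambda>_. \<Sum>i=1..n. L i)"


section \<open>Coefficients of the volume polynomials\<close>

definition admissible :: "nat \<Rightarrow> nat \<Rightarrow> bool" where
  "admissible g n \<longleftrightarrow> n \<ge> 1 \<and> 2 * int g - 1 + int n \<ge> 1"

definition exponents :: "nat \<Rightarrow> nat \<Rightarrow> (nat \<Rightarrow> nat) set" where
  "exponents g n =
     {\<alpha> \<in> {1..n} \<rightarrow>\<^sub>E UNIV. int (\<Sum>i=1..n. \<alpha> i) = 4 * int g - 2 + int n}"

text \<open>A polynomial is determined by its values on the positive orthant, so there is at most one
  such coefficient function.\<close>

definition Vo_coeff :: "nat \<Rightarrow> nat \<Rightarrow> (nat \<Rightarrow> nat) \<Rightarrow> real" where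
  "Vo_coeff g n =
     (THE c. (\<forall>\<alpha>. \<alpha> \<notin> exponents g n \<longrightarrow> c \<alpha> = 0) \<and>
        (\<forall>L. (\<forall>i\<in>{1..n}. L i > 0) \<longrightarrow>
           Vo g n L = (\<Sum>\<alpha>\<in>exponents g n. c \<alpha> * (\<Prod>i=1..n. L i ^ \<alpha> i))))"

definition d_mu :: "(nat \<Rightarrow>\<^sub>0 nat) \<Rightarrow> nat" where
  "d_mu \<mu> = (\<Sum>i\<in>Poly_Mapping.keys \<mu>. i * Poly_Mapping.lookup \<mu> i)"

definition n_mu :: "(nat \<Rightarrow>\<^sub>0 nat) \<Rightarrow> nat" where
  "n_mu \<mu> = (\<Sum>i\<in>Poly_Mapping.keys \<mu>. Poly_Mapping.lookup \<mu> i)"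

definition arises :: "(nat \<Rightarrow>\<^sub>0 nat) \<Rightarrow> nat \<Rightarrow> nat \<Rightarrow> (nat \<Rightarrow> nat) \<Rightarrow> bool" where
  "arises \<mu> g n \<alpha> \<longleftrightarrow>
     admissible g n \<and> \<alpha> \<in> exponents g n \<and>
     (\<forall>i. Poly_Mapping.lookup \<mu> i = card {k \<in> {1..n}. \<alpha> k = i})"

text \<open>Here \<open>g\<close> and \<open>n\<close> are determined by \<open>\<mu>\<close>, and \<open>\<alpha>\<close> is determined up to a permutation, which
  does not change the coefficient because the polynomial is symmetric.\<close>

definition c_mu :: "(nat \<Rightarrow>\<^sub>0 nat) \<Rightarrow> real" where
  "c_mu \<mu> =
     (if \<exists>g n \<alpha>. arises \<mu> g n \<alpha>
      then let (g, n, \<alpha>) = (SOME (g, n, \<alpha>). arises \<mu> g n \<alpha>) in Vo_coeff g n \<alpha>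
      else 0)"


section \<open>Formal power series in q and t\<close>

text \<open>\<open>f k \<mu>\<close> is the coefficient of \<open>q ^ k * (\<Prod>i. t i ^ \<mu> i)\<close>; thus \<open>f 0\<close> is the value of \<open>f\<close> at
  \<open>q = 0\<close>.\<close>

type_synonym qt_series = "nat \<Rightarrow> (nat \<Rightarrow>\<^sub>0 nat) \<Rightarrow> real"

definition ser_one :: qt_series where
  "ser_one = (\<lambda>k \<mu>. if k = 0 \<and> \<mu> = 0 then 1 else 0)"

definition ser_add :: "qt_series \<Rightarrow> qt_series \<Rightarrow> qt_series" (infixl "\<oplus>" 65) where
  "f \<oplus> h = (\<lambda>k \<mu>. f k \<mu> + h k \<mu>)"

definition ser_scale :: "real \<Rightarrow> qt_series \<Rightarrow> qt_series" (infixr "\<odot>" 75) where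
  "c \<odot> f = (\<lambda>k \<mu>. c * f k \<mu>)"

definition times_t :: "nat \<Rightarrow> qt_series \<Rightarrow> qt_series" where
  "times_t i f = (\<lambda>k \<mu>.
     if Poly_Mapping.lookup \<mu> i = 0 then 0 else f k (\<mu> - Poly_Mapping.single i 1))"

definition d_t :: "nat \<Rightarrow> qt_series \<Rightarrow> qt_series" where
  "d_t i f = (\<lambda>k \<mu>. real (Poly_Mapping.lookup \<mu> i + 1) * f k (\<mu> + Poly_Mapping.single i 1))"

definition d_q :: "qt_series \<Rightarrow> qt_series" where
  "d_q f = (\<lambda>k \<mu>. real (k + 1) * f (k + 1) \<mu>)"

text \<open>The sum of a family of series indexed by pairs, taken coefficientwise; it is only meaningful
  if each coefficient receives finitely many non-zero contributions (otherwise \<open>Sum_any\<close> is 0).\<close>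

definition ser_sum :: "(nat \<Rightarrow> nat \<Rightarrow> qt_series) \<Rightarrow> qt_series" where
  "ser_sum F = (\<lambda>k \<mu>. Sum_any (\<lambda>(i, j). F i j k \<mu>))"

definition Zo :: qt_series where
  "Zo = (\<lambda>k \<mu>.
     if 2 * k = d_mu \<mu> + n_mu \<mu>
     then (\<Prod>i\<in>Poly_Mapping.keys \<mu>. fact i ^ Poly_Mapping.lookup \<mu> i) /
         (\<Prod>i\<in>Poly_Mapping.keys \<mu>. fact (Poly_Mapping.lookup \<mu> i)) * c_mu \<mu>
     else 0)"

text \<open>Both families to which \<open>ser_sum\<close> is applied are locally finite, whatever the series.\<close>

lemma join_locally_finite:
  "finite {(i, j). (c i j \<odot> times_t i (times_t j (F i j))) k \<mu> \<noteq> 0}"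
proof -
  have "{(i, j). (c i j \<odot> times_t i (times_t j (F i j))) k \<mu> \<noteq> 0}
      \<subseteq> Poly_Mapping.keys \<mu> \<times> Poly_Mapping.keys \<mu>"
    by (auto simp: ser_scale_def times_t_def lookup_minus in_keys_iff split: if_splits)
  then show ?thesis
    by (rule finite_subset) simp
qed

lemma cut_locally_finite:
  "finite {(i, j). (c i j \<odot> times_t (i + j + 3) (F i j)) k \<mu> \<noteq> 0}"
proof -
  have "{(i, j). (c i j \<odot> times_t (i + j + 3) (F i j)) k \<mu> \<noteq> 0}
      \<subseteq> {..Max (Poly_Mapping.keys \<mu>)} \<times> {..Max (Poly_Mapping.keys \<mu>)}"
  proof clarify
    fix i j
    assume "(c i j \<odot> times_t (i + j + 3) (F i j)) k \<mu> \<noteq> 0"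
    then have "i + j + 3 \<in> Poly_Mapping.keys \<mu>"
      by (auto simp: ser_scale_def times_t_def in_keys_iff split: if_splits)
    then have "i + j + 3 \<le> Max (Poly_Mapping.keys \<mu>)"
      by simp
    then show "i \<in> {..Max (Poly_Mapping.keys \<mu>)} \<and> j \<in> {..Max (Poly_Mapping.keys \<mu>)}"
      by simp
  qed
  then show ?thesis
    by (rule finite_subset) simp
qed

end

theory Submission
  imports Defs
begin

text \<open>Number the edges of a quartic graph with one negative boundary by the position of their negative
  half-edge. The negative boundary is then a full cycle \<open>t\<close> of \<open>2 k\<close> elements, where \<open>k\<close> is the number of
  vertices, and the vertices form a fixed-point-free involution \<open>r\<close> pairing opposite edges; conversely
  every such pair arises, and the positive boundaries are the cycles of \<open>t\<^sup>-\<^sup>1 r\<close>. A metric with prescribed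
  lengths is a point in a product of open simplices, one for each positive boundary, so the volume is
  \<open>\<Prod> L\<^sub>i ^ (m\<^sub>i - 1) / (m\<^sub>i - 1)!\<close> for cycles of lengths \<open>m\<^sub>i\<close>. Hence the coefficient of \<open>q ^ k t ^ \<mu>\<close> in the
  series is \<open>1 / (2 k)!\<close> times the number of pairs \<open>(t, r)\<close> for which \<open>t\<^sup>-\<^sup>1 r\<close> has \<open>\<mu> i\<close> cycles of length
  \<open>i + 1\<close>. Removing one pair of the matching from both \<open>r\<close> and \<open>t\<close> is a bijective recursion for these
  numbers: undoing it either splits one cycle of \<open>t\<^sup>-\<^sup>1 r\<close> into two or joins two into one, with two more
  elements in total. These cases give the two sums in the equation, and the only pair with \<open>k = 1\<close> gives
  \<open>t\<^sub>0\<^sup>2 / 2\<close>.\<close>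

section \<open>Lebesgue measure under integer matrices with integer inverse\<close>

section \<open>Lattice-normalised volumes\<close>

text \<open>Several objects are given by choice, and this shapes the proof. \<open>vol_Met\<close>
  uses some lattice basis and some base point, so the volume is computed for every basis: a change
  of basis is an integer matrix with integer inverse and preserves Lebesgue measure.
  \<open>Vo_coeff\<close> is a definite description, so the coefficients must be shown to be unique
  on the positive orthant. The convention that \<open>c_mu\<close> vanishes unless
  \<open>\<mu>\<close> arises needs a counterpart: no pair has such a cycle type. For this,
  \<open>k + 1 - n_mu \<mu>\<close> is shown to be even and non-negative along the recursion. The
  factor \<open>1 / (2 k)!\<close> is what a cancellation leaves. Numbering the edges replaces
  \<open>1 / #Aut\<close> by a number of keys over \<open>(2 k)!\<close>; the factorials of the
  simplices cancel \<open>(i!) ^ \<mu> i\<close>; the labellings of the cycles cancel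
  \<open>1 / \<mu> i!\<close>. In the equation, the choice of a partner for the new element
  contributes \<open>2 k + 1\<close> and the derivative in \<open>q\<close> contributes
  \<open>k + 1\<close>; as \<open>(k + 1) (2 k + 1) / (2 k + 2)! = 1 / (2 (2 k)!)\<close>, this is
  the origin of \<open>1/2\<close> before both sums.\<close>

lemma nn_integral_PiM_lborel_affine:
  fixes y :: "'i \<Rightarrow> real" and c :: real
  assumes I: "finite I" and c: "\<bar>c\<bar> = 1" and f: "f \<in> borel_measurable (\<Pi>\<^sub>M i\<in>I. lborel)"
  shows "(\<integral>\<^sup>+x. f (\<lambda>i\<in>I. y i + c * x i) \<partial>(\<Pi>\<^sub>M i\<in>I. lborel)) = (\<integral>\<^sup>+x. f x \<partial>(\<Pi>\<^sub>M i\<in>I. lborel))"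
proof -
  let ?M = "\<Pi>\<^sub>M i\<in>I. (lborel :: real measure)"
  interpret product_sigma_finite "\<lambda>_::'i. lborel :: real measure" ..
  have m: "(\<lambda>x. \<lambda>i\<in>I. y i + c * x i) \<in> measurable ?M ?M"
    by measurable
  \<comment> \<open>A product measure is determined by its values on boxes, so one coordinate
    suffices, and there a slope of absolute value 1 preserves length. Slope 1 gives translations,
    slope -1 the reflection used in the Tonelli argument of the next lemma.\<close>
  have "distr ?M ?M (\<lambda>x. \<lambda>i\<in>I. y i + c * x i) = ?M"
  proof (rule PiM_eqI[OF I])
    fix A :: "'i \<Rightarrow> real set"
    assume A: "\<And>i. i \<in> I \<Longrightarrow> A i \<in> sets lborel"
    have A': "(\<lambda>t. y i + c * t) -` A i \<in> sets lborel" if "i \<in> I" for i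
      using measurable_sets[of "\<lambda>t. y i + c * t" borel borel "A i"] A[OF that] by simp
    have e: "emeasure lborel ((\<lambda>t. y i + c * t) -` A i) = emeasure lborel (A i)" if "i \<in> I" for i
    proof -
      have c0: "c \<noteq> 0" using c by auto
      have "emeasure lborel (A i) = emeasure (density (distr lborel borel (\<lambda>t. y i + c * t)) (\<lambda>_. \<bar>c\<bar>)) (A i)"
        using lborel_real_affine[OF c0, of "y i"] by simp
      also have "\<dots> = emeasure lborel ((\<lambda>t. y i + c * t) -` A i)"
        using A[OF that] c by (simp add: density_1 emeasure_distr)
      finally show ?thesis by simp
    qed
    have "emeasure (distr ?M ?M (\<lambda>x. \<lambda>i\<in>I. y i + c * x i)) (Pi\<^sub>E I A)
        = emeasure ?M ((\<lambda>x. \<lambda>i\<in>I. y i + c * x i) -` Pi\<^sub>E I A \<inter> space ?M)"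
      by (rule emeasure_distr[OF m]) (auto intro!: sets_PiM_I_finite I A simp del: sets_lborel)
    also have "(\<lambda>x. \<lambda>i\<in>I. y i + c * x i) -` Pi\<^sub>E I A \<inter> space ?M
        = Pi\<^sub>E I (\<lambda>i. (\<lambda>t. y i + c * t) -` A i)"
      by (auto simp: space_PiM PiE_iff)
    also have "emeasure ?M \<dots> = (\<Prod>i\<in>I. emeasure lborel (A i))"
      using A' e by (subst emeasure_PiM[OF I]) (auto intro!: prod.cong)
    finally show "emeasure (distr ?M ?M (\<lambda>x. \<lambda>i\<in>I. y i + c * x i)) (Pi\<^sub>E I A)
        = (\<Prod>i\<in>I. emeasure lborel (A i))" .
  qed simp
  then have "(\<integral>\<^sup>+x. f x \<partial>?M) = (\<integral>\<^sup>+x. f x \<partial>distr ?M ?M (\<lambda>x. \<lambda>i\<in>I. y i + c * x i))"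
    by simp
  also have "\<dots> = (\<integral>\<^sup>+x. f (\<lambda>i\<in>I. y i + c * x i) \<partial>?M)"
    using f by (intro nn_integral_distr[OF m]) simp
  finally show ?thesis by simp
qed

text \<open>The preimage of Lebesgue measure is translation invariant, so Tonelli for the integral of
  \<open>1\<^sub>A (T u) 1\<^sub>B (T u + x)\<close> shows that it is a multiple of Lebesgue measure. The factor is 1 because
  \<open>T\<close> pulls a fundamental domain of the integer lattice back to a fundamental domain.\<close>

lemma emeasure_PiM_lborel_unimodular:
  fixes P :: "'i \<Rightarrow> 'j \<Rightarrow> int" and Q :: "'j \<Rightarrow> 'i \<Rightarrow> int" and y :: "'j \<Rightarrow> real"
  assumes I: "finite I" and J: "finite J"
    and PQ: "\<And>i j. i \<in> I \<Longrightarrow> j \<in> I \<Longrightarrow> (\<Sum>k\<in>J. P i k * Q k j) = (if i = j then 1 else 0)"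
    and QP: "\<And>i j. i \<in> J \<Longrightarrow> j \<in> J \<Longrightarrow> (\<Sum>k\<in>I. Q i k * P k j) = (if i = j then 1 else 0)"
    and S: "S \<in> sets (\<Pi>\<^sub>M j\<in>J. lborel)"
  shows "emeasure (\<Pi>\<^sub>M i\<in>I. lborel)
      {x \<in> I \<rightarrow>\<^sub>E UNIV. (\<lambda>j\<in>J. y j + (\<Sum>i\<in>I. x i * of_int (P i j))) \<in> S} = emeasure (\<Pi>\<^sub>M j\<in>J. lborel) S"
proof -
  define M where "M = (\<Pi>\<^sub>M i\<in>I. (lborel :: real measure))"
  define N where "N = (\<Pi>\<^sub>M j\<in>J. (lborel :: real measure))"
  interpret product_sigma_finite "\<lambda>_::'i. lborel :: real measure" ..
  interpret N: product_sigma_finite "\<lambda>_::'j. lborel :: real measure" ..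
  have spM: "space M = I \<rightarrow>\<^sub>E UNIV" by (simp add: M_def space_PiM)
  have spN: "space N = J \<rightarrow>\<^sub>E UNIV" by (simp add: N_def space_PiM)
  interpret sM: sigma_finite_measure M
    unfolding M_def by (rule sigma_finite[OF I])
  interpret sN: sigma_finite_measure N
    unfolding N_def by (rule N.sigma_finite[OF J])
  interpret MN: pair_sigma_finite M N ..
  interpret NM: pair_sigma_finite N M ..
  define T where "T = (\<lambda>x. \<lambda>j\<in>J. \<Sum>i\<in>I. x i * real_of_int (P i j))"
  define U where "U = (\<lambda>x. \<lambda>i\<in>I. \<Sum>j\<in>J. x j * real_of_int (Q j i))"
  define addI where "addI = (\<lambda>x y. \<lambda>i\<in>I. x i + (y i :: real))"
  define add where "add = (\<lambda>x y. \<lambda>i\<in>J. x i + (y i :: real))"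
  define sub where "sub = (\<lambda>x y. \<lambda>i\<in>J. x i - (y i :: real))"
  define C where "C = (J \<rightarrow>\<^sub>E {0..<1::real})"
  define CI where "CI = (I \<rightarrow>\<^sub>E {0..<1::real})"
  define Z where "Z = (I \<rightarrow>\<^sub>E (UNIV :: int set))"
  define ZJ where "ZJ = (J \<rightarrow>\<^sub>E (UNIV :: int set))"
  have Tm[measurable]: "T \<in> measurable M N" unfolding T_def M_def N_def by measurable
  have Cm[measurable]: "C \<in> sets N"
    unfolding C_def N_def by (auto intro!: sets_PiM_I_finite J)
  have CIm[measurable]: "CI \<in> sets M"
    unfolding CI_def M_def by (auto intro!: sets_PiM_I_finite I)
  have NC: "emeasure N C = 1"
    unfolding C_def N_def by (subst N.emeasure_PiM[OF J]) auto
  have MC: "emeasure M CI = 1"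
    unfolding CI_def M_def by (subst emeasure_PiM[OF I]) auto
  have addm[measurable]: "(\<lambda>x. add (f x) (g x)) \<in> measurable K N"
    if "f \<in> measurable K N" "g \<in> measurable K N" for K :: "'z measure" and f g
  proof -
    have "(\<lambda>p. add (fst p) (snd p)) \<in> measurable (N \<Otimes>\<^sub>M N) N"
      unfolding add_def N_def by measurable
    from measurable_compose[OF measurable_Pair[OF that] this] show ?thesis by simp
  qed
  have subm[measurable]: "(\<lambda>x. sub (f x) (g x)) \<in> measurable K N"
    if "f \<in> measurable K N" "g \<in> measurable K N" for K :: "'z measure" and f g
  proof -
    have "(\<lambda>p. sub (fst p) (snd p)) \<in> measurable (N \<Otimes>\<^sub>M N) N"
      unfolding sub_def N_def by measurable
    from measurable_compose[OF measurable_Pair[OF that] this] show ?thesis by simp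
  qed
  have addm1[measurable]: "add y \<in> measurable N N" for y
    unfolding add_def N_def by measurable
  have addI1[measurable]: "addI y \<in> measurable M M" for y
    unfolding addI_def M_def by measurable
  have trans: "(\<integral>\<^sup>+x. f (add y x) \<partial>N) = (\<integral>\<^sup>+x. f x \<partial>N)" if "f \<in> borel_measurable N" for f y
    using nn_integral_PiM_lborel_affine[OF J, of 1 f y] that by (simp add: N_def add_def)
  have transI: "(\<integral>\<^sup>+x. f (addI y x) \<partial>M) = (\<integral>\<^sup>+x. f x \<partial>M)" if "f \<in> borel_measurable M" for f y
    using nn_integral_PiM_lborel_affine[OF I, of 1 f y] that by (simp add: M_def addI_def)
  have refl: "(\<integral>\<^sup>+x. f (sub y x) \<partial>N) = (\<integral>\<^sup>+x. f x \<partial>N)" if "f \<in> borel_measurable N" for f y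
    using nn_integral_PiM_lborel_affine[OF J, of "-1" f y] that by (simp add: N_def sub_def)
  have TU: "T (U x) = x" if x: "x \<in> J \<rightarrow>\<^sub>E UNIV" for x
  proof
    fix j
    show "T (U x) j = x j"
    proof (cases "j \<in> J")
      case True
      have "T (U x) j = (\<Sum>k\<in>I. (\<Sum>i\<in>J. x i * real_of_int (Q i k)) * of_int (P k j))"
        using True by (simp add: T_def U_def)
      also have "\<dots> = (\<Sum>i\<in>J. x i * of_int (\<Sum>k\<in>I. Q i k * P k j))"
        by (simp add: sum_distrib_right sum_distrib_left mult.assoc) (rule sum.swap)
      also have "\<dots> = (\<Sum>i\<in>J. x i * (if i = j then 1 else 0))"
        using True by (intro sum.cong) (auto simp: QP)
      also have "\<dots> = x j" using True J by (simp add: if_distrib cong: if_cong)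
      finally show ?thesis .
    next
      case False
      then show ?thesis using x by (auto simp: T_def)
    qed
  qed
  have Tadd: "T (addI x y) = add (T x) (T y)" for x y
    by (auto simp: T_def add_def addI_def algebra_simps sum.distrib)
  have vimage: "emeasure M {x \<in> space M. g x \<in> A} = (\<integral>\<^sup>+x. indicator A (g x) \<partial>M)"
    if g: "g \<in> measurable M K" and A: "A \<in> sets K" for g A and M :: "'x measure" and K :: "'y measure"
  proof -
    have "{x \<in> space M. g x \<in> A} \<in> sets M"
      using measurable_sets[OF g A] by (simp add: vimage_def Int_def conj_commute)
    then have "emeasure M {x \<in> space M. g x \<in> A} = (\<integral>\<^sup>+x. indicator {x \<in> space M. g x \<in> A} x \<partial>M)"
      by simp
    also have "\<dots> = (\<integral>\<^sup>+x. indicator A (g x) \<partial>M)"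
      by (intro nn_integral_cong) (simp add: indicator_def)
    finally show ?thesis .
  qed
  \<comment> \<open>Uniqueness of Haar measure by hand. With \<open>B\<close> the unit cube, it says
    that the preimage of \<open>A\<close> under \<open>T\<close> has the measure of \<open>A\<close>
    times that of the preimage of the cube. Both sides are evaluations of one double
    integral.\<close>
  have haar: "emeasure M {x \<in> space M. T x \<in> A} * emeasure N B = emeasure M {x \<in> space M. T x \<in> B} * emeasure N A"
    if A[measurable]: "A \<in> sets N" and B[measurable]: "B \<in> sets N" for A B
  proof -
    have "emeasure M {x \<in> space M. T x \<in> A} * emeasure N B = (\<integral>\<^sup>+u. indicator A (T u) * emeasure N B \<partial>M)"
      by (subst nn_integral_multc) (simp_all add: vimage[OF Tm])
    also have "\<dots> = (\<integral>\<^sup>+u. (\<integral>\<^sup>+x. indicator A (T u) * indicator B (add (T u) x) \<partial>N) \<partial>M)"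
    proof (rule nn_integral_cong)
      fix u assume u[measurable]: "u \<in> space M"
      have [measurable]: "T u \<in> space N" using u by (rule measurable_space[OF Tm])
      have "(\<integral>\<^sup>+x. indicator B (add (T u) x) \<partial>N) = emeasure N B"
        by (subst trans) auto
      moreover have "(\<lambda>x. indicator B (add (T u) x) :: ennreal) \<in> borel_measurable N"
        by measurable
      ultimately show "indicator A (T u) * emeasure N B = (\<integral>\<^sup>+x. indicator A (T u) * indicator B (add (T u) x) \<partial>N)"
        by (subst nn_integral_cmult) auto
    qed
    also have "\<dots> = (\<integral>\<^sup>+x. (\<integral>\<^sup>+u. indicator A (T u) * indicator B (add (T u) x) \<partial>M) \<partial>N)"
      by (rule NM.Fubini') measurable
    \<comment> \<open>Translating \<open>u\<close> by \<open>U x\<close> translates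
      \<open>T u\<close> by \<open>x\<close>, because \<open>T (U x) = x\<close>. This moves the
      dependence on \<open>x\<close> from the factor of \<open>B\<close> to that of
      \<open>A\<close>, where integration over \<open>x\<close> yields the measure of
      \<open>A\<close>.\<close>
    also have "\<dots> = (\<integral>\<^sup>+x. (\<integral>\<^sup>+u. indicator A (sub (T u) x) * indicator B (T u) \<partial>M) \<partial>N)"
    proof (rule nn_integral_cong)
      fix x assume x[measurable]: "x \<in> space N"
      have "(\<integral>\<^sup>+u. indicator A (sub (T u) x) * indicator B (T u) \<partial>M)
        = (\<integral>\<^sup>+u. indicator A (sub (T (addI (U x) u)) x) * indicator B (T (addI (U x) u)) \<partial>M)"
        by (rule transI[symmetric]) measurable
      also have "\<dots> = (\<integral>\<^sup>+u. indicator A (T u) * indicator B (add (T u) x) \<partial>M)"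
      proof (rule nn_integral_cong)
        fix u
        have "T (addI (U x) u) = add (T u) x"
          using x by (simp add: Tadd TU spN) (simp add: add_def add.commute)
        moreover have "sub (add (T u) x) x = T u"
          by (auto simp: sub_def add_def T_def)
        ultimately show "indicator A (sub (T (addI (U x) u)) x) * indicator B (T (addI (U x) u))
          = (indicator A (T u) * indicator B (add (T u) x) :: ennreal)" by simp
      qed
      finally show "(\<integral>\<^sup>+u. indicator A (T u) * indicator B (add (T u) x) \<partial>M)
          = (\<integral>\<^sup>+u. indicator A (sub (T u) x) * indicator B (T u) \<partial>M)" by simp
    qed
    also have "\<dots> = (\<integral>\<^sup>+u. (\<integral>\<^sup>+x. indicator A (sub (T u) x) * indicator B (T u) \<partial>N) \<partial>M)"
      by (rule MN.Fubini') measurable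
    also have "\<dots> = (\<integral>\<^sup>+u. emeasure N A * indicator B (T u) \<partial>M)"
    proof (rule nn_integral_cong)
      fix u assume u[measurable]: "u \<in> space M"
      have [measurable]: "T u \<in> space N" using u by (rule measurable_space[OF Tm])
      have "(\<integral>\<^sup>+x. indicator A (sub (T u) x) \<partial>N) = emeasure N A"
        by (subst refl) auto
      moreover have "(\<lambda>x. indicator A (sub (T u) x) :: ennreal) \<in> borel_measurable N"
        by measurable
      ultimately show "(\<integral>\<^sup>+x. indicator A (sub (T u) x) * indicator B (T u) \<partial>N) = emeasure N A * indicator B (T u)"
        by (subst nn_integral_multc) auto
    qed
    also have "\<dots> = emeasure M {x \<in> space M. T x \<in> B} * emeasure N A"
      by (subst nn_integral_cmult) (simp_all add: vimage[OF Tm] mult.commute)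
    finally show ?thesis .
  qed
  \<comment> \<open>Integer translates of a unit cube tile the space. The tiling of the source by
    translates of \<open>CI\<close> is inserted as a sum equal to 1, each translation is moved over
    to the factor with \<open>T\<close>, and there the sum runs over the tiling of the target by
    translates of \<open>C\<close>, because \<open>T\<close> maps integer vectors bijectively to
    integer vectors. What remains is the measure of \<open>CI\<close>.\<close>
  have TC: "emeasure M {x \<in> space M. T x \<in> C} = 1"
  proof -
    define em where "em = (\<lambda>z. \<lambda>i\<in>I. - real_of_int (z i))"
    have Zc: "countable Z" unfolding Z_def by (intro countable_PiE I) auto
    define emJ where "emJ = (\<lambda>z. \<lambda>i\<in>J. - real_of_int (z i))"
    have unique: "\<exists>!z. z \<in> (I \<rightarrow>\<^sub>E UNIV) \<and> (\<lambda>i\<in>I. (\<lambda>i\<in>I. - real_of_int (z i)) i + x i) \<in> (I \<rightarrow>\<^sub>E {0..<1})"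
      for x and I :: "'k set"
    proof (rule ex1I[of _ "\<lambda>i\<in>I. \<lfloor>x i\<rfloor>"])
      show "(\<lambda>i\<in>I. \<lfloor>x i\<rfloor>) \<in> (I \<rightarrow>\<^sub>E UNIV) \<and>
          (\<lambda>i\<in>I. (\<lambda>i\<in>I. - real_of_int ((\<lambda>i\<in>I. \<lfloor>x i\<rfloor>) i)) i + x i) \<in> (I \<rightarrow>\<^sub>E {0..<1})"
        by auto linarith+
      fix z assume z: "z \<in> (I \<rightarrow>\<^sub>E UNIV) \<and>
        (\<lambda>i\<in>I. (\<lambda>i\<in>I. - real_of_int (z i)) i + x i) \<in> (I \<rightarrow>\<^sub>E {0..<1})"
      show "z = (\<lambda>i\<in>I. \<lfloor>x i\<rfloor>)"
      proof
        fix i show "z i = (\<lambda>i\<in>I. \<lfloor>x i\<rfloor>) i"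
        proof (cases "i \<in> I")
          case True
          then have "- real_of_int (z i) + x i \<in> {0..<1}"
            using z by (auto simp: PiE_iff)
          then show ?thesis using True by (auto simp: floor_eq_iff) linarith
        qed (use z in \<open>auto simp: PiE_iff extensional_def\<close>)
      qed
    qed
    have uniqueI: "\<exists>!z. z \<in> Z \<and> addI (em z) x \<in> CI" for x
      using unique[of I x] by (simp add: Z_def addI_def em_def CI_def)
    have uniqueJ: "\<exists>!z. z \<in> ZJ \<and> add (emJ z) x \<in> C" for x
      using unique[of J x] by (simp add: ZJ_def add_def emJ_def C_def)
    have one: "(\<integral>\<^sup>+z. g z \<partial>count_space Z) = 1"
      if "\<exists>!z. z \<in> Z \<and> p z" "\<And>z. z \<in> Z \<Longrightarrow> g z = (if p z then 1 else 0)" for p and g :: "_ \<Rightarrow> ennreal"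
    proof -
      from that(1) obtain z0 where "z0 \<in> Z \<and> p z0" "\<forall>z. z \<in> Z \<and> p z \<longrightarrow> z = z0"
        by (elim ex1E)
      then have z0: "z0 \<in> Z" "p z0" "\<And>z. z \<in> Z \<Longrightarrow> p z \<Longrightarrow> z = z0" by blast+
      have "(\<integral>\<^sup>+z. g z \<partial>count_space Z) = (\<integral>\<^sup>+z. indicator {z0} z \<partial>count_space Z)"
      proof (rule nn_integral_cong)
        fix z assume "z \<in> space (count_space Z)"
        then have "z \<in> Z" by simp
        then have "g z = (if p z then 1 else 0)" by (rule that(2))
        moreover have "p z \<longleftrightarrow> z = z0" using z0 \<open>z \<in> Z\<close> by blast
        ultimately show "g z = indicator {z0} z" by (simp only: indicator_def of_bool_def singleton_iff)
      qed
      also have "\<dots> = 1" using z0(1) by (subst nn_integral_indicator) auto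
      finally show ?thesis .
    qed
    define neg where "neg = (\<lambda>z. \<lambda>i\<in>I. - (z i :: int))"
    have emneg: "addI (em (neg z)) (addI (em z) x) = x" if "x \<in> space M" for x z
      using that by (intro ext) (auto simp: addI_def em_def neg_def spM PiE_iff extensional_def)
    have "emeasure M {x \<in> space M. T x \<in> C} = (\<integral>\<^sup>+x. indicator C (T x) \<partial>M)"
      by (rule vimage[OF Tm Cm])
    also have "\<dots> = (\<integral>\<^sup>+x. (\<integral>\<^sup>+z. indicator C (T x) * indicator CI (addI (em z) x) \<partial>count_space Z) \<partial>M)"
    proof (rule nn_integral_cong)
      fix x
      have "(\<integral>\<^sup>+z. indicator CI (addI (em z) x) \<partial>count_space Z) = (1::ennreal)"
        by (rule one[OF uniqueI[of x]]) (auto simp: indicator_def)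
      then show "indicator C (T x) = (\<integral>\<^sup>+z. indicator C (T x) * indicator CI (addI (em z) x) \<partial>count_space Z :: ennreal)"
        by (subst nn_integral_cmult) auto
    qed
    also have "\<dots> = (\<integral>\<^sup>+z. (\<integral>\<^sup>+x. indicator C (T x) * indicator CI (addI (em z) x) \<partial>M) \<partial>count_space Z)"
      by (rule nn_integral_count_space_nn_integral[OF Zc]) measurable
    also have "\<dots> = (\<integral>\<^sup>+z. (\<integral>\<^sup>+x. indicator C (T (addI (em (neg z)) x)) * indicator CI x \<partial>M) \<partial>count_space Z)"
    proof (rule nn_integral_cong)
      fix z
      have "(\<integral>\<^sup>+x. indicator C (T (addI (em (neg z)) x)) * indicator CI x \<partial>M)
        = (\<integral>\<^sup>+x. indicator C (T (addI (em (neg z)) (addI (em z) x))) * indicator CI (addI (em z) x) \<partial>M :: ennreal)"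
        by (rule transI[symmetric]) measurable
      also have "\<dots> = (\<integral>\<^sup>+x. indicator C (T x) * indicator CI (addI (em z) x) \<partial>M)"
        by (intro nn_integral_cong) (simp add: emneg)
      finally show "(\<integral>\<^sup>+x. indicator C (T x) * indicator CI (addI (em z) x) \<partial>M)
        = (\<integral>\<^sup>+x. indicator C (T (addI (em (neg z)) x)) * indicator CI x \<partial>M :: ennreal)" by simp
    qed
    also have "\<dots> = (\<integral>\<^sup>+x. (\<integral>\<^sup>+z. indicator C (T (addI (em (neg z)) x)) * indicator CI x \<partial>count_space Z) \<partial>M)"
      by (rule nn_integral_count_space_nn_integral[OF Zc, symmetric]) measurable
    also have "\<dots> = (\<integral>\<^sup>+x. indicator CI x \<partial>M)"
    proof (rule nn_integral_cong)
      fix x assume x: "x \<in> space M"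
      \<comment> \<open>\<open>emJ\<close> subtracts its argument while the vector \<open>z\<close>
        is added here; the minus sign in \<open>Tz\<close> accounts for this. \<open>Tz\<close> and
        \<open>Uz\<close> are still inverse to each other, as the two signs cancel.\<close>
      define Tz where "Tz = (\<lambda>z. \<lambda>j\<in>J. - (\<Sum>i\<in>I. z i * P i j))"
      define Uz where "Uz = (\<lambda>z. \<lambda>j\<in>I. - (\<Sum>i\<in>J. z i * Q i j))"
      have Tem: "T (addI (em (neg z)) x) = add (emJ (Tz z)) (T x)" for z
        unfolding T_def add_def addI_def em_def emJ_def neg_def Tz_def
        by (intro ext) (simp add: sum_negf algebra_simps sum.distrib)
      have TzUz: "Tz (Uz z) = z" if "z \<in> ZJ" for z
      proof
        fix j show "Tz (Uz z) j = z j"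
        proof (cases "j \<in> J")
          case True
          have "Tz (Uz z) j = (\<Sum>k\<in>I. (\<Sum>i\<in>J. z i * Q i k) * P k j)"
            using True by (simp add: Tz_def Uz_def sum_negf)
          also have "\<dots> = (\<Sum>i\<in>J. z i * (\<Sum>k\<in>I. Q i k * P k j))"
            by (simp add: sum_distrib_right sum_distrib_left mult.assoc) (rule sum.swap)
          also have "\<dots> = (\<Sum>i\<in>J. z i * (if i = j then 1 else 0))"
            using True by (intro sum.cong) (auto simp: QP)
          finally show ?thesis using True J by (simp add: if_distrib cong: if_cong)
        next
          case False then show ?thesis using that by (auto simp: Tz_def ZJ_def)
        qed
      qed
      have UzTz: "Uz (Tz z) = z" if "z \<in> Z" for z
      proof
        fix j show "Uz (Tz z) j = z j"
        proof (cases "j \<in> I")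
          case True
          have "Uz (Tz z) j = (\<Sum>k\<in>J. (\<Sum>i\<in>I. z i * P i k) * Q k j)"
            using True by (simp add: Tz_def Uz_def sum_negf)
          also have "\<dots> = (\<Sum>i\<in>I. z i * (\<Sum>k\<in>J. P i k * Q k j))"
            by (simp add: sum_distrib_right sum_distrib_left mult.assoc) (rule sum.swap)
          also have "\<dots> = (\<Sum>i\<in>I. z i * (if i = j then 1 else 0))"
            using True by (intro sum.cong) (auto simp: PQ)
          finally show ?thesis using True I by (simp add: if_distrib cong: if_cong)
        next
          case False then show ?thesis using that by (auto simp: Uz_def Z_def)
        qed
      qed
      have TU_Z: "Tz z \<in> ZJ" "Uz z' \<in> Z" for z z'
        by (auto simp: Tz_def Uz_def Z_def ZJ_def)
      from uniqueJ[of "T x"] obtain w where w: "w \<in> ZJ \<and> add (emJ w) (T x) \<in> C"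
        and w': "\<forall>z. z \<in> ZJ \<and> add (emJ z) (T x) \<in> C \<longrightarrow> z = w"
        by (elim ex1E)
      have "\<exists>!z. z \<in> Z \<and> add (emJ (Tz z)) (T x) \<in> C"
      proof (rule ex1I)
        have "Tz (Uz w) = w" using w by (intro TzUz) blast
        then show "Uz w \<in> Z \<and> add (emJ (Tz (Uz w))) (T x) \<in> C" using w TU_Z(2) by simp
        fix z assume z: "z \<in> Z \<and> add (emJ (Tz z)) (T x) \<in> C"
        then have "Tz z \<in> ZJ \<and> add (emJ (Tz z)) (T x) \<in> C" using TU_Z(1)[of z] by (intro conjI) simp_all
        with w' have "Tz z = w" by (elim allE impE)
        moreover have "Uz (Tz z) = z" using z by (intro UzTz) simp
        ultimately show "z = Uz w" by simp
      qed
      then have "(\<integral>\<^sup>+z. indicator C (T (addI (em (neg z)) x)) \<partial>count_space Z) = (1::ennreal)"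
        by (rule one) (auto simp: indicator_def Tem)
      then show "(\<integral>\<^sup>+z. indicator C (T (addI (em (neg z)) x)) * indicator CI x \<partial>count_space Z) = (indicator CI x :: ennreal)"
        by (subst nn_integral_multc) auto
    qed
    also have "\<dots> = 1" using MC by simp
    finally show ?thesis .
  qed
  have S'[measurable]: "S \<in> sets N" using S by (simp add: N_def)
  define S' where "S' = {x \<in> space N. add y x \<in> S}"
  have S'm[measurable]: "S' \<in> sets N"
    unfolding S'_def using measurable_sets[OF addm1 S'] by (simp add: vimage_def Int_def conj_commute)
  have "{x \<in> I \<rightarrow>\<^sub>E UNIV. (\<lambda>j\<in>J. y j + (\<Sum>i\<in>I. x i * of_int (P i j))) \<in> S} = {x \<in> space M. T x \<in> S'}"
    by (auto simp: spM spN S'_def T_def add_def cong: restrict_cong)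
  also have "emeasure M \<dots> = emeasure N S'"
    using haar[of S' C] NC TC by simp
  also have "\<dots> = (\<integral>\<^sup>+x. indicator S (add y x) \<partial>N)"
    unfolding S'_def by (rule vimage[OF addm1 S'])
  also have "\<dots> = emeasure N S" by (subst trans) auto
  finally show ?thesis by (simp add: M_def N_def)
qed

section \<open>Volumes of products of open simplices, one for each block of coordinates\<close>

lemma sets_PiM_block_simplex:
  fixes L :: "'c \<Rightarrow> real" and blk :: "'b \<Rightarrow> 'c"
  assumes J: "finite J" and K: "finite K"
  shows "{x \<in> J \<rightarrow>\<^sub>E UNIV. (\<forall>i\<in>J. 0 < x i) \<and> (\<forall>c\<in>K. (\<Sum>i | i \<in> J \<and> blk i = c. x i) < L c)}
    \<in> sets (\<Pi>\<^sub>M i\<in>J. lborel)"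
proof -
  have comp: "(\<lambda>x. x i) \<in> borel_measurable (\<Pi>\<^sub>M i\<in>J. lborel :: real measure)" if "i \<in> J" for i
    using measurable_component_singleton[OF that, of "\<lambda>_. lborel :: real measure"] by simp
  have "{x \<in> space (\<Pi>\<^sub>M i\<in>J. lborel). (\<forall>i\<in>J. 0 < x i) \<and> (\<forall>c\<in>K. (\<Sum>i | i \<in> J \<and> blk i = c. x i) < L c)}
     \<in> sets (\<Pi>\<^sub>M i\<in>J. lborel)"
    using J K
    by (intro sets.sets_Collect_conj sets.sets_Collect_finite_All borel_measurable_less
        borel_measurable_sum borel_measurable_const) (auto intro: comp)
  then show ?thesis by (simp add: space_PiM)
qed

text \<open>Induction on the coordinates with Tonelli: fixing the new coordinate at \<open>y\<close>
  lowers the bound of its block from \<open>L c0\<close> to \<open>L c0 - y\<close> and leaves the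
  other blocks alone, and integrating \<open>(L c0 - y) ^ n / n!\<close> over \<open>y\<close> gives
  \<open>L c0 ^ (n + 1) / (n + 1)!\<close>. The bounds \<open>L\<close> change from step to step and
  are therefore generalised.\<close>

lemma emeasure_PiM_block_simplex:
  fixes L :: "'c \<Rightarrow> real" and blk :: "'b \<Rightarrow> 'c"
  assumes "finite I" and K: "finite K" and "blk ` I \<subseteq> K" and "\<And>c. c \<in> K \<Longrightarrow> 0 < L c"
  shows "emeasure (\<Pi>\<^sub>M i\<in>I. lborel)
      {x \<in> I \<rightarrow>\<^sub>E UNIV. (\<forall>i\<in>I. 0 < x i) \<and> (\<forall>c\<in>K. (\<Sum>i | i \<in> I \<and> blk i = c. x i) < L c)}
    = ennreal (\<Prod>c\<in>K. L c ^ card {i \<in> I. blk i = c} / fact (card {i \<in> I. blk i = c}))"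
  using assms(1,3,4)
proof (induction I arbitrary: L rule: finite_induct)
  case empty
  interpret product_sigma_finite "\<lambda>_::'b. lborel :: real measure" ..
  have "{x. x = (\<lambda>k::'b. undefined :: real) \<and> (\<forall>c\<in>K. 0 < L c)} = {\<lambda>k. undefined}"
    using empty by auto
  then show ?case by (simp add: PiM_empty)
next
  case (insert i0 I)
  interpret product_sigma_finite "\<lambda>_::'b. lborel :: real measure" ..
  define c0 where "c0 = blk i0"
  have c0: "c0 \<in> K" and L0: "0 < L c0" using insert by (auto simp: c0_def)
  define G where "G = (\<lambda>I L. \<Prod>c\<in>K. L c ^ card {i \<in> I. blk i = c} / fact (card {i \<in> I. blk i = c}) :: real)"
  define S where "S = (\<lambda>I L. {x \<in> I \<rightarrow>\<^sub>E UNIV. (\<forall>i\<in>I. 0 < x i) \<and> (\<forall>c\<in>K. (\<Sum>i | i \<in> I \<and> blk i = c. x i) < (L c :: real))})"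
  have Sm: "S J L' \<in> sets (\<Pi>\<^sub>M i\<in>J. lborel)" if J: "finite J" for J L'
    unfolding S_def using J K by (rule sets_PiM_block_simplex)
  define n where "n = card {i \<in> I. blk i = c0}"
  define R where "R = (\<Prod>c\<in>K - {c0}. L c ^ card {i \<in> I. blk i = c} / fact (card {i \<in> I. blk i = c}))"
  have GI: "G I L' = R * (L' c0 ^ n / fact n)" if "\<And>c. c \<noteq> c0 \<Longrightarrow> L' c = L c" for L'
    unfolding G_def R_def n_def using c0 K that by (subst prod.remove[of _ c0]) (auto intro!: prod.cong)
  have R0: "R \<ge> 0" unfolding R_def using insert by (intro prod_nonneg) (auto intro!: less_imp_le)
  have ins: "{i \<in> insert i0 I. blk i = c} = (if c = c0 then insert i0 {i \<in> I. blk i = c} else {i \<in> I. blk i = c})" for c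
    by (auto simp: c0_def)
  have cards: "card {i \<in> insert i0 I. blk i = c}
      = (if c = c0 then Suc (card {i \<in> I. blk i = c}) else card {i \<in> I. blk i = c})" for c
    using insert(1,2) unfolding ins by simp
  have GI': "G (insert i0 I) L = R * (L c0 ^ Suc n / fact (Suc n))"
    unfolding G_def R_def n_def cards using c0 K by (subst prod.remove[of _ c0]) auto
  have inner: "emeasure (\<Pi>\<^sub>M i\<in>I. lborel) {x \<in> I \<rightarrow>\<^sub>E UNIV. x(i0 := y) \<in> S (insert i0 I) L}
      = (if 0 < y \<and> y < L c0 then ennreal (R * ((L c0 - y) ^ n / fact n)) else 0)" for y
  proof -
    have nonneg: "(\<Sum>i | i \<in> I \<and> blk i = c0. x i) \<ge> 0" if "\<forall>i\<in>I. 0 < x i" for x :: "'b \<Rightarrow> real"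
      using that by (intro sum_nonneg) (auto intro: less_imp_le)
    have sum': "(\<Sum>i | i \<in> insert i0 I \<and> blk i = c. (x(i0 := y)) i)
        = (if c = c0 then y else 0) + (\<Sum>i | i \<in> I \<and> blk i = c. x i)" for x :: "'b \<Rightarrow> real" and c
    proof -
      have "(\<Sum>i | i \<in> I \<and> blk i = c. (x(i0 := y)) i) = (\<Sum>i | i \<in> I \<and> blk i = c. x i)"
        using insert(2) by (intro sum.cong) auto
      then show ?thesis
        using insert(1,2) by (simp only: ins) auto
    qed
    have eq: "{x \<in> I \<rightarrow>\<^sub>E UNIV. x(i0 := y) \<in> S (insert i0 I) L}
      = (if 0 < y \<and> y < L c0 then S I (L(c0 := L c0 - y)) else {})"
    proof (cases "0 < y \<and> y < L c0")
      case True
      have "x(i0 := y) \<in> S (insert i0 I) L \<longleftrightarrow> x \<in> S I (L(c0 := L c0 - y))" if x: "x \<in> I \<rightarrow>\<^sub>E UNIV" for x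
      proof -
        have "x(i0 := y) \<in> insert i0 I \<rightarrow>\<^sub>E UNIV" using x by (auto simp: PiE_iff extensional_def)
        moreover have "(\<forall>i\<in>insert i0 I. 0 < (x(i0 := y)) i) \<longleftrightarrow> (\<forall>i\<in>I. 0 < x i)"
          using True insert(2) by auto
        moreover have "(\<forall>c\<in>K. (if c = c0 then y else 0) + (\<Sum>i | i \<in> I \<and> blk i = c. x i) < L c)
          \<longleftrightarrow> (\<forall>c\<in>K. (\<Sum>i | i \<in> I \<and> blk i = c. x i) < (L(c0 := L c0 - y)) c)"
          by (intro ball_cong) auto
        ultimately show ?thesis using x unfolding S_def mem_Collect_eq sum' by blast
      qed
      moreover have "S I (L(c0 := L c0 - y)) \<subseteq> I \<rightarrow>\<^sub>E UNIV" by (auto simp: S_def)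
      ultimately have "{x \<in> I \<rightarrow>\<^sub>E UNIV. x(i0 := y) \<in> S (insert i0 I) L} = S I (L(c0 := L c0 - y))"
        by blast
      then show ?thesis using True by (simp only: if_True simp_thms)
    next
      case False
      have "x(i0 := y) \<notin> S (insert i0 I) L" for x
      proof
        assume x: "x(i0 := y) \<in> S (insert i0 I) L"
        then have "0 < y" by (auto simp: S_def)
        moreover have "\<forall>i\<in>I. 0 < x i" using x insert(2) by (auto simp: S_def split: if_splits)
        then have "0 \<le> (\<Sum>i | i \<in> I \<and> blk i = c0. x i)" by (rule nonneg)
        moreover have "y + (\<Sum>i | i \<in> I \<and> blk i = c0. x i) < L c0"
          using x c0 unfolding S_def mem_Collect_eq sum' by auto
        ultimately show False using False by auto
      qed
      then show ?thesis using False by (auto simp: S_def)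
    qed
    show ?thesis
    proof (cases "0 < y \<and> y < L c0")
      case True
      have "emeasure (\<Pi>\<^sub>M i\<in>I. lborel) (S I (L(c0 := L c0 - y))) = ennreal (G I (L(c0 := L c0 - y)))"
        unfolding S_def G_def using insert.prems True by (intro insert.IH) auto
      then show ?thesis using True by (simp add: eq GI)
    next
      case False
      then show ?thesis by (simp only: eq False if_False emeasure_empty)
    qed
  qed
  have "emeasure (\<Pi>\<^sub>M i\<in>insert i0 I. lborel) (S (insert i0 I) L)
      = (\<integral>\<^sup>+x. indicator (S (insert i0 I) L) x \<partial>(\<Pi>\<^sub>M i\<in>insert i0 I. lborel))"
    using insert(1) by (intro nn_integral_indicator[symmetric] Sm) simp
  also have "\<dots> = (\<integral>\<^sup>+y. (\<integral>\<^sup>+x. indicator (S (insert i0 I) L) (x(i0 := y)) \<partial>(\<Pi>\<^sub>M i\<in>I. lborel)) \<partial>lborel)"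
    using insert(1,2) by (intro product_nn_integral_insert_rev) (auto intro!: borel_measurable_indicator Sm)
  also have "\<dots> = (\<integral>\<^sup>+y. emeasure (\<Pi>\<^sub>M i\<in>I. lborel) {x \<in> I \<rightarrow>\<^sub>E UNIV. x(i0 := y) \<in> S (insert i0 I) L} \<partial>lborel)"
  proof (rule nn_integral_cong)
    fix y :: real
    have "{x \<in> I \<rightarrow>\<^sub>E UNIV. x(i0 := y) \<in> S (insert i0 I) L}
        = (\<lambda>x. x(i0 := y)) -` S (insert i0 I) L \<inter> space (\<Pi>\<^sub>M i\<in>I. lborel)"
      by (auto simp: space_PiM)
    also have "\<dots> \<in> sets (\<Pi>\<^sub>M i\<in>I. lborel)"
    proof (rule measurable_sets[OF _ Sm])
      show "(\<lambda>x. x(i0 := y)) \<in> measurable (\<Pi>\<^sub>M i\<in>I. lborel) (\<Pi>\<^sub>M i\<in>insert i0 I. lborel)"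
        by measurable
    qed (use insert in simp)
    finally have "{x \<in> I \<rightarrow>\<^sub>E UNIV. x(i0 := y) \<in> S (insert i0 I) L} \<in> sets (\<Pi>\<^sub>M i\<in>I. lborel)" .
    then have "emeasure (\<Pi>\<^sub>M i\<in>I. lborel) {x \<in> I \<rightarrow>\<^sub>E UNIV. x(i0 := y) \<in> S (insert i0 I) L}
      = (\<integral>\<^sup>+x. indicator {x \<in> I \<rightarrow>\<^sub>E UNIV. x(i0 := y) \<in> S (insert i0 I) L} x \<partial>(\<Pi>\<^sub>M i\<in>I. lborel))"
      by simp
    also have "\<dots> = (\<integral>\<^sup>+x. indicator (S (insert i0 I) L) (x(i0 := y)) \<partial>(\<Pi>\<^sub>M i\<in>I. lborel))"
      by (rule nn_integral_cong) (simp add: indicator_def space_PiM)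
    finally show "(\<integral>\<^sup>+x. indicator (S (insert i0 I) L) (x(i0 := y)) \<partial>(\<Pi>\<^sub>M i\<in>I. lborel))
      = emeasure (\<Pi>\<^sub>M i\<in>I. lborel) {x \<in> I \<rightarrow>\<^sub>E UNIV. x(i0 := y) \<in> S (insert i0 I) L}" by simp
  qed
  \<comment> \<open>The slice formula holds on an open interval, the fundamental theorem of calculus
    is applied on the closed one; the two endpoints form a null set.\<close>
  also have "\<dots> = (\<integral>\<^sup>+y. ennreal (R * ((L c0 - y) ^ n / fact n)) * indicator {0..L c0} y \<partial>lborel)"
  proof (rule nn_integral_cong_AE)
    show "AE y in lborel. emeasure (\<Pi>\<^sub>M i\<in>I. lborel) {x \<in> I \<rightarrow>\<^sub>E UNIV. x(i0 := y) \<in> S (insert i0 I) L}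
       = ennreal (R * ((L c0 - y) ^ n / fact n)) * indicator {0..L c0} y"
      using AE_lborel_singleton[of 0] AE_lborel_singleton[of "L c0"]
      by eventually_elim (auto simp: inner indicator_def)
  qed
  also have "\<dots> = ennreal (- R * (L c0 - L c0) ^ Suc n / fact (Suc n) - (- R * (L c0 - 0) ^ Suc n / fact (Suc n)))"
  proof -
    have "((\<lambda>y. - R * (L c0 - y) ^ Suc n / fact (Suc n)) has_real_derivative R * ((L c0 - y) ^ n / fact n)) (at y)" for y
      by (rule derivative_eq_intros refl | simp)+
    then show ?thesis
      using L0 R0
      by (intro nn_integral_FTC_Icc[where F = "\<lambda>y. - R * (L c0 - y) ^ Suc n / fact (Suc n)"])
         (auto intro: has_field_derivative_at_within)
  qed
  also have "\<dots> = ennreal (G (insert i0 I) L)"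
    by (simp add: GI')
  finally show ?case by (simp add: S_def G_def)
qed

text \<open>In each block the entry at the representative \<open>rep c\<close> is determined by the
  block sum and the other entries. Coordinates on the set \<open>F\<close> of non-representatives
  thus identify the real kernel with real vectors on \<open>F\<close> and the integer kernel with
  integer vectors. In these coordinates any lattice basis is a matrix invertible over the integers,
  and positivity of the entry at \<open>rep c\<close> bounds the sum of the other entries of the
  block by \<open>L c\<close>: one open simplex for each block. Edges and boundaries are abstracted
  to a set with a block function so that the formulas fold into \<open>length_kernel\<close>,
  \<open>integer_kernel\<close> and \<open>lattice_basis\<close>.\<close>

lemma block_lattice_basis_and_volume:
  fixes E :: "'b set" and blk :: "'b \<Rightarrow> 'c"
  assumes E: "finite E"
  defines "Kr \<equiv> {m :: 'b \<Rightarrow> real. (\<forall>e. e \<notin> E \<longrightarrow> m e = 0) \<and> (\<forall>c\<in>blk ` E. (\<Sum>e | e \<in> E \<and> blk e = c. m e) = 0)}"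
  defines "Kz \<equiv> {m \<in> Kr. \<forall>e. m e \<in> \<int>}"
  defines "zb \<equiv> \<lambda>(d::nat) b. (\<forall>i<d. b i \<in> Kz) \<and>
     bij_betw (\<lambda>z e. \<Sum>i<d. of_int (z i) * b i e) ({..<d} \<rightarrow>\<^sub>E (UNIV :: int set)) Kz"
  shows "(\<exists>d b. zb d b) \<and>
    (\<forall>d b L m. zb d b \<longrightarrow> (\<forall>c\<in>blk ` E. 0 < L c) \<longrightarrow> (\<forall>e. e \<notin> E \<longrightarrow> m e = 0) \<longrightarrow>
      (\<forall>c\<in>blk ` E. (\<Sum>e | e \<in> E \<and> blk e = c. m e) = L c) \<longrightarrow>
      measure (\<Pi>\<^sub>M i\<in>{..<d}. lborel)
        {x \<in> {..<d} \<rightarrow>\<^sub>E UNIV. \<forall>e\<in>E. 0 < m e + (\<Sum>i<d. x i * b i e)}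
        = (\<Prod>c\<in>blk ` E. L c ^ (card {e \<in> E. blk e = c} - 1) / fact (card {e \<in> E. blk e = c} - 1)))"
proof -
  define K where "K = blk ` E"
  have K: "finite K" using E by (simp add: K_def)
  define rep where "rep = (\<lambda>c. SOME e. e \<in> E \<and> blk e = c)"
  have rep: "rep c \<in> E" "blk (rep c) = c" if "c \<in> K" for c
    using that someI_ex[of "\<lambda>e. e \<in> E \<and> blk e = c"] by (auto simp: rep_def K_def)
  define F where "F = {e \<in> E. rep (blk e) \<noteq> e}"
  have F: "finite F" using E by (simp add: F_def)
  have repF: "rep c \<notin> F" if "c \<in> K" for c using rep[OF that] by (auto simp: F_def)
  have Esplit: "{e \<in> E. blk e = c} = insert (rep c) {e \<in> F. blk e = c}" if "c \<in> K" for c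
    using rep[OF that] by (auto simp: F_def)
  have Ecases: "e \<in> F \<or> (\<exists>c\<in>K. e = rep c)" if "e \<in> E" for e
    using that by (cases "e \<in> F") (auto simp: F_def K_def intro!: bexI[of _ e])
  have sumE: "(\<Sum>e | e \<in> E \<and> blk e = c. m e) = m (rep c) + (\<Sum>e | e \<in> F \<and> blk e = c. m e)"
    if "c \<in> K" for c and m :: "'b \<Rightarrow> real"
  proof -
    have "{e. e \<in> E \<and> blk e = c} = insert (rep c) {e. e \<in> F \<and> blk e = c}"
      using Esplit[OF that] by simp
    then show ?thesis using repF[OF that] F by simp
  qed
  \<comment> \<open>The unit vector at \<open>f\<close> minus the unit vector at the representative
    of its block. Then \<open>lin x\<close> is the kernel vector that agrees with \<open>x\<close>
    on \<open>F\<close>.\<close>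
  define std where "std = (\<lambda>f e. if e = f then 1 else if e = rep (blk f) then -1 else 0 :: real)"
  define lin where "lin = (\<lambda>x e. \<Sum>f\<in>F. x f * std f e :: real)"
  have linF: "lin x e = x e" if "e \<in> F" for x e
  proof -
    have "lin x e = (\<Sum>f\<in>F. if e = f then x f else 0)"
      unfolding lin_def
    proof (rule sum.cong)
      fix f assume "f \<in> F"
      then have "e \<noteq> rep (blk f)" using that repF[of "blk f"] by (auto simp: K_def F_def)
      then show "x f * std f e = (if e = f then x f else 0)" by (auto simp: std_def)
    qed simp
    also have "\<dots> = x e" using that F by simp
    finally show ?thesis .
  qed
  have linrep: "lin x (rep c) = - (\<Sum>f | f \<in> F \<and> blk f = c. x f)" if "c \<in> K" for x c
  proof -
    have "lin x (rep c) = (\<Sum>f\<in>F. if blk f = c then - x f else 0)"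
      unfolding lin_def
    proof (rule sum.cong)
      fix f assume f: "f \<in> F"
      then have "rep c \<noteq> f" using that repF[of c] by auto
      moreover have "rep c = rep (blk f) \<longleftrightarrow> blk f = c"
      proof -
        have "blk f \<in> K" using f by (auto simp: F_def K_def)
        then show ?thesis using rep(2) that by metis
      qed
      ultimately show "x f * std f (rep c) = (if blk f = c then - x f else 0)" by (auto simp: std_def)
    qed simp
    also have "\<dots> = (\<Sum>f | f \<in> F \<and> blk f = c. - x f)"
      using F by (simp add: sum.inter_filter)
    finally show ?thesis by (simp add: sum_negf)
  qed
  have linout: "lin x e = 0" if "e \<notin> E" for x e
    unfolding lin_def
  proof (rule sum.neutral, intro ballI)
    fix f assume f: "f \<in> F"
    then have "e \<noteq> f" "e \<noteq> rep (blk f)" using that rep(1)[of "blk f"] by (auto simp: F_def K_def)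
    then show "x f * std f e = 0" by (simp add: std_def)
  qed
  have Kr: "m \<in> Kr \<longleftrightarrow> (\<forall>e. e \<notin> E \<longrightarrow> m e = 0) \<and> (\<forall>c\<in>K. (\<Sum>e | e \<in> E \<and> blk e = c. m e) = 0)" for m
    by (simp add: Kr_def K_def)
  have lin_Kr: "lin x \<in> Kr" for x
    unfolding Kr
  proof (intro conjI ballI allI impI)
    fix c assume c: "c \<in> K"
    have "(\<Sum>e | e \<in> F \<and> blk e = c. lin x e) = (\<Sum>e | e \<in> F \<and> blk e = c. x e)"
      by (intro sum.cong) (auto simp: linF)
    then show "(\<Sum>e | e \<in> E \<and> blk e = c. lin x e) = 0"
      by (simp add: sumE[OF c] linrep[OF c])
  qed (rule linout)
  have Kr_lin: "m = lin m" if m: "m \<in> Kr" for m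
  proof
    fix e show "m e = lin m e"
    proof (cases "e \<in> E")
      case True
      then consider "e \<in> F" | c where "c \<in> K" "e = rep c" using Ecases by blast
      then show ?thesis
      proof cases
        case 2
        then show ?thesis using m sumE[of c m] by (simp add: linrep Kr)
      qed (simp add: linF)
    next
      case False then show ?thesis using m by (simp add: linout Kr)
    qed
  qed
  have lin_int: "lin x e \<in> \<int>" if "\<And>f. f \<in> F \<Longrightarrow> x f \<in> \<int>" for x e
    unfolding lin_def using that by (intro Ints_sum Ints_mult) (auto simp: std_def)
  have std_lin: "std f = lin (\<lambda>e. if e = f then 1 else 0)" if "f \<in> F" for f
  proof
    fix e
    have "lin (\<lambda>e. if e = f then 1 else 0) e = (\<Sum>g\<in>F. if g = f then std f e else 0)"
      unfolding lin_def by (intro sum.cong) auto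
    then show "std f e = lin (\<lambda>e. if e = f then 1 else 0) e" using that F by simp
  qed
  have stdK: "std f \<in> Kz" if "f \<in> F" for f
    using std_lin[OF that] lin_Kr lin_int[of "\<lambda>e. if e = f then 1 else 0"] by (simp add: Kz_def)
  have ex: "\<exists>d b. zb d b"
  proof -
    obtain en where en: "bij_betw en {..<card F} F"
      using ex_bij_betw_nat_finite[OF F] by (auto simp: lessThan_atLeast0)
    define d where "d = card F"
    have enb: "bij_betw en {..<d} F" using en by (simp add: d_def)
    define ie where "ie = the_inv_into {..<d} en"
    have ie: "ie f < d" "en (ie f) = f" if "f \<in> F" for f
      using that the_inv_into_into[of en "{..<d}" f "{..<d}"] f_the_inv_into_f[of en "{..<d}" f] enb
      by (auto simp: ie_def bij_betw_def)
    have ei: "ie (en i) = i" "en i \<in> F" if "i < d" for i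
      using that enb by (auto simp: ie_def bij_betw_def the_inv_into_f_f)
    define b where "b = (\<lambda>i. std (en i))"
    have sumb: "(\<Sum>i<d. x i * b i e) = lin (\<lambda>f. x (ie f)) e" for x e
      unfolding lin_def b_def
      by (subst sum.reindex_bij_betw[OF enb, symmetric]) (auto intro!: sum.cong simp: ei)
    have "bij_betw (\<lambda>z e. \<Sum>i<d. of_int (z i) * b i e) ({..<d} \<rightarrow>\<^sub>E (UNIV :: int set)) Kz"
    proof (rule bij_betwI[where g = "\<lambda>m. \<lambda>i\<in>{..<d}. \<lfloor>m (en i)\<rfloor>"])
      show "(\<lambda>z e. \<Sum>i<d. of_int (z i) * b i e) \<in> ({..<d} \<rightarrow>\<^sub>E (UNIV :: int set)) \<rightarrow> Kz"
        unfolding sumb using lin_Kr lin_int by (auto simp: Kz_def)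
      show "(\<lambda>m. \<lambda>i\<in>{..<d}. \<lfloor>m (en i)\<rfloor>) \<in> Kz \<rightarrow> ({..<d} \<rightarrow>\<^sub>E (UNIV :: int set))" by auto
      show "(\<lambda>i\<in>{..<d}. \<lfloor>\<Sum>j<d. of_int (z j) * b j (en i)\<rfloor>) = z" if z: "z \<in> {..<d} \<rightarrow>\<^sub>E UNIV" for z :: "nat \<Rightarrow> int"
        unfolding sumb using z by (intro ext) (auto simp: linF ei PiE_iff extensional_def)
      show "(\<lambda>e. \<Sum>i<d. of_int ((\<lambda>i\<in>{..<d}. \<lfloor>m (en i)\<rfloor>) i) * b i e) = m" if m: "m \<in> Kz" for m
      proof -
        have "lin (\<lambda>f. of_int ((\<lambda>i\<in>{..<d}. \<lfloor>m (en i)\<rfloor>) (ie f))) = lin m"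
          unfolding lin_def using m by (intro ext sum.cong) (auto simp: ie Kz_def Ints_def)
        also have "\<dots> = m" using m Kr_lin[of m] by (simp add: Kz_def)
        finally show ?thesis unfolding sumb .
      qed
    qed
    moreover have "\<forall>i<d. b i \<in> Kz" using ei stdK by (auto simp: b_def)
    ultimately show ?thesis unfolding zb_def by (intro exI[of _ d] exI[of _ b] conjI)
  qed
  show ?thesis
  proof (intro conjI ex allI impI)
    fix d b and L :: "'c \<Rightarrow> real" and m :: "'b \<Rightarrow> real"
    assume zb: "zb d b" and L: "\<forall>c\<in>blk ` E. 0 < L c"
      and m0: "\<forall>e. e \<notin> E \<longrightarrow> m e = 0" and mL: "\<forall>c\<in>blk ` E. (\<Sum>e | e \<in> E \<and> blk e = c. m e) = L c"
    have bK: "b i \<in> Kz" if "i < d" for i using zb that by (auto simp: zb_def)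
    have bij: "bij_betw (\<lambda>z e. \<Sum>i<d. of_int (z i) * b i e) ({..<d} \<rightarrow>\<^sub>E (UNIV :: int set)) Kz"
      using zb by (auto simp: zb_def)
    \<comment> \<open>\<open>P\<close> holds the coordinates on \<open>F\<close> of the given basis,
      \<open>Q\<close> the integer coefficients of the vectors \<open>std f\<close> in that basis.
      One product is the identity by reading off coordinates on \<open>F\<close>, the other by
      uniqueness of coefficients in the basis.\<close>
    define P where "P = (\<lambda>i f. \<lfloor>b i f\<rfloor>)"
    have P: "of_int (P i f) = b i f" if "i < d" for i f
      using bK[OF that] by (auto simp: P_def Kz_def Ints_def)
    define Q where "Q = (\<lambda>f. SOME z. z \<in> {..<d} \<rightarrow>\<^sub>E (UNIV :: int set) \<and> (\<lambda>e. \<Sum>i<d. of_int (z i) * b i e) = std f)"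
    have Q: "Q f \<in> {..<d} \<rightarrow>\<^sub>E UNIV \<and> (\<lambda>e. \<Sum>i<d. of_int (Q f i) * b i e) = std f" if "f \<in> F" for f
    proof -
      have "std f \<in> (\<lambda>z e. \<Sum>i<d. of_int (z i) * b i e) ` ({..<d} \<rightarrow>\<^sub>E (UNIV :: int set))"
        using bij stdK[OF that] by (simp add: bij_betw_def)
      then have "\<exists>z. z \<in> {..<d} \<rightarrow>\<^sub>E (UNIV :: int set) \<and> (\<lambda>e. \<Sum>i<d. of_int (z i) * b i e) = std f" by auto
      from someI_ex[OF this] show ?thesis by (simp only: Q_def)
    qed
    have QP: "(\<Sum>k<d. Q f k * P k g) = (if f = g then 1 else 0)" if fg: "f \<in> F" "g \<in> F" for f g
    proof -
      have "real_of_int (\<Sum>k<d. Q f k * P k g) = (\<Sum>k<d. of_int (Q f k) * b k g)"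
        by (simp add: P)
      also have "\<dots> = std f g" by (rule fun_cong[OF conjunct2[OF Q[OF fg(1)]]])
      also have "\<dots> = of_int (if f = g then 1 else 0)"
        using fg repF[of "blk f"] by (auto simp: std_def F_def K_def)
      finally show ?thesis by (simp only: of_int_eq_iff)
    qed
    have PQ: "(\<Sum>f\<in>F. P i f * Q f j) = (if i = j then 1 else 0)" if ij: "i < d" "j < d" for i j
    proof -
      define z where "z = (\<lambda>j\<in>{..<d}. \<Sum>f\<in>F. P i f * Q f j)"
      have "(\<lambda>e. \<Sum>k<d. of_int (z k) * b k e) = b i"
      proof
        fix e
        have "(\<Sum>k<d. of_int (z k) * b k e) = (\<Sum>k<d. \<Sum>f\<in>F. b i f * (of_int (Q f k) * b k e))"
          by (simp add: z_def sum_distrib_right P[OF ij(1)] mult.assoc)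
        also have "\<dots> = (\<Sum>f\<in>F. b i f * (\<Sum>k<d. of_int (Q f k) * b k e))"
          by (subst sum.swap) (simp add: sum_distrib_left)
        also have "\<dots> = (\<Sum>f\<in>F. b i f * std f e)"
          by (intro sum.cong refl arg_cong[where f = "(*) _"] fun_cong[OF conjunct2[OF Q]])
        also have "\<dots> = lin (b i) e" by (simp only: lin_def)
        also have "lin (b i) = b i" using bK[OF ij(1)] by (intro Kr_lin[symmetric]) (simp add: Kz_def)
        finally show "(\<Sum>k<d. of_int (z k) * b k e) = b i e" .
      qed
      also have "b i = (\<lambda>e. \<Sum>k<d. of_int ((\<lambda>k\<in>{..<d}. if i = k then 1 else 0) k) * b k e)"
      proof
        fix e
        have "(\<Sum>k<d. real_of_int ((\<lambda>k\<in>{..<d}. if i = k then 1 else 0) k) * b k e) = (\<Sum>k<d. if i = k then b k e else 0)"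
          by (intro sum.cong) auto
        then show "b i e = (\<Sum>k<d. real_of_int ((\<lambda>k\<in>{..<d}. if i = k then 1 else 0) k) * b k e)"
          using ij by simp
      qed
      finally have "z = (\<lambda>k\<in>{..<d}. if i = k then 1 else 0)"
        using bij by (intro inj_onD[OF bij_betw_imp_inj_on[OF bij]]) (auto simp: z_def)
      from fun_cong[OF this, of j] show ?thesis using ij by (simp add: z_def)
    qed
    define S where "S = {w \<in> F \<rightarrow>\<^sub>E UNIV. (\<forall>f\<in>F. 0 < w f) \<and> (\<forall>c\<in>K. (\<Sum>f | f \<in> F \<and> blk f = c. w f) < L c)}"
    have Sm: "S \<in> sets (\<Pi>\<^sub>M f\<in>F. lborel)"
      unfolding S_def using F K by (rule sets_PiM_block_simplex)
    have pos: "(\<forall>e\<in>E. 0 < m e + (\<Sum>i<d. x i * b i e))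
        \<longleftrightarrow> (\<lambda>f\<in>F. m f + (\<Sum>i<d. x i * of_int (P i f))) \<in> S" for x
    proof -
      define w where "w = (\<lambda>e. m e + (\<Sum>i<d. x i * b i e))"
      have bsum: "(\<Sum>e | e \<in> E \<and> blk e = c. b i e) = 0" if "i < d" "c \<in> K" for i c
        using bK[OF that(1)] that(2) by (simp add: Kz_def Kr)
      have wsum: "(\<Sum>e | e \<in> E \<and> blk e = c. w e) = L c" if c: "c \<in> K" for c
      proof -
        have "(\<Sum>e | e \<in> E \<and> blk e = c. w e) = L c + (\<Sum>e | e \<in> E \<and> blk e = c. \<Sum>i<d. x i * b i e)"
          using bspec[OF mL c[unfolded K_def]] by (simp add: w_def sum.distrib)
        also have "(\<Sum>e | e \<in> E \<and> blk e = c. \<Sum>i<d. x i * b i e) = (\<Sum>i<d. x i * (\<Sum>e | e \<in> E \<and> blk e = c. b i e))"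
          by (subst sum.swap) (simp add: sum_distrib_left)
        also have "\<dots> = 0" by (intro sum.neutral) (simp add: bsum c)
        finally show ?thesis by simp
      qed
      have r: "(\<lambda>f\<in>F. m f + (\<Sum>i<d. x i * of_int (P i f))) = restrict w F"
        by (intro ext) (simp add: w_def P)
      have "(\<forall>e\<in>E. 0 < w e) \<longleftrightarrow> (\<forall>f\<in>F. 0 < w f) \<and> (\<forall>c\<in>K. 0 < w (rep c))"
        using Ecases rep(1) by (auto simp: F_def)
      also have "(\<forall>c\<in>K. 0 < w (rep c)) \<longleftrightarrow> (\<forall>c\<in>K. (\<Sum>f | f \<in> F \<and> blk f = c. w f) < L c)"
      proof (intro ball_cong refl)
        fix c assume "c \<in> K"
        then show "(0 < w (rep c)) = ((\<Sum>f | f \<in> F \<and> blk f = c. w f) < L c)"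
          using sumE[of c w] wsum[of c] by auto
      qed
      also have "(\<forall>f\<in>F. 0 < w f) \<and> \<dots> \<longleftrightarrow> restrict w F \<in> S"
        by (simp add: S_def)
      finally show ?thesis unfolding r by (simp add: w_def)
    qed
    have "emeasure (\<Pi>\<^sub>M i\<in>{..<d}. lborel) {x \<in> {..<d} \<rightarrow>\<^sub>E UNIV. \<forall>e\<in>E. 0 < m e + (\<Sum>i<d. x i * b i e)}
        = emeasure (\<Pi>\<^sub>M f\<in>F. lborel) S"
      unfolding pos using F Sm PQ QP by (intro emeasure_PiM_lborel_unimodular[where Q = Q]) auto
    also have "\<dots> = ennreal (\<Prod>c\<in>K. L c ^ card {i \<in> F. blk i = c} / fact (card {i \<in> F. blk i = c}))"
      unfolding S_def using F K L by (intro emeasure_PiM_block_simplex) (auto simp: K_def F_def)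
    finally have "measure (\<Pi>\<^sub>M i\<in>{..<d}. lborel) {x \<in> {..<d} \<rightarrow>\<^sub>E UNIV. \<forall>e\<in>E. 0 < m e + (\<Sum>i<d. x i * b i e)}
        = (\<Prod>c\<in>K. L c ^ card {i \<in> F. blk i = c} / fact (card {i \<in> F. blk i = c}))"
      using L by (intro measure_eq_emeasure_eq_ennreal prod_nonneg) (auto simp: K_def intro!: divide_nonneg_nonneg less_imp_le)
    also have "\<dots> = (\<Prod>c\<in>K. L c ^ (card {e \<in> E. blk e = c} - 1) / fact (card {e \<in> E. blk e = c} - 1))"
    proof (intro prod.cong refl)
      fix c assume c: "c \<in> K"
      have "card {e \<in> E. blk e = c} = Suc (card {i \<in> F. blk i = c})"
        using Esplit[OF c] repF[OF c] F by simp
      then show "L c ^ card {i \<in> F. blk i = c} / fact (card {i \<in> F. blk i = c})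
        = L c ^ (card {e \<in> E. blk e = c} - 1) / fact (card {e \<in> E. blk e = c} - 1)" by simp
    qed
    finally show "measure (\<Pi>\<^sub>M i\<in>{..<d}. lborel) {x \<in> {..<d} \<rightarrow>\<^sub>E UNIV. \<forall>e\<in>E. 0 < m e + (\<Sum>i<d. x i * b i e)}
        = (\<Prod>c\<in>blk ` E. L c ^ (card {e \<in> E. blk e = c} - 1) / fact (card {e \<in> E. blk e = c} - 1))"
      by (simp add: K_def)
  qed
qed

section \<open>Cycles as lists\<close>

text \<open>The equation \<open>map f xs = rotate1 xs\<close> says that \<open>f\<close> moves each
  entry to the next one cyclically, so a distinct such list is a cycle of \<open>f\<close>. In this
  form cycles are cut and joined as lists.\<close>

lemma funpow_rotate1:
  assumes "map f xs = rotate1 xs" "xs \<noteq> []"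
  shows "(f ^^ i) (xs ! 0) = xs ! (i mod length xs)"
proof (induction i)
  case (Suc i)
  have l: "i mod length xs < length xs" using assms(2) by simp
  have "f (xs ! (i mod length xs)) = rotate1 xs ! (i mod length xs)"
    using l by (simp flip: assms(1))
  also have "\<dots> = xs ! (Suc i mod length xs)"
    using l by (simp add: nth_rotate1 mod_Suc_eq)
  finally show ?case using Suc by simp
qed (use assms in simp)

lemma orbit_eq_set_hd:
  assumes "map f xs = rotate1 xs" "xs \<noteq> []"
  shows "orbit f (hd xs) = set xs"
proof -
  have hd: "hd xs = xs ! 0" using assms(2) by (simp add: hd_conv_nth)
  have "orbit f (xs ! 0) = {(f ^^ m) (xs ! 0) | m. m < length xs}"
    using assms by (intro orbit_altdef_bounded) (auto simp: funpow_rotate1)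
  also have "\<dots> = {xs ! m | m. m < length xs}"
    using funpow_rotate1[OF assms] by (intro Collect_cong) (metis mod_less)
  finally show ?thesis by (simp add: hd set_conv_nth)
qed

lemma orbit_eq_set:
  assumes "map f xs = rotate1 xs" "x \<in> set xs"
  shows "orbit f x = set xs"
proof -
  obtain i where i: "i < length xs" "x = xs ! i" using assms(2) by (auto simp: in_set_conv_nth)
  have "map f (rotate i xs) = rotate1 (rotate i xs)"
    by (metis assms(1) rotate_map rotate1_rotate_swap)
  moreover have "rotate i xs \<noteq> []" "hd (rotate i xs) = x"
    using i hd_rotate_conv_nth[of xs i] by (cases "xs = []"; force)+
  ultimately show ?thesis using orbit_eq_set_hd[of f "rotate i xs"] by simp
qed

lemma rotate1_iff_nth:
  "map f xs = rotate1 xs \<longleftrightarrow> (\<forall>i<length xs. f (xs ! i) = xs ! (Suc i mod length xs))"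
  by (auto simp: list_eq_iff_nth_eq nth_rotate1)

text \<open>The list starts at a prescribed element; this fixes the place where the cycle is cut
  when an edge is added.\<close>

lemma ex_cycle_list:
  assumes "permutation f"
  obtains xs where "distinct xs" "map f xs = rotate1 xs" "set xs = orbit f x" "xs \<noteq> []" "hd xs = x"
proof -
  have x: "x \<in> orbit f x" using assms by (rule permutation_self_in_orbit)
  define n where "n = funpow_dist1 f x x"
  define xs where "xs = map (\<lambda>i. (f ^^ i) x) [0..<n]"
  have n: "0 < n" by (simp add: n_def)
  have fn: "(f ^^ n) x = x" using x unfolding n_def by (rule funpow_dist1_prop)
  have "inj_on (\<lambda>i. (f ^^ i) x) {0..<n}"
    unfolding n_def by (rule inj_on_funpow_dist1[OF x])
  then have "distinct xs" by (simp add: xs_def distinct_map)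
  moreover have "map f xs = rotate1 xs"
  proof -
    have "f ((f ^^ i) x) = (f ^^ (Suc i mod n)) x" if "i < n" for i
    proof (cases "Suc i < n")
      case False
      then have "Suc i = n" using that by simp
      then show ?thesis using fn by (metis funpow.simps(2) comp_apply mod_self funpow_0)
    qed simp
    then show ?thesis unfolding rotate1_iff_nth using n by (simp add: xs_def)
  qed
  moreover have "set xs = orbit f x"
    by (simp add: xs_def orbit_conv_funpow_dist1[OF x, folded n_def])
  moreover have "xs \<noteq> []" "hd xs = x" using n by (auto simp: xs_def hd_map)
  ultimately show ?thesis by (rule that)
qed

lemma orbit_eq_if_in:
  assumes "permutation f" "y \<in> orbit f x"
  shows "orbit f y = orbit f x"
proof -
  obtain xs where "map f xs = rotate1 xs" "set xs = orbit f x"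
    using ex_cycle_list[OF assms(1)] by metis
  then show ?thesis using orbit_eq_set[of f xs y] assms(2) by simp
qed

lemma orbit_subset_invariant:
  assumes "f ` A \<subseteq> A" "x \<in> A"
  shows "orbit f x \<subseteq> A"
proof
  fix y assume "y \<in> orbit f x"
  then show "y \<in> A" by induction (use assms in auto)
qed

section \<open>Cycle types\<close>

text \<open>The shift by one makes the index of a cycle the exponent of its length variable in the
  volume, since a boundary with \<open>m\<close> edges corresponds to a simplex of dimension
  \<open>m - 1\<close>. Fixed points count at index 0. Being a sum over cycles, the type is additive
  over disjoint invariant sets.\<close>

definition cycle_type :: "'a set \<Rightarrow> ('a \<Rightarrow> 'a) \<Rightarrow> (nat \<Rightarrow>\<^sub>0 nat)" where
  "cycle_type A f = (\<Sum>C\<in>orbit f ` A. Poly_Mapping.single (card C - 1) 1)"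

lemma cycle_type_Un:
  assumes "finite A" "finite B" "A \<inter> B = {}" "f ` A \<subseteq> A" "f ` B \<subseteq> B"
  shows "cycle_type (A \<union> B) f = cycle_type A f + cycle_type B f"
proof -
  have "orbit f ` A \<inter> orbit f ` B = {}"
  proof (rule ccontr)
    assume "orbit f ` A \<inter> orbit f ` B \<noteq> {}"
    then obtain x y where xy: "x \<in> A" "y \<in> B" "orbit f x = orbit f y" by auto
    then have "orbit f x \<subseteq> A \<inter> B"
      using orbit_subset_invariant[OF assms(4) xy(1)] orbit_subset_invariant[OF assms(5) xy(2)] by auto
    then show False using assms(3) orbit_nonempty[of f x] by auto
  qed
  then show ?thesis
    unfolding cycle_type_def image_Un using assms(1,2) by (intro sum.union_disjoint) auto
qed

lemma cycle_type_cong: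
  assumes "f ` A \<subseteq> A" "\<And>x. x \<in> A \<Longrightarrow> f x = g x"
  shows "cycle_type A f = cycle_type A g"
proof -
  have "orbit f x = orbit g x" if "x \<in> A" for x
    using that assms by (intro orbit_cong0[where A = A]) auto
  then show ?thesis unfolding cycle_type_def by (metis (no_types, lifting) image_cong)
qed

lemma cycle_type_list:
  assumes "map f xs = rotate1 xs" "distinct xs" "xs \<noteq> []"
  shows "cycle_type (set xs) f = Poly_Mapping.single (length xs - 1) 1"
proof -
  have "orbit f ` set xs = {set xs}"
    using orbit_eq_set[OF assms(1)] assms(3) by (auto simp: image_iff) (metis list.set_intros(1) neq_Nil_conv)
  then show ?thesis by (simp add: cycle_type_def distinct_card[OF assms(2)])
qed

lemma image_rotate1: "map f xs = rotate1 xs \<Longrightarrow> f ` set xs = set xs"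
  by (metis list.set_map set_rotate1)

lemma permutes_finite_permutation: "finite A \<Longrightarrow> f permutes A \<Longrightarrow> permutation f"
  by (auto simp: permutation_permutes)

lemma finite_orbit_permutes: "finite A \<Longrightarrow> f permutes A \<Longrightarrow> finite (orbit f x)"
  by (intro finite_orbit permutation_self_in_orbit permutes_finite_permutation)

lemma permutes_orbit_subset: "f permutes A \<Longrightarrow> x \<in> A \<Longrightarrow> orbit f x \<subseteq> A"
  by (rule orbit_subset_invariant) (auto simp: permutes_image)

lemma card_orbit_pos: "finite A \<Longrightarrow> f permutes A \<Longrightarrow> 0 < card (orbit f x)"
  by (simp add: card_gt_0_iff finite_orbit_permutes orbit_nonempty)

lemma lookup_cycle_type:
  assumes "finite A" "f permutes A"
  shows "Poly_Mapping.lookup (cycle_type A f) i = card {C \<in> orbit f ` A. card C = Suc i}"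
proof -
  have "Poly_Mapping.lookup (cycle_type A f) i = (\<Sum>C\<in>orbit f ` A. if card C = Suc i then 1 else 0)"
    unfolding cycle_type_def lookup_sum
  proof (rule sum.cong)
    fix C assume "C \<in> orbit f ` A"
    then have "0 < card C" using card_orbit_pos[OF assms] by auto
    then show "Poly_Mapping.lookup (Poly_Mapping.single (card C - 1) 1) i = (if card C = Suc i then 1 else 0)"
      by (auto simp: lookup_single when_def)
  qed simp
  also have "\<dots> = card {C \<in> orbit f ` A. card C = Suc i}"
    using assms(1) by (simp add: sum.If_cases Int_def)
  finally show ?thesis .
qed

text \<open>Distinct cycles are disjoint, so each contributes its full length. Choosing points
  rather than cycles is the origin of the coefficients \<open>i + j\<close> and
  \<open>(i + 1) (j + 1)\<close> in the equation.\<close>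

lemma card_points_in_cycles:
  assumes "finite A" "f permutes A"
  shows "card {x \<in> A. card (orbit f x) = Suc i} = Suc i * Poly_Mapping.lookup (cycle_type A f) i"
proof -
  have perm: "permutation f" using assms by (rule permutes_finite_permutation)
  have "{x \<in> A. card (orbit f x) = Suc i} = \<Union> {C \<in> orbit f ` A. card C = Suc i}"
  proof (intro set_eqI iffI)
    fix x assume "x \<in> {x \<in> A. card (orbit f x) = Suc i}"
    then show "x \<in> \<Union> {C \<in> orbit f ` A. card C = Suc i}"
      using permutation_self_in_orbit[OF perm, of x] by auto
  next
    fix x assume "x \<in> \<Union> {C \<in> orbit f ` A. card C = Suc i}"
    then obtain y where y: "y \<in> A" "card (orbit f y) = Suc i" "x \<in> orbit f y" by auto
    then show "x \<in> {x \<in> A. card (orbit f x) = Suc i}"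
      using orbit_eq_if_in[OF perm y(3)] permutes_orbit_subset[OF assms(2) y(1)] by auto
  qed
  also have "card \<dots> = (\<Sum>C\<in>{C \<in> orbit f ` A. card C = Suc i}. card C)"
  proof (rule card_Union_disjoint)
    show "pairwise disjnt {C \<in> orbit f ` A. card C = Suc i}"
    proof (rule pairwiseI)
      fix C D assume "C \<in> {C \<in> orbit f ` A. card C = Suc i}" "D \<in> {C \<in> orbit f ` A. card C = Suc i}" "C \<noteq> D"
      then obtain x y where "C = orbit f x" "D = orbit f y" "C \<noteq> D" by auto
      then show "disjnt C D"
        using orbit_eq_if_in[OF perm] by (metis disjoint_iff disjnt_def)
    qed
  qed (auto simp: finite_orbit_permutes[OF assms])
  also have "\<dots> = Suc i * card {C \<in> orbit f ` A. card C = Suc i}" by simp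
  finally show ?thesis by (simp add: lookup_cycle_type[OF assms])
qed

lemma cycle_type_conj:
  assumes A: "finite A" "f permutes A" and t: "bij t" "t ` A = A"
    and g: "\<And>x. g (t x) = t (f x)"
  shows "cycle_type A g = cycle_type A f"
proof -
  have perm: "permutation f" using A by (rule permutes_finite_permutation)
  have orb: "orbit g (t x) = t ` orbit f x" for x
    using permutation_self_in_orbit[OF perm, of x] g by (intro orbit_inverse[symmetric]) auto
  have "orbit g ` A = orbit g ` (t ` A)" using t by simp
  also have "\<dots> = (`) t ` (orbit f ` A)" by (auto simp: orb image_image)
  finally have "cycle_type A g = (\<Sum>C\<in>(`) t ` (orbit f ` A). Poly_Mapping.single (card C - 1) 1)"
    by (simp add: cycle_type_def)
  also have "\<dots> = (\<Sum>C\<in>orbit f ` A. Poly_Mapping.single (card (t ` C) - 1) 1)"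
    using t by (subst sum.reindex) (auto intro!: inj_onI simp: bij_def inj_image_eq_iff)
  also have "\<dots> = cycle_type A f"
    unfolding cycle_type_def using t by (simp add: card_image bij_def inj_on_subset[of t UNIV])
  finally show ?thesis .
qed

text \<open>What becomes of \<open>s = inv t \<circ> r\<close> when \<open>h\<close> is inserted after \<open>a\<close>, and then \<open>h'\<close> after \<open>b\<close>, into the
  cycle \<open>t\<close>, and the pair \<open>{h, h'}\<close> is added to the matching \<open>r\<close>.\<close>

definition add_edge :: "'a \<Rightarrow> 'a \<Rightarrow> 'a \<Rightarrow> 'a \<Rightarrow> ('a \<Rightarrow> 'a) \<Rightarrow> 'a \<Rightarrow> 'a" where
  "add_edge h h' a b s =
    Transposition.transpose h' b \<circ> Transposition.transpose h a \<circ> s \<circ> Transposition.transpose h h'"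

section \<open>The effect of an added edge on the cycles: splitting one or joining two\<close>

context
  fixes X :: "'a set" and s :: "'a \<Rightarrow> 'a" and h h' a :: 'a
  assumes X: "finite X" and s: "s permutes X" and h: "h \<notin> X" "h' \<notin> X" "h \<noteq> h'" and a: "a \<in> X"
begin

text \<open>The case \<open>b = h\<close> occurs because \<open>h\<close> is already in the cycle
  \<open>t\<close> when \<open>h'\<close> is inserted. On \<open>X\<close> the value of
  \<open>s\<close> changes only where it is \<open>a\<close> or \<open>b\<close>, the elements after
  which something was inserted.\<close>

lemma add_edge_apply:
  assumes "b \<in> insert h X"
  shows "add_edge h h' a b s h' = (if b = a then h' else a)"
    and "add_edge h h' a b s h = b"
    and "x \<in> X \<Longrightarrow> add_edge h h' a b s x =
      (if s x = a then if b = h then h' else h else if s x = b then h' else s x)"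
proof -
  have sh: "s h = h" "s h' = h'" using s h by (auto simp: permutes_not_in)
  have ab: "a \<noteq> h" "a \<noteq> h'" "b \<noteq> h'" using a h assms by auto
  show "add_edge h h' a b s h' = (if b = a then h' else a)" "add_edge h h' a b s h = b"
    using sh ab h by (auto simp: add_edge_def Transposition.transpose_def)
  assume x: "x \<in> X"
  then have sx: "s x \<in> X" using s by (simp add: permutes_in_image)
  then have "x \<noteq> h" "x \<noteq> h'" "s x \<noteq> h" "s x \<noteq> h'" using x h by auto
  then show "add_edge h h' a b s x =
      (if s x = a then if b = h then h' else h else if s x = b then h' else s x)"
    using ab h by (auto simp: add_edge_def Transposition.transpose_def)
qed

text \<open>Let the cycle be \<open>x_0 ... x_(l-1)\<close> with \<open>x_0 = a\<close>. It becomes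
  \<open>x_0 ... x_(j-1) h'\<close> and \<open>h x_j ... x_(l-1)\<close>, of lengths
  \<open>j + 1\<close> and \<open>l - j + 1\<close>, hence of indices \<open>j\<close> and
  \<open>l - j\<close>. The extreme cases are \<open>j = 0\<close> for \<open>b = a\<close>, where
  \<open>h'\<close> is a fixed point, and \<open>j = l\<close> for \<open>b = h\<close>, where
  \<open>h\<close> is one. The removed cycle is added on the left to avoid subtraction of
  types.\<close>

lemma cycle_type_split:
  assumes xs: "distinct xs" "map s xs = rotate1 xs" "set xs \<subseteq> X" "xs \<noteq> []" "hd xs = a"
    and j: "j \<le> length xs" and b: "b = (xs @ [h]) ! j"
  shows "cycle_type (insert h (insert h' X)) (add_edge h h' a b s) + Poly_Mapping.single (length xs - 1) 1
    = cycle_type X s + Poly_Mapping.single j 1 + Poly_Mapping.single (length xs - j) 1"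
proof -
  let ?l = "length xs" and ?r = "add_edge h h' a b s"
  define L1 where "L1 = take j xs @ [h']"
  define L2 where "L2 = h # drop j xs"
  have a0: "xs ! 0 = a" using xs by (simp add: hd_conv_nth)
  have l: "0 < ?l" using xs by simp
  have sxs: "s (xs ! i) = xs ! (Suc i mod ?l)" if "i < ?l" for i
    using xs(2) that by (simp add: rotate1_iff_nth)
  have xsX: "xs ! i \<in> X" if "i < ?l" for i using that xs(3) by auto
  have b': "b \<in> insert h X" using j xsX by (auto simp: b nth_append)
  have eqa: "xs ! i = a \<longleftrightarrow> i = 0" if "i < ?l" for i
    using that xs(1) l by (simp flip: a0 add: nth_eq_iff_index_eq)
  have eqb: "xs ! i = b \<longleftrightarrow> i = j" if "i < ?l" for i
    using that xs(1) j h xsX by (auto simp: b nth_append nth_eq_iff_index_eq)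
  have bh: "b = h \<longleftrightarrow> j = ?l" using j h xsX by (auto simp: b nth_append)
  have ba: "b = a \<longleftrightarrow> j = 0" using eqb[of 0] l a0 by auto
  note r = add_edge_apply[OF b']
  \<comment> \<open>Only two arrows change: the last entry, which led back to \<open>a\<close>, now
    leads to \<open>h\<close>, or to \<open>h'\<close> if \<open>b = h\<close>; and the entry before
    \<open>b\<close>, if the list has one, leads to \<open>h'\<close>.\<close>
  have rx: "?r (xs ! i) = (if Suc i = ?l then if j = ?l then h' else h else if Suc i = j then h' else xs ! Suc i)"
    if "i < ?l" for i
  proof (cases "Suc i = ?l")
    case True
    then show ?thesis using r(3)[OF xsX[OF that]] sxs[OF that] l by (auto simp: a0 bh)
  next
    case False
    then have "Suc i < ?l" using that by simp
    then show ?thesis using r(3)[OF xsX[OF that]] sxs[OF that] by (auto simp: eqa eqb)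
  qed
  have c1: "map ?r L1 = rotate1 L1"
  proof -
    have "?r (L1 ! i) = L1 ! (Suc i mod Suc j)" if i: "i < Suc j" for i
    proof (cases "i = j")
      case True
      have "?r h' = (if j = 0 then h' else a)" by (simp add: r(1) ba)
      also have "\<dots> = L1 ! 0" using j l a0 by (auto simp: L1_def nth_append)
      finally show ?thesis using True j by (simp add: L1_def nth_append)
    next
      case False
      then have ij: "i < j" using i by simp
      then have "L1 ! i = xs ! i" using j by (simp add: L1_def nth_append)
      moreover have "L1 ! Suc i = (if Suc i = j then h' else xs ! Suc i)"
        using ij j by (auto simp: L1_def nth_append)
      moreover have "?r (xs ! i) = (if Suc i = j then h' else xs ! Suc i)"
        using ij j rx[of i] by auto
      ultimately show ?thesis using ij by simp
    qed
    then show ?thesis unfolding rotate1_iff_nth using j by (simp add: L1_def)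
  qed
  have c2: "map ?r L2 = rotate1 L2"
  proof -
    have len: "length L2 = Suc (?l - j)" by (simp add: L2_def)
    have "?r (L2 ! i) = L2 ! (Suc i mod Suc (?l - j))" if i: "i < Suc (?l - j)" for i
    proof (cases i)
      case 0
      have "L2 ! (Suc 0 mod Suc (?l - j)) = b"
      proof (cases "j = ?l")
        case True then show ?thesis using bh by (simp add: L2_def)
      next
        case False
        then have "j < ?l" using j by simp
        then show ?thesis by (simp add: L2_def b nth_append)
      qed
      then show ?thesis using 0 r(2) by (simp add: L2_def)
    next
      case (Suc i')
      then have ij: "j + i' < ?l" using i by simp
      have L: "L2 ! i = xs ! (j + i')" using Suc ij j by (simp add: L2_def)
      show ?thesis
      proof (cases "Suc (j + i') = ?l")
        case True
        then have "Suc i mod Suc (?l - j) = 0" using Suc by (metis Suc_diff_le add_Suc_right add_diff_cancel_left' mod_self)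
        moreover have "j \<noteq> ?l" using ij by simp
        ultimately show ?thesis using rx[OF ij] True L by (simp add: L2_def)
      next
        case False
        then have "Suc (Suc (j + i')) \<le> ?l" using ij by simp
        then have "Suc i < Suc (?l - j)" using Suc by linarith
        then have "L2 ! (Suc i mod Suc (?l - j)) = xs ! Suc (j + i')"
          using Suc ij j by (simp add: L2_def)
        then show ?thesis using rx[OF ij] False L by auto
      qed
    qed
    then show ?thesis unfolding rotate1_iff_nth len by blast
  qed
  have dist: "distinct L1" "distinct L2"
    using xs(1,3) h by (auto simp: L1_def L2_def dest: in_set_takeD in_set_dropD)
  have disj: "set L1 \<inter> set L2 = {}"
    using xs(1,3) h by (auto simp: L1_def L2_def dest: in_set_takeD in_set_dropD set_take_disj_set_drop_if_distinct[of xs j j])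
  have un: "set L1 \<union> set L2 = insert h (insert h' (set xs))"
    by (simp add: L1_def L2_def insert_commute) (metis append_take_drop_id set_append Un_insert_left Un_insert_right)
  have img: "s ` (X - set xs) \<subseteq> X - set xs"
  proof -
    have "s ` (X - set xs) = s ` X - s ` set xs"
      using permutes_inj[OF s] by (simp add: image_set_diff)
    then show ?thesis using permutes_image[OF s] image_rotate1[OF xs(2)] by simp
  qed
  have same: "?r x = s x" if "x \<in> X - set xs" for x
  proof -
    have "s x \<notin> set xs" using img that by auto
    then have "s x \<noteq> a" "s x \<noteq> b"
      using xs(4,5) j img that h by (auto simp: b nth_append split: if_splits)
    then show ?thesis using r(3)[of x] that by simp
  qed
  have "cycle_type X s = cycle_type (X - set xs) s + cycle_type (set xs) s"
  proof -
    have "cycle_type ((X - set xs) \<union> set xs) s = cycle_type (X - set xs) s + cycle_type (set xs) s"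
      using X img image_rotate1[OF xs(2)] by (intro cycle_type_Un) auto
    moreover have "(X - set xs) \<union> set xs = X" using xs(3) by auto
    ultimately show ?thesis by simp
  qed
  then have tX: "cycle_type X s = cycle_type (X - set xs) s + Poly_Mapping.single (?l - 1) 1"
    using cycle_type_list[OF xs(2,1,4)] by simp
  have "insert h (insert h' X) = (X - set xs) \<union> (set L1 \<union> set L2)"
    using xs(3) by (auto simp: un)
  moreover have "?r ` (X - set xs) \<subseteq> X - set xs" using same img by auto
  moreover have "?r ` set L1 = set L1" "?r ` set L2 = set L2" using c1 c2 image_rotate1 by blast+
  moreover have "(X - set xs) \<inter> (set L1 \<union> set L2) = {}" using h by (auto simp: un)
  ultimately have "cycle_type (insert h (insert h' X)) ?r
      = cycle_type (X - set xs) ?r + (cycle_type (set L1) ?r + cycle_type (set L2) ?r)"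
    using X disj by (simp add: cycle_type_Un image_Un)
  also have "cycle_type (X - set xs) ?r = cycle_type (X - set xs) s"
    using same img by (intro cycle_type_cong[symmetric]) auto
  also have "cycle_type (set L1) ?r = Poly_Mapping.single j 1"
    using cycle_type_list[OF c1 dist(1)] j by (simp add: L1_def)
  also have "cycle_type (set L2) ?r = Poly_Mapping.single (?l - j) 1"
    using cycle_type_list[OF c2 dist(2)] by (simp add: L2_def)
  finally show ?thesis by (simp add: tX ac_simps)
qed

text \<open>The new cycle is \<open>xs h ys h'\<close>, with one new element at each of the two
  seams. Cycles of indices \<open>i\<close> and \<open>j\<close> have lengths \<open>i + 1\<close>
  and \<open>j + 1\<close>, so the result has length \<open>i + j + 4\<close> and index
  \<open>i + j + 3\<close>, as in the second sum of the equation.\<close>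

lemma cycle_type_join:
  assumes xs: "distinct xs" "map s xs = rotate1 xs" "set xs \<subseteq> X" "xs \<noteq> []" "hd xs = a"
    and ys: "distinct ys" "map s ys = rotate1 ys" "set ys \<subseteq> X" "ys \<noteq> []" "hd ys = b"
    and disj: "set xs \<inter> set ys = {}"
  shows "cycle_type (insert h (insert h' X)) (add_edge h h' a b s)
      + Poly_Mapping.single (length xs - 1) 1 + Poly_Mapping.single (length ys - 1) 1
    = cycle_type X s + Poly_Mapping.single (length xs + length ys + 1) 1"
proof -
  let ?r = "add_edge h h' a b s"
  obtain xs' where xs': "xs = a # xs'" using xs(4,5) by (cases xs) auto
  obtain ys' where ys': "ys = b # ys'" using ys(4,5) by (cases ys) auto
  have b: "b \<in> X" "b \<noteq> h" "b \<noteq> a" using ys ys' xs' disj h by auto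
  note r = add_edge_apply[of b]
  define L where "L = xs @ h # ys @ [h']"
  have rs: "map ?r zs = map (\<lambda>x. if s x = a then h else if s x = b then h' else s x) zs" if "set zs \<subseteq> X" for zs
    using that b r(3) by (intro map_cong) auto
  have mx: "map ?r xs = xs' @ [h]"
  proof -
    have "map ?r xs = map (\<lambda>y. if y = a then h else if y = b then h' else y) (map s xs)"
      by (simp add: rs[OF xs(3)])
    also have "\<dots> = map (\<lambda>y. if y = a then h else if y = b then h' else y) xs' @ [h]"
      by (simp add: xs(2)) (simp add: xs')
    also have "map (\<lambda>y. if y = a then h else if y = b then h' else y) xs' = map id xs'"
      using xs(1) disj by (intro map_cong refl) (auto simp: xs' ys')
    finally show ?thesis by simp
  qed
  have my: "map ?r ys = ys' @ [h']"
  proof -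
    have "map ?r ys = map (\<lambda>y. if y = a then h else if y = b then h' else y) (map s ys)"
      by (simp add: rs[OF ys(3)])
    also have "\<dots> = map (\<lambda>y. if y = a then h else if y = b then h' else y) ys' @ [h']"
      using b by (simp add: ys(2)) (simp add: ys')
    also have "map (\<lambda>y. if y = a then h else if y = b then h' else y) ys' = map id ys'"
      using ys(1) disj by (intro map_cong refl) (auto simp: xs' ys')
    finally show ?thesis by simp
  qed
  have c: "map ?r L = rotate1 L"
    using r(1,2) b by (simp add: L_def mx my) (simp add: xs' ys')
  have dL: "distinct L" using xs ys disj h by (auto simp: L_def)
  have sL: "set L = insert h (insert h' (set xs \<union> set ys))" by (auto simp: L_def)
  let ?W = "X - (set xs \<union> set ys)"
  have imgs: "s ` (set xs \<union> set ys) = set xs \<union> set ys"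
    using image_rotate1[OF xs(2)] image_rotate1[OF ys(2)] by (simp add: image_Un)
  have img: "s ` ?W \<subseteq> ?W"
  proof -
    have "s ` ?W = s ` X - s ` (set xs \<union> set ys)"
      using permutes_inj[OF s] by (simp add: image_set_diff)
    then show ?thesis using permutes_image[OF s] imgs by simp
  qed
  have same: "?r x = s x" if "x \<in> ?W" for x
  proof -
    have "s x \<notin> set xs \<union> set ys" using img that by auto
    then have "s x \<noteq> a" "s x \<noteq> b" by (auto simp: xs' ys')
    then show ?thesis using r(3)[of x] that b by simp
  qed
  have "X = ?W \<union> (set xs \<union> set ys)" using xs(3) ys(3) by auto
  moreover have "cycle_type (?W \<union> (set xs \<union> set ys)) s
      = cycle_type ?W s + (cycle_type (set xs) s + cycle_type (set ys) s)"
    using X img disj image_rotate1[OF xs(2)] image_rotate1[OF ys(2)]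
    by (subst cycle_type_Un) (auto simp: cycle_type_Un imgs)
  ultimately have tX: "cycle_type X s = cycle_type ?W s
      + (Poly_Mapping.single (length xs - 1) 1 + Poly_Mapping.single (length ys - 1) 1)"
    using cycle_type_list[OF xs(2,1,4)] cycle_type_list[OF ys(2,1,4)] by simp
  have "insert h (insert h' X) = ?W \<union> set L" using xs(3) ys(3) by (auto simp: sL)
  moreover have "?r ` ?W \<subseteq> ?W" using same img by auto
  moreover have "?W \<inter> set L = {}" using h by (auto simp: sL)
  ultimately have "cycle_type (insert h (insert h' X)) ?r = cycle_type ?W ?r + cycle_type (set L) ?r"
    using X image_rotate1[OF c] by (simp add: cycle_type_Un)
  also have "cycle_type ?W ?r = cycle_type ?W s"
    using same img by (intro cycle_type_cong[symmetric]) auto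
  also have "cycle_type (set L) ?r = Poly_Mapping.single (length xs + length ys + 1) 1"
    using cycle_type_list[OF c dL] by (simp add: L_def)
  finally show ?thesis by (simp add: tX ac_simps)
qed

end

section \<open>Pairs of a full cycle and a fixed-point-free involution\<close>

definition full_cycles :: "'a set \<Rightarrow> ('a \<Rightarrow> 'a) set" where
  "full_cycles A = {t. t permutes A \<and> (\<forall>x\<in>A. orbit t x = A)}"

definition matchings :: "'a set \<Rightarrow> ('a \<Rightarrow> 'a) set" where
  "matchings A = {r. r permutes A \<and> (\<forall>x\<in>A. r x \<noteq> x \<and> r (r x) = x)}"

lemma finite_full_cycles: "finite A \<Longrightarrow> finite (full_cycles A)"
  unfolding full_cycles_def by (rule finite_subset[OF _ finite_permutations]) auto

lemma finite_matchings: "finite A \<Longrightarrow> finite (matchings A)"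
  unfolding matchings_def by (rule finite_subset[OF _ finite_permutations]) auto

lemma full_cycleI:
  assumes "t permutes A" "map t xs = rotate1 xs" "set xs = A"
  shows "t \<in> full_cycles A"
  using assms orbit_eq_set[of t xs] by (auto simp: full_cycles_def)

lemma full_cycle_list:
  assumes "finite A" "t \<in> full_cycles A" "a \<in> A"
  obtains xs where "distinct (a # xs)" "t a # map t xs = xs @ [a]" "insert a (set xs) = A"
proof -
  have t: "t permutes A" "orbit t a = A" using assms by (auto simp: full_cycles_def)
  obtain ys where ys: "distinct ys" "map t ys = rotate1 ys" "set ys = orbit t a" "ys \<noteq> []" "hd ys = a"
    using ex_cycle_list[OF permutes_finite_permutation[OF assms(1) t(1)]] by blast
  obtain xs where "ys = a # xs" using ys(4,5) by (cases ys) auto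
  then show ?thesis using ys t by (intro that[of xs]) auto
qed

text \<open>\<open>t \<circ> Transposition.transpose h a\<close> is \<open>t\<close> with
  \<open>h\<close> inserted between \<open>a\<close> and \<open>t a\<close>. Conversely, a full
  cycle on the larger set determines \<open>a\<close> as the predecessor of \<open>h\<close>; it
  lies in \<open>A\<close> because \<open>A\<close> is non-empty.\<close>

lemma full_cycles_insert:
  assumes A: "finite A" "A \<noteq> {}" and h: "h \<notin> A"
  shows "bij_betw (\<lambda>(t, a). t \<circ> Transposition.transpose h a) (full_cycles A \<times> A) (full_cycles (insert h A))"
  unfolding bij_betw_def
proof (intro conjI inj_onI set_eqI iffI; clarify?)
  fix t a t' a'
  assume t: "t \<in> full_cycles A" "a \<in> A" "t' \<in> full_cycles A" "a' \<in> A"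
    and eq: "t \<circ> Transposition.transpose h a = t' \<circ> Transposition.transpose h a'"
  have th: "t h = h" "t' h = h" using t h by (auto simp: full_cycles_def permutes_not_in)
  have "t' (Transposition.transpose h a' a) = t' h"
    using fun_cong[OF eq, of a] th by simp
  then have "Transposition.transpose h a' a = h"
    using t(3) by (auto simp: full_cycles_def dest: permutes_inj injD)
  then have aa: "a = a'" using t h by (auto simp: Transposition.transpose_def split: if_splits)
  have "t = t \<circ> Transposition.transpose h a \<circ> Transposition.transpose h a"
    by (simp add: comp_assoc)
  also have "\<dots> = t'" by (simp add: eq comp_assoc flip: aa)
  finally show "t = t' \<and> a = a'" using aa by simp
next
  fix t a assume t: "t \<in> full_cycles A" and a: "a \<in> A"
  obtain xs where xs: "distinct (a # xs)" "t a # map t xs = xs @ [a]" "insert a (set xs) = A"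
    using full_cycle_list[OF A(1) t a] by blast
  have tp: "t permutes A" using t by (simp add: full_cycles_def)
  have th: "t h = h" using tp h by (simp add: permutes_not_in)
  show "t \<circ> Transposition.transpose h a \<in> full_cycles (insert h A)"
  proof (rule full_cycleI)
    show "t \<circ> Transposition.transpose h a permutes insert h A"
      using a tp by (intro permutes_compose permutes_swap_id permutes_subset[OF tp]) auto
    have mt: "map (t \<circ> Transposition.transpose h a) xs = map t xs"
      using xs(1,3) h by (intro map_cong) (auto simp: Transposition.transpose_def)
    show "map (t \<circ> Transposition.transpose h a) (a # h # xs) = rotate1 (a # h # xs)"
      unfolding list.map mt using xs(2) th by simp
    show "set (a # h # xs) = insert h A" using xs(3) by auto
  qed
next
  fix t assume t: "t \<in> full_cycles (insert h A)"
  have tp: "t permutes insert h A" using t by (simp add: full_cycles_def)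
  obtain ys where ys: "distinct (h # ys)" "t h # map t ys = ys @ [h]" "insert h (set ys) = insert h A"
    using full_cycle_list[OF _ t, of h] A by blast
  have ysA: "set ys = A" using ys(1,3) h by auto
  then have "ys \<noteq> []" using A by auto
  then obtain zs a where zs: "ys = zs @ [a]" by (cases ys rule: rev_cases) auto
  have a: "a \<in> A" using ysA zs by auto
  have ta: "t a = h" and tz: "t h # map t zs = zs @ [a]" using ys(2) zs by auto
  define u where "u = t \<circ> Transposition.transpose h a"
  have uz: "map u zs = map t zs"
    using ys(1) by (intro map_cong) (auto simp: u_def zs Transposition.transpose_def)
  have "u \<in> full_cycles A"
  proof (rule full_cycleI)
    have "u permutes insert h A"
      unfolding u_def using a tp by (intro permutes_compose permutes_swap_id) auto
    then show "u permutes A"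
      by (rule permutes_superset) (auto simp: u_def ta)
    have "map u (zs @ [a]) = map t zs @ [t h]" using uz by (simp add: u_def)
    also have "\<dots> = rotate1 (t h # map t zs)" by simp
    also have "\<dots> = rotate1 (zs @ [a])" by (simp only: tz)
    finally show "map u (zs @ [a]) = rotate1 (zs @ [a])" .
    show "set (zs @ [a]) = A" using ysA zs by simp
  qed
  moreover have "t = u \<circ> Transposition.transpose h a" by (simp add: u_def comp_assoc)
  ultimately show "t \<in> (\<lambda>(t, a). t \<circ> Transposition.transpose h a) ` (full_cycles A \<times> A)"
    using a by (auto intro!: image_eqI[of _ _ "(u, a)"])
qed

lemma matchings_insert:
  assumes h: "h \<notin> A" "h' \<notin> A" "h \<noteq> h'"
  shows "bij_betw (\<lambda>r. r \<circ> Transposition.transpose h h') (matchings A)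
    {r \<in> matchings (insert h (insert h' A)). r h = h'}"
proof (rule bij_betwI[where g = "\<lambda>r. r \<circ> Transposition.transpose h h'"])
  show "(\<lambda>r. r \<circ> Transposition.transpose h h') \<in> matchings A \<rightarrow> {r \<in> matchings (insert h (insert h' A)). r h = h'}"
  proof
    fix r assume r: "r \<in> matchings A"
    then have rp: "r permutes A" by (simp add: matchings_def)
    have rh: "r h = h" "r h' = h'" using rp h by (auto simp: permutes_not_in)
    have "r \<circ> Transposition.transpose h h' permutes insert h (insert h' A)"
      by (intro permutes_compose permutes_swap_id permutes_subset[OF rp]) auto
    moreover have "r x \<in> A" if "x \<in> A" for x using rp that by (simp add: permutes_in_image)
    ultimately show "r \<circ> Transposition.transpose h h' \<in> {r \<in> matchings (insert h (insert h' A)). r h = h'}"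
      using r h rh by (auto simp: matchings_def Transposition.transpose_def)
  qed
  show "(\<lambda>r. r \<circ> Transposition.transpose h h') \<in> {r \<in> matchings (insert h (insert h' A)). r h = h'} \<rightarrow> matchings A"
  proof
    fix r assume r: "r \<in> {r \<in> matchings (insert h (insert h' A)). r h = h'}"
    then have rp: "r permutes insert h (insert h' A)" and rh: "r h = h'" "r h' = h" and rr: "\<And>x. x \<in> A \<Longrightarrow> r x \<noteq> x \<and> r (r x) = x"
      by (auto simp: matchings_def)
    have "r \<circ> Transposition.transpose h h' permutes insert h (insert h' A)"
      by (intro permutes_compose permutes_swap_id rp) auto
    then have p: "r \<circ> Transposition.transpose h h' permutes A"
      by (rule permutes_superset) (auto simp: rh)
    have same: "(r \<circ> Transposition.transpose h h') x = r x" if "x \<in> A" for x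
      using that h by (auto simp: Transposition.transpose_def)
    moreover have "r x \<in> A" if "x \<in> A" for x
      using permutes_in_image[OF p, of x] that same by simp
    ultimately show "r \<circ> Transposition.transpose h h' \<in> matchings A"
      using p rr by (auto simp: matchings_def simp del: comp_apply)
  qed
qed (simp_all add: comp_assoc)

text \<open>The element \<open>h\<close> is inserted first, with the elements of \<open>X\<close> as
  possible predecessors; then \<open>h'\<close>, which may also follow \<open>h\<close>. Hence the
  different ranges of \<open>a\<close> and \<open>b\<close>.\<close>

lemma sum_pairs_insert:
  fixes f :: "('a \<Rightarrow> 'a) \<Rightarrow> ('a \<Rightarrow> 'a) \<Rightarrow> 'b::comm_monoid_add"
  assumes X: "finite X" "X \<noteq> {}" and h: "h \<notin> X" "h' \<notin> X" "h \<noteq> h'"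
  shows "(\<Sum>t\<in>full_cycles (insert h (insert h' X)). \<Sum>r | r \<in> matchings (insert h (insert h' X)) \<and> r h = h'. f t r)
    = (\<Sum>t\<in>full_cycles X. \<Sum>r\<in>matchings X. \<Sum>a\<in>X. \<Sum>b\<in>insert h X.
        f (t \<circ> Transposition.transpose h a \<circ> Transposition.transpose h' b) (r \<circ> Transposition.transpose h h'))"
proof -
  let ?g = "\<lambda>t. \<Sum>r\<in>matchings X. f t (r \<circ> Transposition.transpose h h')"
  have "(\<Sum>t\<in>full_cycles (insert h (insert h' X)). \<Sum>r | r \<in> matchings (insert h (insert h' X)) \<and> r h = h'. f t r)
    = (\<Sum>t\<in>full_cycles (insert h (insert h' X)). ?g t)"
    by (intro sum.cong refl sum.reindex_bij_betw[OF matchings_insert[OF h], symmetric])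
  also have "\<dots> = (\<Sum>t\<in>full_cycles (insert h' (insert h X)). ?g t)"
    by (simp only: insert_commute[of h h'])
  also have "\<dots> = (\<Sum>(t, b)\<in>full_cycles (insert h X) \<times> insert h X. ?g (t \<circ> Transposition.transpose h' b))"
    using X h by (subst sum.reindex_bij_betw[OF full_cycles_insert, symmetric]) (auto simp: case_prod_unfold)
  also have "\<dots> = (\<Sum>t\<in>full_cycles (insert h X). \<Sum>b\<in>insert h X. ?g (t \<circ> Transposition.transpose h' b))"
    by (rule sum.cartesian_product[symmetric])
  also have "\<dots> = (\<Sum>(t, a)\<in>full_cycles X \<times> X. \<Sum>b\<in>insert h X. ?g (t \<circ> Transposition.transpose h a \<circ> Transposition.transpose h' b))"
    using X h by (subst sum.reindex_bij_betw[OF full_cycles_insert, symmetric]) (auto simp: case_prod_unfold)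
  also have "\<dots> = (\<Sum>t\<in>full_cycles X. \<Sum>a\<in>X. \<Sum>b\<in>insert h X. ?g (t \<circ> Transposition.transpose h a \<circ> Transposition.transpose h' b))"
    by (rule sum.cartesian_product[symmetric])
  also have "\<dots> = (\<Sum>t\<in>full_cycles X. \<Sum>r\<in>matchings X. \<Sum>a\<in>X. \<Sum>b\<in>insert h X.
        f (t \<circ> Transposition.transpose h a \<circ> Transposition.transpose h' b) (r \<circ> Transposition.transpose h h'))"
    by (intro sum.cong refl) (simp add: sum.swap[of _ "matchings X"])
  finally show ?thesis .
qed

text \<open>Conjugation, in the form valid when \<open>p\<close> is its own inverse; it is applied
  to transpositions.\<close>

definition conj_by :: "('a \<Rightarrow> 'a) \<Rightarrow> ('a \<Rightarrow> 'a) \<Rightarrow> 'a \<Rightarrow> 'a" where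
  "conj_by p t = p \<circ> t \<circ> p"

lemma bij_betw_conj_by:
  assumes p: "p permutes A" "p \<circ> p = id" and S: "\<And>t. t \<in> S \<Longrightarrow> conj_by p t \<in> S'" "\<And>t. t \<in> S' \<Longrightarrow> conj_by p t \<in> S"
  shows "bij_betw (conj_by p) S S'"
proof -
  have "conj_by p (conj_by p t) = t" for t
    unfolding conj_by_def using p(2) by (simp add: comp_assoc) (simp flip: comp_assoc add: p(2))
  then show ?thesis using S by (intro bij_betwI[where g = "conj_by p"]) auto
qed

lemma conj_by_permutes: "p permutes A \<Longrightarrow> t permutes A \<Longrightarrow> conj_by p t permutes A"
  unfolding conj_by_def by (intro permutes_compose)

lemma conj_by_full_cycles:
  assumes A: "finite A" and p: "p permutes A" "p \<circ> p = id" and t: "t \<in> full_cycles A"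
  shows "conj_by p t \<in> full_cycles A"
proof -
  have tp: "t permutes A" using t by (simp add: full_cycles_def)
  have pp: "p (p x) = x" for x using p(2) by (metis comp_apply id_apply)
  have orb: "orbit (conj_by p t) (p x) = p ` orbit t x" for x
    using permutation_self_in_orbit[OF permutes_finite_permutation[OF A tp]]
    by (intro orbit_inverse[symmetric]) (auto simp: conj_by_def pp)
  have "orbit (conj_by p t) x = A" if "x \<in> A" for x
  proof -
    have "p x \<in> A" using that p by (simp add: permutes_in_image)
    then have "orbit t (p x) = A" using t by (simp add: full_cycles_def)
    then show ?thesis using orb[of "p x"] p by (simp add: pp permutes_image)
  qed
  then show ?thesis using conj_by_permutes[OF p(1) tp] by (simp add: full_cycles_def)
qed

lemma conj_by_matchings:
  assumes p: "p permutes A" "p \<circ> p = id" and r: "r \<in> matchings A"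
  shows "conj_by p r \<in> matchings A"
proof -
  have pp: "p (p x) = x" for x using p(2) by (metis comp_apply id_apply)
  have "p (r (p x)) \<noteq> x" if "x \<in> A" for x
  proof
    assume "p (r (p x)) = x"
    then have "r (p x) = p x" by (metis pp)
    then show False using r that p by (auto simp: matchings_def permutes_in_image)
  qed
  then show ?thesis using r p conj_by_permutes[OF p(1)]
    by (auto simp: matchings_def permutes_in_image pp conj_by_def)
qed

text \<open>Conjugation makes all partners of \<open>h\<close> equally likely.\<close>

lemma sum_pairs_fix_partner:
  fixes f :: "('a \<Rightarrow> 'a) \<Rightarrow> ('a \<Rightarrow> 'a) \<Rightarrow> nat"
  assumes Y: "finite Y" and h: "h \<in> Y" "h' \<in> Y" "h \<noteq> h'"
    and f: "\<And>p t r. p permutes Y \<Longrightarrow> p \<circ> p = id \<Longrightarrow> t \<in> full_cycles Y \<Longrightarrow> r \<in> matchings Y \<Longrightarrow> f (conj_by p t) (conj_by p r) = f t r"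
  shows "(\<Sum>t\<in>full_cycles Y. \<Sum>r\<in>matchings Y. f t r)
    = (card Y - 1) * (\<Sum>t\<in>full_cycles Y. \<Sum>r | r \<in> matchings Y \<and> r h = h'. f t r)"
proof -
  have each: "(\<Sum>t\<in>full_cycles Y. \<Sum>r | r \<in> matchings Y \<and> r h = c. f t r)
      = (\<Sum>t\<in>full_cycles Y. \<Sum>r | r \<in> matchings Y \<and> r h = h'. f t r)" if c: "c \<in> Y - {h}" for c
  proof -
    \<comment> \<open>Both \<open>c\<close> and \<open>h'\<close> differ from \<open>h\<close>, so
      this transposition fixes \<open>h\<close> and carries the matchings pairing \<open>h\<close>
      with \<open>c\<close> to those pairing it with \<open>h'\<close>.\<close>
    let ?p = "Transposition.transpose c h'"
    have p: "?p permutes Y" "?p \<circ> ?p = id" using c h by (auto intro: permutes_swap_id)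
    have ph: "?p h = h" using c h by (auto simp: Transposition.transpose_def)
    have b1: "bij_betw (conj_by ?p) (full_cycles Y) (full_cycles Y)"
      using p by (intro bij_betw_conj_by[OF p] conj_by_full_cycles[OF Y])
    have b2: "bij_betw (conj_by ?p) {r \<in> matchings Y. r h = c} {r \<in> matchings Y. r h = h'}"
      using p conj_by_matchings[OF p] by (intro bij_betw_conj_by[OF p]) (auto simp: conj_by_def ph)
    have "(\<Sum>t\<in>full_cycles Y. \<Sum>r | r \<in> matchings Y \<and> r h = h'. f t r)
      = (\<Sum>t\<in>full_cycles Y. \<Sum>r | r \<in> matchings Y \<and> r h = h'. f (conj_by ?p t) r)"
      by (rule sum.reindex_bij_betw[OF b1, symmetric])
    also have "\<dots> = (\<Sum>t\<in>full_cycles Y. \<Sum>r | r \<in> matchings Y \<and> r h = c. f (conj_by ?p t) (conj_by ?p r))"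
      by (intro sum.cong refl sum.reindex_bij_betw[OF b2, symmetric])
    also have "\<dots> = (\<Sum>t\<in>full_cycles Y. \<Sum>r | r \<in> matchings Y \<and> r h = c. f t r)"
      by (intro sum.cong refl f[OF p]) auto
    finally show ?thesis by simp
  qed
  have "(\<Sum>r\<in>matchings Y. f t r) = (\<Sum>c\<in>Y - {h}. \<Sum>r | r \<in> matchings Y \<and> r h = c. f t r)" for t
    using Y h by (intro sum.group[symmetric] finite_matchings) (auto simp: matchings_def permutes_in_image)
  then have "(\<Sum>t\<in>full_cycles Y. \<Sum>r\<in>matchings Y. f t r)
      = (\<Sum>t\<in>full_cycles Y. \<Sum>c\<in>Y - {h}. \<Sum>r | r \<in> matchings Y \<and> r h = c. f t r)" by simp
  also have "\<dots> = (\<Sum>c\<in>Y - {h}. \<Sum>t\<in>full_cycles Y. \<Sum>r | r \<in> matchings Y \<and> r h = c. f t r)"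
    by (rule sum.swap)
  also have "\<dots> = (\<Sum>c\<in>Y - {h}. \<Sum>t\<in>full_cycles Y. \<Sum>r | r \<in> matchings Y \<and> r h = h'. f t r)"
    by (intro sum.cong refl each)
  finally show ?thesis using h(1) Y by simp
qed

text \<open>As \<open>b\<close> runs through \<open>h\<close> and the cycle of \<open>a\<close>, that cycle is split in every ordered way; any other \<open>b\<close>
  joins the cycles of \<open>a\<close> and \<open>b\<close>.\<close>

lemma sum_add_edge:
  fixes \<mu> :: "nat \<Rightarrow>\<^sub>0 nat" and e :: "nat \<Rightarrow> nat \<Rightarrow>\<^sub>0 nat"
  assumes X: "finite X" and s: "s permutes X" and h: "h \<notin> X" "h' \<notin> X" "h \<noteq> h'" and a: "a \<in> X"
  defines "e \<equiv> \<lambda>i. Poly_Mapping.single i 1"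
  defines "l \<equiv> \<lambda>x. card (orbit s x)"
  shows "(\<Sum>b\<in>insert h X. of_bool (cycle_type (insert h (insert h' X)) (add_edge h h' a b s) = \<mu>))
    = (\<Sum>j\<le>l a. of_bool (\<mu> + e (l a - 1) = cycle_type X s + e j + e (l a - j)))
    + (\<Sum>b\<in>X - orbit s a. of_bool (\<mu> + e (l a - 1) + e (l b - 1) = cycle_type X s + e (l a + l b + 1)) :: nat)"
proof -
  let ?F = "\<lambda>b. cycle_type (insert h (insert h' X)) (add_edge h h' a b s)"
  have perm: "permutation s" using X s by (rule permutes_finite_permutation)
  obtain xs where xs: "distinct xs" "map s xs = rotate1 xs" "set xs = orbit s a" "xs \<noteq> []" "hd xs = a"
    using ex_cycle_list[OF perm] by blast
  have C: "orbit s a \<subseteq> X" using s a by (rule permutes_orbit_subset)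
  have lx: "length xs = l a" using distinct_card[OF xs(1)] xs(3) by (simp add: l_def)
  have hxs: "distinct (xs @ [h])" using xs C h by auto
  \<comment> \<open>Appending \<open>h\<close> to the cycle of \<open>a\<close> lists exactly the
    values of \<open>b\<close> that split it; the index \<open>j\<close> is the number of old
    elements in the first piece.\<close>
  have bij: "bij_betw ((!) (xs @ [h])) {..l a} (insert h (orbit s a))"
    using bij_betw_nth[OF hxs, of "{..l a}" "insert h (orbit s a)"] lx xs(3)
    by (simp add: lessThan_Suc_atMost)
  have "(\<Sum>b\<in>insert h X. of_bool (?F b = \<mu>)) = (\<Sum>b\<in>insert h (orbit s a) \<union> (X - orbit s a). of_bool (?F b = \<mu>))"
    using C by (intro sum.cong) auto
  also have "\<dots> = (\<Sum>b\<in>insert h (orbit s a). of_bool (?F b = \<mu>)) + (\<Sum>b\<in>X - orbit s a. of_bool (?F b = \<mu>))"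
    using C X h finite_subset[OF C X] by (intro sum.union_disjoint) auto
  also have "(\<Sum>b\<in>insert h (orbit s a). of_bool (?F b = \<mu>)) = (\<Sum>j\<le>l a. of_bool (?F ((xs @ [h]) ! j) = \<mu>))"
    by (rule sum.reindex_bij_betw[OF bij, symmetric])
  also have "\<dots> = (\<Sum>j\<le>l a. of_bool (\<mu> + e (l a - 1) = cycle_type X s + e j + e (l a - j)))"
  proof (intro sum.cong refl arg_cong[where f = of_bool])
    fix j assume "j \<in> {..l a}"
    then have "?F ((xs @ [h]) ! j) + e (l a - 1) = cycle_type X s + e j + e (l a - j)"
      using cycle_type_split[OF X s h a xs(1,2) _ xs(4,5), of j "(xs @ [h]) ! j"] C
      by (simp add: e_def lx xs(3))
    then show "(?F ((xs @ [h]) ! j) = \<mu>) = (\<mu> + e (l a - 1) = cycle_type X s + e j + e (l a - j))"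
      by (metis add_right_cancel)
  qed
  also have "(\<Sum>b\<in>X - orbit s a. of_bool (?F b = \<mu>))
      = (\<Sum>b\<in>X - orbit s a. of_bool (\<mu> + e (l a - 1) + e (l b - 1) = cycle_type X s + e (l a + l b + 1)))"
  proof (intro sum.cong refl arg_cong[where f = of_bool])
    fix b assume b: "b \<in> X - orbit s a"
    obtain ys where ys: "distinct ys" "map s ys = rotate1 ys" "set ys = orbit s b" "ys \<noteq> []" "hd ys = b"
      using ex_cycle_list[OF perm] by blast
    have ly: "length ys = l b" using distinct_card[OF ys(1)] ys(3) by (simp add: l_def)
    have "orbit s a \<inter> orbit s b = {}"
    proof (rule ccontr)
      assume "orbit s a \<inter> orbit s b \<noteq> {}"
      then have "orbit s a = orbit s b" using orbit_eq_if_in[OF perm] by blast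
      then show False using b permutation_self_in_orbit[OF perm, of b] by simp
    qed
    moreover have "orbit s b \<subseteq> X" using s b by (intro permutes_orbit_subset) auto
    ultimately have "?F b + e (l a - 1) + e (l b - 1) = cycle_type X s + e (l a + l b + 1)"
      using cycle_type_join[OF X s h a xs(1,2) _ xs(4,5) ys(1,2) _ ys(4,5)] C
      by (simp add: e_def lx ly xs(3) ys(3))
    then show "(?F b = \<mu>) = (\<mu> + e (l a - 1) + e (l b - 1) = cycle_type X s + e (l a + l b + 1))"
      by (metis add_right_cancel)
  qed
  finally show ?thesis .
qed

section \<open>The recursion for the number of pairs, and the constraints on size and genus\<close>

section \<open>Counting pairs by cycle type\<close>

definition pair_count :: "nat \<Rightarrow> (nat \<Rightarrow>\<^sub>0 nat) \<Rightarrow> nat" where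
  "pair_count k \<mu> = (\<Sum>t\<in>full_cycles {..<2 * k}. \<Sum>r\<in>matchings {..<2 * k}.
     of_bool (cycle_type {..<2 * k} (inv t \<circ> r) = \<mu>))"

lemma pair_permutes:
  "t \<in> full_cycles A \<Longrightarrow> r \<in> matchings A \<Longrightarrow> inv t \<circ> r permutes A"
  by (auto simp: full_cycles_def matchings_def intro!: permutes_compose permutes_inv)

lemma cycle_type_conj_by:
  assumes A: "finite A" and p: "p permutes A" "p \<circ> p = id" and t: "t \<in> full_cycles A" and r: "r \<in> matchings A"
  shows "cycle_type A (inv (conj_by p t) \<circ> conj_by p r) = cycle_type A (inv t \<circ> r)"
proof (rule cycle_type_conj[where t = p])
  have pp: "p (p x) = x" for x using p(2) by (metis comp_apply id_apply)
  have bt: "bij t" using t by (auto simp: full_cycles_def intro: permutes_bij)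
  have bp: "bij p" using p(1) by (rule permutes_bij)
  have "inv p = p" using p(2) by (simp add: inv_unique_comp)
  then have "inv (conj_by p t) = conj_by p (inv t)"
    using bt bp by (simp add: conj_by_def o_inv_distrib bij_comp comp_assoc)
  then show "(inv (conj_by p t) \<circ> conj_by p r) (p x) = p ((inv t \<circ> r) x)" for x
    by (simp add: conj_by_def pp)
  show "bij p" by (rule bp)
  show "p ` A = A" using p(1) by (rule permutes_image)
qed (use A pair_permutes[OF t r] in auto)

text \<open>The element \<open>2 k\<close> has \<open>2 k + 1\<close> possible partners, all
  contributing equally by conjugation. With the partner \<open>2 k + 1\<close> fixed, deleting both
  elements leaves an arbitrary pair on \<open>2 k\<close> points. The deletion is inverse to
  insertion into a non-empty cycle, hence \<open>k \<ge> 1\<close>.\<close>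

lemma pair_count_Suc:
  assumes k: "1 \<le> k"
  shows "pair_count (Suc k) \<mu> = (2 * k + 1) *
    (\<Sum>t\<in>full_cycles {..<2 * k}. \<Sum>r\<in>matchings {..<2 * k}. \<Sum>a\<in>{..<2 * k}. \<Sum>b\<in>insert (2 * k) {..<2 * k}.
      of_bool (cycle_type (insert (2 * k) (insert (2 * k + 1) {..<2 * k}))
        (add_edge (2 * k) (2 * k + 1) a b (inv t \<circ> r)) = \<mu>))"
proof -
  let ?X = "{..<2 * k}" and ?h = "2 * k" and ?h' = "2 * k + 1"
  let ?Y = "insert ?h (insert ?h' ?X)"
  have Y: "{..<2 * Suc k} = ?Y" by auto
  let ?f = "\<lambda>t r. of_bool (cycle_type ?Y (inv t \<circ> r) = \<mu>) :: nat"
  have "pair_count (Suc k) \<mu> = (\<Sum>t\<in>full_cycles ?Y. \<Sum>r\<in>matchings ?Y. ?f t r)"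
    unfolding pair_count_def Y ..
  also have "\<dots> = (card ?Y - 1) * (\<Sum>t\<in>full_cycles ?Y. \<Sum>r | r \<in> matchings ?Y \<and> r ?h = ?h'. ?f t r)"
    by (rule sum_pairs_fix_partner) (auto simp: cycle_type_conj_by)
  also have "(\<Sum>t\<in>full_cycles ?Y. \<Sum>r | r \<in> matchings ?Y \<and> r ?h = ?h'. ?f t r)
    = (\<Sum>t\<in>full_cycles ?X. \<Sum>r\<in>matchings ?X. \<Sum>a\<in>?X. \<Sum>b\<in>insert ?h ?X.
        ?f (t \<circ> Transposition.transpose ?h a \<circ> Transposition.transpose ?h' b) (r \<circ> Transposition.transpose ?h ?h'))"
    by (rule sum_pairs_insert) (use k in \<open>auto simp: lessThan_empty_iff\<close>)
  also have "\<dots> = (\<Sum>t\<in>full_cycles ?X. \<Sum>r\<in>matchings ?X. \<Sum>a\<in>?X. \<Sum>b\<in>insert ?h ?X.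
      of_bool (cycle_type ?Y (add_edge ?h ?h' a b (inv t \<circ> r)) = \<mu>))"
  proof (intro sum.cong refl)
    fix t r a b assume t: "t \<in> full_cycles ?X"
    have bt: "bij t" using t by (auto simp: full_cycles_def intro: permutes_bij)
    have "inv (t \<circ> Transposition.transpose ?h a \<circ> Transposition.transpose ?h' b)
        = Transposition.transpose ?h' b \<circ> (Transposition.transpose ?h a \<circ> inv t)"
      using bt by (simp add: o_inv_distrib bij_comp inv_transpose_eq)
    then show "?f (t \<circ> Transposition.transpose ?h a \<circ> Transposition.transpose ?h' b) (r \<circ> Transposition.transpose ?h ?h')
      = of_bool (cycle_type ?Y (add_edge ?h ?h' a b (inv t \<circ> r)) = \<mu>)"
      by (simp add: add_edge_def comp_assoc)
  qed
  also have "card ?Y - 1 = 2 * k + 1" by simp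
  finally show ?thesis .
qed

lemma sum_by_cycle_length:
  fixes g :: "nat \<Rightarrow> nat"
  assumes A: "finite A" "s permutes A" and M: "card A \<le> M"
  shows "(\<Sum>x\<in>A. g (card (orbit s x) - 1)) = (\<Sum>i\<le>M. Suc i * Poly_Mapping.lookup (cycle_type A s) i * g i)"
proof -
  have pos: "0 < card (orbit s x)" for x using A by (rule card_orbit_pos)
  have le: "card (orbit s x) - 1 \<le> M" if "x \<in> A" for x
    using card_mono[OF A(1) permutes_orbit_subset[OF A(2) that]] M by simp
  have "(\<Sum>x\<in>A. g (card (orbit s x) - 1)) = (\<Sum>i\<le>M. \<Sum>x | x \<in> A \<and> card (orbit s x) - 1 = i. g (card (orbit s x) - 1))"
    using A(1) le by (intro sum.group[symmetric]) auto
  also have "\<dots> = (\<Sum>i\<le>M. Suc i * Poly_Mapping.lookup (cycle_type A s) i * g i)"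
  proof (intro sum.cong refl)
    fix i
    have "{x. x \<in> A \<and> card (orbit s x) - 1 = i} = {x \<in> A. card (orbit s x) = Suc i}"
      using pos by (auto simp: Suc_pred')
    then show "(\<Sum>x | x \<in> A \<and> card (orbit s x) - 1 = i. g (card (orbit s x) - 1))
        = Suc i * Poly_Mapping.lookup (cycle_type A s) i * g i"
      by (simp add: card_points_in_cycles[OF A])
  qed
  finally show ?thesis .
qed

text \<open>Leaving out the cycle of \<open>a\<close> lowers by one the number of available cycles
  of its own length. This becomes the correction for equal indices in the coefficient of a second
  derivative.\<close>

lemma sum_by_cycle_length_other:
  fixes g :: "nat \<Rightarrow> nat"
  assumes A: "finite A" "s permutes A" and M: "card A \<le> M" and a: "a \<in> A"
  shows "(\<Sum>x\<in>A - orbit s a. g (card (orbit s x) - 1))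
    = (\<Sum>i\<le>M. Suc i * (Poly_Mapping.lookup (cycle_type A s) i - of_bool (i = card (orbit s a) - 1)) * g i)"
proof -
  let ?l = "\<lambda>x. card (orbit s x)"
  have perm: "permutation s" using A by (rule permutes_finite_permutation)
  have pos: "0 < ?l x" for x using A by (rule card_orbit_pos)
  have C: "orbit s a \<subseteq> A" using A(2) a by (rule permutes_orbit_subset)
  have Cl: "?l x = ?l a" if "x \<in> orbit s a" for x using orbit_eq_if_in[OF perm that] by simp
  have le: "?l x - 1 \<le> M" if "x \<in> A" for x
    using card_mono[OF A(1) permutes_orbit_subset[OF A(2) that]] M by simp
  have "(\<Sum>x\<in>A - orbit s a. g (?l x - 1)) = (\<Sum>i\<le>M. \<Sum>x | x \<in> A - orbit s a \<and> ?l x - 1 = i. g (?l x - 1))"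
    using A(1) le by (intro sum.group[symmetric]) auto
  also have "\<dots> = (\<Sum>i\<le>M. Suc i * (Poly_Mapping.lookup (cycle_type A s) i - of_bool (i = ?l a - 1)) * g i)"
  proof (intro sum.cong refl)
    fix i
    have eq: "?l x - 1 = i \<longleftrightarrow> ?l x = Suc i" for x using pos[of x] by linarith
    have "{x. x \<in> A - orbit s a \<and> ?l x - 1 = i} = {x \<in> A. ?l x = Suc i} - (if ?l a = Suc i then orbit s a else {})"
      unfolding eq using Cl by auto
    moreover have "card \<dots> = card {x \<in> A. ?l x = Suc i} - card (if ?l a = Suc i then orbit s a else {})"
      using C Cl by (intro card_Diff_subset) (auto intro: finite_orbit_permutes[OF A])
    moreover have "i = ?l a - 1 \<longleftrightarrow> ?l a = Suc i" using eq[of a] by auto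
    ultimately have "card {x. x \<in> A - orbit s a \<and> ?l x - 1 = i}
        = Suc i * (Poly_Mapping.lookup (cycle_type A s) i - of_bool (i = ?l a - 1))"
      by (simp add: card_points_in_cycles[OF A] diff_mult_distrib2)
    then show "(\<Sum>x | x \<in> A - orbit s a \<and> ?l x - 1 = i. g (?l x - 1))
        = Suc i * (Poly_Mapping.lookup (cycle_type A s) i - of_bool (i = ?l a - 1)) * g i"
      by simp
  qed
  finally show ?thesis .
qed

text \<open>The weights with which a pair of type \<open>\<nu>\<close> yields the type \<open>\<mu>\<close> when an edge is added; any bound \<open>M\<close> on
  the cycle lengths will do.\<close>

definition split_ways :: "nat \<Rightarrow> (nat \<Rightarrow>\<^sub>0 nat) \<Rightarrow> (nat \<Rightarrow>\<^sub>0 nat) \<Rightarrow> nat" where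
  "split_ways M \<nu> \<mu> = (\<Sum>i\<le>M. \<Sum>j\<le>Suc i. Suc i * Poly_Mapping.lookup \<nu> i *
     of_bool (\<mu> + Poly_Mapping.single i 1 = \<nu> + Poly_Mapping.single j 1 + Poly_Mapping.single (Suc i - j) 1))"

definition join_ways :: "nat \<Rightarrow> (nat \<Rightarrow>\<^sub>0 nat) \<Rightarrow> (nat \<Rightarrow>\<^sub>0 nat) \<Rightarrow> nat" where
  "join_ways M \<nu> \<mu> = (\<Sum>i\<le>M. \<Sum>j\<le>M. Suc i * Suc j * (Poly_Mapping.lookup \<nu> i * (Poly_Mapping.lookup \<nu> j - of_bool (j = i))) *
     of_bool (\<mu> + Poly_Mapping.single i 1 + Poly_Mapping.single j 1 = \<nu> + Poly_Mapping.single (i + j + 3) 1))"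

text \<open>Summing over all \<open>a\<close> and \<open>b\<close> weights cycles by their numbers
  of points, and the result depends on \<open>s\<close> only through its cycle type. This is what
  closes the recursion.\<close>

lemma sum_add_edges:
  assumes X: "finite X" and s: "s permutes X" and h: "h \<notin> X" "h' \<notin> X" "h \<noteq> h'" and M: "card X \<le> M"
  shows "(\<Sum>a\<in>X. \<Sum>b\<in>insert h X. of_bool (cycle_type (insert h (insert h' X)) (add_edge h h' a b s) = \<mu>))
    = split_ways M (cycle_type X s) \<mu> + join_ways M (cycle_type X s) \<mu>"
proof -
  let ?e = "\<lambda>i. Poly_Mapping.single i 1 :: nat \<Rightarrow>\<^sub>0 nat" and ?l = "\<lambda>x. card (orbit s x)"
  let ?n = "cycle_type X s"
  let ?g1 = "\<lambda>i. \<Sum>j\<le>Suc i. of_bool (\<mu> + ?e i = ?n + ?e j + ?e (Suc i - j)) :: nat"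
  let ?g2 = "\<lambda>i j. of_bool (\<mu> + ?e i + ?e j = ?n + ?e (i + j + 3)) :: nat"
  have pos: "0 < ?l x" for x using X s by (rule card_orbit_pos)
  have "(\<Sum>a\<in>X. \<Sum>b\<in>insert h X. of_bool (cycle_type (insert h (insert h' X)) (add_edge h h' a b s) = \<mu>))
    = (\<Sum>a\<in>X. ?g1 (?l a - 1) + (\<Sum>b\<in>X - orbit s a. ?g2 (?l a - 1) (?l b - 1)))"
  proof (intro sum.cong refl)
    fix a assume a: "a \<in> X"
    have la: "Suc (?l a - 1) = ?l a" using pos[of a] by simp
    have lb: "?l a - 1 + (?l b - 1) + 3 = ?l a + ?l b + 1" for b using pos[of a] pos[of b] by linarith
    show "(\<Sum>b\<in>insert h X. of_bool (cycle_type (insert h (insert h' X)) (add_edge h h' a b s) = \<mu>))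
      = ?g1 (?l a - 1) + (\<Sum>b\<in>X - orbit s a. ?g2 (?l a - 1) (?l b - 1))"
      unfolding sum_add_edge[OF X s h a] la lb ..
  qed
  also have "\<dots> = (\<Sum>a\<in>X. ?g1 (?l a - 1)) + (\<Sum>a\<in>X. \<Sum>b\<in>X - orbit s a. ?g2 (?l a - 1) (?l b - 1))"
    by (rule sum.distrib)
  also have "(\<Sum>a\<in>X. ?g1 (?l a - 1)) = split_ways M ?n \<mu>"
    unfolding sum_by_cycle_length[OF X s M, of ?g1] by (simp only: split_ways_def sum_distrib_left)
  also have "(\<Sum>a\<in>X. \<Sum>b\<in>X - orbit s a. ?g2 (?l a - 1) (?l b - 1))
      = (\<Sum>a\<in>X. (\<lambda>i. \<Sum>j\<le>M. Suc j * (Poly_Mapping.lookup ?n j - of_bool (j = i)) * ?g2 i j) (?l a - 1))"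
    by (intro sum.cong refl) (simp only: sum_by_cycle_length_other[OF X s M, of _ "?g2 _"])
  also have "\<dots> = (\<Sum>i\<le>M. Suc i * Poly_Mapping.lookup ?n i *
      (\<Sum>j\<le>M. Suc j * (Poly_Mapping.lookup ?n j - of_bool (j = i)) * ?g2 i j))"
    by (rule sum_by_cycle_length[OF X s M])
  also have "\<dots> = join_ways M ?n \<mu>"
    unfolding join_ways_def
    by (intro sum.cong refl) (simp only: sum_distrib_left mult.assoc mult.left_commute)
  finally show ?thesis .
qed

lemma pair_count_recursion:
  assumes k: "1 \<le> k" and M: "2 * k \<le> M"
  shows "pair_count (Suc k) \<mu> = (2 * k + 1) *
    (\<Sum>t\<in>full_cycles {..<2 * k}. \<Sum>r\<in>matchings {..<2 * k}.
      split_ways M (cycle_type {..<2 * k} (inv t \<circ> r)) \<mu> + join_ways M (cycle_type {..<2 * k} (inv t \<circ> r)) \<mu>)"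
  unfolding pair_count_Suc[OF k]
  by (intro arg_cong[where f = "(*) _"] sum.cong refl sum_add_edges pair_permutes) (use M in auto)

lemma transpose_only_01:
  assumes "t permutes {..<2::nat}" "t 0 \<noteq> 0"
  shows "t = Transposition.transpose 0 1"
proof
  fix x
  have "t 0 \<in> {..<2}" "t 1 \<in> {..<2}" using permutes_in_image[OF assms(1), of 0] permutes_in_image[OF assms(1), of 1] by auto
  moreover have "t 1 \<noteq> t 0" using assms(1) by (metis permutes_inj injD zero_neq_one)
  ultimately have "t 0 = 1" "t 1 = 0" using assms(2) by auto
  moreover have "t x = x" if "x \<noteq> 0" "x \<noteq> 1" using assms(1) that by (intro permutes_not_in) auto
  ultimately show "t x = Transposition.transpose 0 1 x"
    by (cases "x = 0"; cases "x = 1") auto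
qed

lemma pair_count_1: "pair_count 1 \<mu> = of_bool (\<mu> = Poly_Mapping.single 0 1 + Poly_Mapping.single 0 1)"
proof -
  let ?t = "Transposition.transpose 0 (1::nat)"
  have A: "{..<2::nat} = {0, 1}" by auto
  have tp: "?t permutes {..<2}" by (intro permutes_swap_id) auto
  have "matchings {..<2::nat} = {?t}"
  proof (intro set_eqI iffI)
    fix r assume "r \<in> matchings {..<2::nat}"
    then have "r permutes {..<2}" "r 0 \<noteq> 0" by (auto simp: matchings_def)
    then show "r \<in> {?t}" using transpose_only_01 by blast
  next
    fix r :: "nat \<Rightarrow> nat" assume "r \<in> {?t}"
    then show "r \<in> matchings {..<2::nat}" using tp by (auto simp: matchings_def A)
  qed
  moreover have "full_cycles {..<2::nat} = {?t}"
  proof (intro set_eqI iffI)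
    fix t assume t: "t \<in> full_cycles {..<2::nat}"
    then have "t permutes {..<2}" "orbit t 0 = {..<2}" by (auto simp: full_cycles_def)
    moreover have "t 0 \<noteq> 0"
    proof
      assume "t 0 = 0"
      then have "orbit t 0 \<subseteq> {0}" by (intro orbit_subset_invariant) auto
      then show False using calculation(2) by (auto simp: A)
    qed
    ultimately show "t \<in> {?t}" using transpose_only_01 by blast
  next
    fix t :: "nat \<Rightarrow> nat" assume "t \<in> {?t}"
    then show "t \<in> full_cycles {..<2::nat}"
      using tp full_cycleI[of ?t "{..<2}" "[0, 1]"] by (simp add: A)
  qed
  moreover have "cycle_type {..<2} (inv ?t \<circ> ?t) = Poly_Mapping.single 0 1 + Poly_Mapping.single 0 1"
  proof -
    have orb: "orbit id x = {x}" for x :: nat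
    proof -
      have "orbit id x \<subseteq> {x}" by (intro orbit_subset_invariant) auto
      then show ?thesis using orbit_nonempty[of id x] by auto
    qed
    have "inv ?t \<circ> ?t = id" by (simp add: inv_transpose_eq)
    then show ?thesis by (simp add: cycle_type_def A orb)
  qed
  ultimately show ?thesis by (auto simp: pair_count_def)
qed

lemma n_mu_superset: "finite S \<Longrightarrow> Poly_Mapping.keys \<mu> \<subseteq> S \<Longrightarrow> n_mu \<mu> = (\<Sum>i\<in>S. Poly_Mapping.lookup \<mu> i)"
  unfolding n_mu_def by (rule sum.mono_neutral_left) (auto simp: in_keys_iff)

lemma d_mu_superset: "finite S \<Longrightarrow> Poly_Mapping.keys \<mu> \<subseteq> S \<Longrightarrow> d_mu \<mu> = (\<Sum>i\<in>S. i * Poly_Mapping.lookup \<mu> i)"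
  unfolding d_mu_def by (rule sum.mono_neutral_left) (auto simp: in_keys_iff)

lemma n_mu_add: "n_mu (\<mu> + \<nu>) = n_mu \<mu> + n_mu \<nu>"
proof -
  let ?S = "Poly_Mapping.keys \<mu> \<union> Poly_Mapping.keys \<nu>"
  have "Poly_Mapping.keys (\<mu> + \<nu>) \<subseteq> ?S" by (rule Poly_Mapping.keys_add)
  then show ?thesis by (simp add: n_mu_superset[of ?S] lookup_add sum.distrib)
qed

lemma n_mu_single: "n_mu (Poly_Mapping.single i 1) = 1"
  by (simp add: n_mu_def)

lemma pair_count_witness:
  assumes "pair_count k \<mu> \<noteq> 0"
  obtains s where "s permutes {..<2 * k}" "cycle_type {..<2 * k} s = \<mu>"
proof -
  obtain t where t: "t \<in> full_cycles {..<2 * k}"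
    "(\<Sum>r\<in>matchings {..<2 * k}. of_bool (cycle_type {..<2 * k} (inv t \<circ> r) = \<mu>)) \<noteq> (0::nat)"
    using assms unfolding pair_count_def by (rule sum.not_neutral_contains_not_neutral)
  from t(2) obtain r where r: "r \<in> matchings {..<2 * k}" "of_bool (cycle_type {..<2 * k} (inv t \<circ> r) = \<mu>) \<noteq> (0::nat)"
    by (rule sum.not_neutral_contains_not_neutral)
  show ?thesis
    by (rule that[of "inv t \<circ> r"]) (use r pair_permutes[OF t(1) r(1)] in auto)
qed

text \<open>The cycle lengths add up to the \<open>2 k\<close> points, and a cycle of index
  \<open>i\<close> has length \<open>i + 1\<close>: it contributes \<open>i\<close> to
  \<open>d_mu\<close> and 1 to \<open>n_mu\<close>.\<close>

lemma pair_count_size: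
  assumes "pair_count k \<mu> \<noteq> 0"
  shows "d_mu \<mu> + n_mu \<mu> = 2 * k"
proof -
  obtain s where s: "s permutes {..<2 * k}" "cycle_type {..<2 * k} s = \<mu>" using assms by (rule pair_count_witness)
  have keys: "Poly_Mapping.keys \<mu> \<subseteq> {..2 * k}"
  proof
    fix i assume "i \<in> Poly_Mapping.keys \<mu>"
    then have "0 < Suc i * Poly_Mapping.lookup \<mu> i" by (simp add: in_keys_iff)
    also have "\<dots> = card {x \<in> {..<2 * k}. card (orbit s x) = Suc i}"
      using card_points_in_cycles[of "{..<2 * k}" s i] s by simp
    finally have "{x \<in> {..<2 * k}. card (orbit s x) = Suc i} \<noteq> {}"
      by (metis card.empty less_numeral_extra(3))
    then obtain x where "x \<in> {..<2 * k}" "card (orbit s x) = Suc i" by blast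
    then show "i \<in> {..2 * k}"
      using card_mono[OF _ permutes_orbit_subset[OF s(1), of x]] by simp
  qed
  have "2 * k = (\<Sum>x\<in>{..<2 * k}. (\<lambda>_. 1) (card (orbit s x) - 1))" by simp
  also have "\<dots> = (\<Sum>i\<le>2 * k. Suc i * Poly_Mapping.lookup \<mu> i * 1)"
    using s sum_by_cycle_length[of "{..<2 * k}" s "2 * k" "\<lambda>_. 1"] by simp
  also have "\<dots> = d_mu \<mu> + n_mu \<mu>"
    using keys by (simp add: n_mu_superset[of "{..2 * k}"] d_mu_superset[of "{..2 * k}"] sum.distrib)
  finally show ?thesis by simp
qed

text \<open>Splitting a cycle preserves \<open>k + 1 - n_mu \<mu>\<close>, joining two cycles raises it by 2.\<close>

lemma pair_count_genus:
  assumes "1 \<le> k" "pair_count k \<mu> \<noteq> 0"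
  shows "\<exists>g. k + 1 = n_mu \<mu> + 2 * g"
  using assms
proof (induction k arbitrary: \<mu> rule: dec_induct)
  case base
  then have "\<mu> = Poly_Mapping.single 0 1 + Poly_Mapping.single 0 1"
    unfolding pair_count_1 by (simp only: of_bool_eq_0_iff not_not)
  then have "n_mu \<mu> = 2" by (simp only: n_mu_add n_mu_single)
  then show ?case by (intro exI[of _ 0]) simp
next
  case (step k)
  let ?n = "\<lambda>t r. cycle_type {..<2 * k} (inv t \<circ> r)"
  obtain t r where tr: "t \<in> full_cycles {..<2 * k}" "r \<in> matchings {..<2 * k}"
    and nz: "split_ways (2 * k) (?n t r) \<mu> + join_ways (2 * k) (?n t r) \<mu> \<noteq> 0"
  proof -
    have "(\<Sum>t\<in>full_cycles {..<2 * k}. \<Sum>r\<in>matchings {..<2 * k}.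
        split_ways (2 * k) (?n t r) \<mu> + join_ways (2 * k) (?n t r) \<mu>) \<noteq> 0"
      using step.prems pair_count_recursion[OF step.hyps(1), of "2 * k" \<mu>] by (intro notI) simp
    then obtain t where t: "t \<in> full_cycles {..<2 * k}" "(\<Sum>r\<in>matchings {..<2 * k}.
        split_ways (2 * k) (?n t r) \<mu> + join_ways (2 * k) (?n t r) \<mu>) \<noteq> 0"
      by (rule sum.not_neutral_contains_not_neutral)
    from t(2) obtain r where "r \<in> matchings {..<2 * k}"
        "split_ways (2 * k) (?n t r) \<mu> + join_ways (2 * k) (?n t r) \<mu> \<noteq> 0"
      by (rule sum.not_neutral_contains_not_neutral)
    with t(1) show ?thesis by (rule that)
  qed
  define \<nu> where "\<nu> = ?n t r"
  \<comment> \<open>The pair \<open>(t, r)\<close> is itself counted under its type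
    \<open>\<nu>\<close>, so the induction hypothesis applies to \<open>\<nu>\<close>.\<close>
  have "pair_count k \<nu> \<noteq> 0"
  proof
    assume "pair_count k \<nu> = 0"
    then show False
      using tr by (auto simp: pair_count_def \<nu>_def finite_full_cycles finite_matchings)
  qed
  then obtain g where g: "k + 1 = n_mu \<nu> + 2 * g" using step.IH by blast
  from nz have "split_ways (2 * k) \<nu> \<mu> \<noteq> 0 \<or> join_ways (2 * k) \<nu> \<mu> \<noteq> 0" by (auto simp: \<nu>_def)
  then show ?case
  proof
    assume "split_ways (2 * k) \<nu> \<mu> \<noteq> 0"
    then obtain i j where "\<mu> + Poly_Mapping.single i 1 = \<nu> + Poly_Mapping.single j 1 + Poly_Mapping.single (Suc i - j) 1"
      unfolding split_ways_def
      by (elim sum.not_neutral_contains_not_neutral) (auto simp: of_bool_def split: if_splits)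
    then have "n_mu (\<mu> + Poly_Mapping.single i 1) = n_mu (\<nu> + Poly_Mapping.single j 1 + Poly_Mapping.single (Suc i - j) 1)"
      by simp
    then have "n_mu \<mu> = n_mu \<nu> + 1" by (simp only: n_mu_add n_mu_single)
    then show ?thesis using g by (intro exI[of _ g]) simp
  next
    assume "join_ways (2 * k) \<nu> \<mu> \<noteq> 0"
    then obtain i j where "\<mu> + Poly_Mapping.single i 1 + Poly_Mapping.single j 1 = \<nu> + Poly_Mapping.single (i + j + 3) 1"
      unfolding join_ways_def
      by (elim sum.not_neutral_contains_not_neutral) (auto simp: of_bool_def split: if_splits)
    then have "n_mu (\<mu> + Poly_Mapping.single i 1 + Poly_Mapping.single j 1) = n_mu (\<nu> + Poly_Mapping.single (i + j + 3) 1)"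
      by simp
    then have "n_mu \<mu> + 1 = n_mu \<nu>" by (simp only: n_mu_add n_mu_single)
    then show ?thesis using g by (intro exI[of _ "Suc g"]) simp
  qed
qed

section \<open>The triples attached to a graph with one negative boundary\<close>

section \<open>Ribbon graphs as pairs of permutations\<close>

text \<open>Transport of \<open>f\<close> along the numbering \<open>\<theta>\<close>. Fixing every
  number from \<open>N\<close> on makes the result a permutation in the sense of
  \<open>permutes\<close>.\<close>

definition pull :: "(nat \<Rightarrow> 'a) \<Rightarrow> nat \<Rightarrow> ('a \<Rightarrow> 'a) \<Rightarrow> nat \<Rightarrow> nat" where
  "pull \<theta> N f = (\<lambda>i. if i < N then inv_into {..<N} \<theta> (f (\<theta> i)) else i)"

lemma pull_apply:
  assumes "bij_betw \<theta> {..<N} A" "f ` A \<subseteq> A" "i < N"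
  shows "\<theta> (pull \<theta> N f i) = f (\<theta> i)" "pull \<theta> N f i < N"
proof -
  have "f (\<theta> i) \<in> \<theta> ` {..<N}" using assms by (auto simp: bij_betw_def)
  then show "\<theta> (pull \<theta> N f i) = f (\<theta> i)" "pull \<theta> N f i < N"
    using assms(3) inv_into_into[of "f (\<theta> i)" \<theta> "{..<N}"] by (auto simp: pull_def f_inv_into_f)
qed

lemma pull_eqI:
  assumes "bij_betw \<theta> {..<N} A" "\<And>i. i < N \<Longrightarrow> g i < N \<and> \<theta> (g i) = f (\<theta> i)" "\<And>i. \<not> i < N \<Longrightarrow> g i = i"
  shows "pull \<theta> N f = g"
  using assms by (auto simp: pull_def bij_betw_def fun_eq_iff) (metis inv_into_f_f lessThan_iff)

lemma pull_permutes:
  assumes \<theta>: "bij_betw \<theta> {..<N} A" and f: "bij_betw f A A"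
  shows "pull \<theta> N f permutes {..<N}"
proof (rule bij_imp_permutes)
  have "bij_betw (inv_into {..<N} \<theta> \<circ> (f \<circ> \<theta>)) {..<N} {..<N}"
    using \<theta> f by (intro bij_betw_trans[OF bij_betw_trans] bij_betw_inv_into)
  then show "bij_betw (pull \<theta> N f) {..<N} {..<N}"
    by (rule bij_betw_cong[THEN iffD1, rotated]) (simp add: pull_def)
qed (simp add: pull_def)

lemma pull_orbit:
  assumes \<theta>: "bij_betw \<theta> {..<N} A" and f: "bij_betw f A A" and i: "i < N"
  shows "\<theta> ` orbit (pull \<theta> N f) i = orbit f (\<theta> i)"
proof (rule orbit_inverse)
  note p = pull_permutes[OF \<theta> f]
  show "i \<in> orbit (pull \<theta> N f) i"
    by (rule permutation_self_in_orbit[OF permutes_finite_permutation[OF _ p]]) simp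
  fix x assume "x \<in> orbit (pull \<theta> N f) i"
  then have "x < N" using permutes_orbit_subset[OF p, of i] i by auto
  then show "f (\<theta> x) = \<theta> (pull \<theta> N f x)"
    using pull_apply[OF \<theta>, of f x] f by (simp add: bij_betw_def)
qed

definition negs :: "('a, 'b) dribbon_scheme \<Rightarrow> 'a set" where
  "negs R = {x \<in> half_edges R. dir R x = -1}"

definition poss :: "('a, 'b) dribbon_scheme \<Rightarrow> 'a set" where
  "poss R = {x \<in> half_edges R. dir R x = 1}"

text \<open>The edges are identified with their negative halves, which \<open>\<theta>\<close> numbers. The components are the
  successor on the negative boundary, the opposite edge at the vertex (\<open>s2 s1\<close> is inverse to \<open>s0\<close>), and
  the label of the positive boundary.\<close>

definition key :: "'a dribbon \<Rightarrow> nat \<Rightarrow> (nat \<Rightarrow> 'a) \<Rightarrow> (nat \<Rightarrow> nat) \<times> (nat \<Rightarrow> nat) \<times> (nat \<Rightarrow> nat)" where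
  "key R N \<theta> = (pull \<theta> N (s2 R), pull \<theta> N (\<lambda>x. s2 R (s1 R (s2 R (s1 R x)))),
     \<lambda>i\<in>{..<N}. label R (orbit (s2 R) (s1 R (\<theta> i))))"

text \<open>A labelling of the cycles of \<open>s\<close>, stored as a function on points that is
  constant on cycles and separates them; in this way all components of a key are functions on
  numbers, whatever the graph.\<close>

definition labellings :: "nat \<Rightarrow> nat \<Rightarrow> (nat \<Rightarrow> nat) \<Rightarrow> (nat \<Rightarrow> nat) set" where
  "labellings N n s = {l \<in> {..<N} \<rightarrow>\<^sub>E {1..n}. l ` {..<N} = {1..n} \<and>
     (\<forall>i<N. \<forall>j<N. l i = l j \<longleftrightarrow> orbit s i = orbit s j)}"

definition all_keys :: "nat \<Rightarrow> nat \<Rightarrow> ((nat \<Rightarrow> nat) \<times> (nat \<Rightarrow> nat) \<times> (nat \<Rightarrow> nat)) set" where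
  "all_keys N n = {(t, r, l). t \<in> full_cycles {..<N} \<and> r \<in> matchings {..<N} \<and> l \<in> labellings N n (inv t \<circ> r)}"

text \<open>The keys for all numberings of the negative halves. Unlike a single key, this set is an
  invariant of the graph, and it turns out to be a complete one.\<close>

definition keys_of :: "'a dribbon \<Rightarrow> ((nat \<Rightarrow> nat) \<times> (nat \<Rightarrow> nat) \<times> (nat \<Rightarrow> nat)) set" where
  "keys_of R = {key R (card (negs R)) \<theta> | \<theta>. bij_betw \<theta> {..<card (negs R)} (negs R)}"

locale one_negative =
  fixes R :: "'a dribbon" and n :: nat
  assumes rg: "ribbon_graph R" and dirR: "direction R"
    and lp: "bij_betw (label R) (pos_boundaries R) {1..n}"
    and ln: "bij_betw (label R) (neg_boundaries R) {1..1}"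
    and q4: "\<forall>v\<in>vertices R. card v = 4"
begin

abbreviation "H \<equiv> half_edges R"
definition "N = card (negs R)"
text \<open>The action of \<open>s2\<close> on positive halves, carried over to negative halves by
  \<open>s1\<close>. Its cycles there correspond to the positive boundaries.\<close>

definition "nu = (\<lambda>x. s1 R (s2 R (s1 R x)))"
definition "opp = (\<lambda>x. s2 R (s1 R (s2 R (s1 R x))))"

lemma finH: "finite H"
  and p0: "s0 R permutes H" and p1: "s1 R permutes H" and p2: "s2 R permutes H"
  and s11: "x \<in> H \<Longrightarrow> s1 R (s1 R x) = x" "x \<in> H \<Longrightarrow> s1 R x \<noteq> x"
  and s210: "s2 R (s1 R (s0 R x)) = x"
  using rg by (auto simp: ribbon_graph_def fun_eq_iff)

lemma in_H: "s0 R x \<in> H \<longleftrightarrow> x \<in> H" "s1 R x \<in> H \<longleftrightarrow> x \<in> H" "s2 R x \<in> H \<longleftrightarrow> x \<in> H"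
  using p0 p1 p2 by (simp_all add: permutes_in_image)

lemma s021: "s0 R (s2 R (s1 R x)) = x"
proof -
  have "s2 R (s1 R (s0 R (s2 R (s1 R x)))) = s2 R (s1 R x)" by (rule s210)
  then show ?thesis using permutes_inj[OF p1] permutes_inj[OF p2] by (auto dest: injD)
qed

lemma dir_simps: "x \<in> H \<Longrightarrow> dir R (s2 R x) = dir R x" "x \<in> H \<Longrightarrow> dir R (s1 R x) = - dir R x"
  "x \<in> H \<Longrightarrow> dir R x = 1 \<or> dir R x = -1"
  using dirR by (auto simp: direction_def)

lemma H_split: "H = negs R \<union> poss R" "negs R \<inter> poss R = {}"
  using dir_simps(3) by (auto simp: negs_def poss_def)

lemma negs_H: "x \<in> negs R \<Longrightarrow> x \<in> H" and poss_H: "x \<in> poss R \<Longrightarrow> x \<in> H"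
  by (auto simp: negs_def poss_def)

lemma fin_negs: "finite (negs R)" using finH by (simp add: negs_def)

lemma s1_negs: "x \<in> negs R \<Longrightarrow> s1 R x \<in> poss R" and s1_poss: "x \<in> poss R \<Longrightarrow> s1 R x \<in> negs R"
  and s2_negs: "x \<in> negs R \<Longrightarrow> s2 R x \<in> negs R" and s2_poss: "x \<in> poss R \<Longrightarrow> s2 R x \<in> poss R"
  by (auto simp: negs_def poss_def in_H dir_simps)

lemma inj_s1: "inj (s1 R)" and inj_s2: "inj (s2 R)"
  using permutes_inj[OF p1] permutes_inj[OF p2] by auto

lemma endo_negs: "s2 R ` negs R \<subseteq> negs R" "nu ` negs R \<subseteq> negs R" "opp ` negs R \<subseteq> negs R"
  by (auto simp: nu_def opp_def intro!: s2_negs s1_poss s2_poss s1_negs)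

lemma bij_negs: "bij_betw (s2 R) (negs R) (negs R)" "bij_betw nu (negs R) (negs R)" "bij_betw opp (negs R) (negs R)"
proof -
  have "inj_on nu (negs R)" "inj_on opp (negs R)" "inj_on (s2 R) (negs R)"
    by (simp_all add: inj_on_def nu_def opp_def inj_eq[OF inj_s1] inj_eq[OF inj_s2])
  then show "bij_betw (s2 R) (negs R) (negs R)" "bij_betw nu (negs R) (negs R)" "bij_betw opp (negs R) (negs R)"
    using endo_negs fin_negs by (simp_all add: bij_betw_def endo_inj_surj)
qed

lemma perm2: "permutation (s2 R)" using finH p2 by (rule permutes_finite_permutation)

lemma orbit2_sub: "x \<in> negs R \<Longrightarrow> orbit (s2 R) x \<subseteq> negs R" "x \<in> poss R \<Longrightarrow> orbit (s2 R) x \<subseteq> poss R"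
  using orbit_subset_invariant[of "s2 R" "negs R" x] orbit_subset_invariant[of "s2 R" "poss R" x]
    s2_negs s2_poss by blast+

lemma negs_orbit: "x \<in> negs R \<Longrightarrow> orbit (s2 R) x = negs R" and negs_nonempty: "negs R \<noteq> {}"
proof -
  have "card (neg_boundaries R) = 1" using bij_betw_same_card[OF ln] by simp
  then obtain O1 where O1: "orbit (s2 R) ` negs R = {O1}"
    by (auto simp: neg_boundaries_def negs_def card_1_singleton_iff)
  then show "negs R \<noteq> {}" by auto
  assume x: "x \<in> negs R"
  have "y \<in> orbit (s2 R) x" if "y \<in> negs R" for y
  proof -
    have "orbit (s2 R) y = orbit (s2 R) x" using O1 x that by blast
    then show ?thesis using permutation_self_in_orbit[OF perm2, of y] by simp
  qed
  then show "orbit (s2 R) x = negs R" using orbit2_sub x by auto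
qed

lemma neg_boundaries: "neg_boundaries R = {negs R}"
  using negs_orbit negs_nonempty by (auto simp: neg_boundaries_def negs_def[symmetric])

lemma pos_boundaries: "pos_boundaries R = orbit (s2 R) ` poss R"
  by (simp add: pos_boundaries_def poss_def)

lemma boundaries: "boundaries R = neg_boundaries R \<union> pos_boundaries R"
proof -
  have "boundaries R = orbit (s2 R) ` (negs R \<union> poss R)" by (simp add: boundaries_def flip: H_split(1))
  then show ?thesis by (simp add: neg_boundaries_def pos_boundaries_def negs_def poss_def image_Un)
qed

lemma bij_s1: "bij_betw (s1 R) (negs R) (poss R)"
proof (rule bij_betwI[where g = "s1 R"])
qed (auto simp: s1_negs s1_poss s11 negs_H poss_H)

lemma edge_eq: "x \<in> H \<Longrightarrow> orbit (s1 R) x = {x, s1 R x}"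
  using orbit_eq_set[of "s1 R" "[x, s1 R x]" x] by (simp add: s11)

lemma edges_negs: "bij_betw (orbit (s1 R)) (negs R) (edges R)"
proof -
  have "inj_on (orbit (s1 R)) (negs R)"
  proof (rule inj_onI)
    fix x y assume xy: "x \<in> negs R" "y \<in> negs R" "orbit (s1 R) x = orbit (s1 R) y"
    have "y \<in> {x, s1 R x}" using xy by (metis edge_eq insertI1 negs_H)
    moreover have "y \<noteq> s1 R x" using s1_negs[OF xy(1)] xy(2) H_split(2) by auto
    ultimately show "x = y" by simp
  qed
  moreover have "orbit (s1 R) ` negs R = edges R"
  proof -
    have "orbit (s1 R) x \<in> orbit (s1 R) ` negs R" if "x \<in> poss R" for x
    proof -
      have "orbit (s1 R) x = orbit (s1 R) (s1 R x)"
        using that by (auto simp: edge_eq poss_H in_H s11)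
      then show ?thesis using s1_poss[OF that] by blast
    qed
    then show ?thesis by (auto simp: edges_def H_split(1))
  qed
  ultimately show ?thesis by (simp add: bij_betw_def)
qed

lemma edge_s1: "x \<in> H \<Longrightarrow> orbit (s1 R) (s1 R x) = orbit (s1 R) x"
  by (auto simp: edge_eq in_H s11)

lemma counts: "card H = 2 * N" "card (edges R) = N" "card (boundaries R) = n + 1" "2 * card (vertices R) = N"
proof -
  have cp: "card (poss R) = N" using bij_betw_same_card[OF bij_s1] by (simp add: N_def)
  show cH: "card H = 2 * N"
  proof -
    have "card H = card (negs R \<union> poss R)" by (simp flip: H_split(1))
    also have "\<dots> = card (negs R) + card (poss R)"
      using H_split(2) fin_negs finH by (intro card_Un_disjoint) (auto simp: poss_def)
    finally show ?thesis by (simp add: cp N_def)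
  qed
  show "card (edges R) = N" using bij_betw_same_card[OF edges_negs] by (simp add: N_def)
  have disj: "neg_boundaries R \<inter> pos_boundaries R = {}"
  proof -
    have "orbit (s2 R) x \<noteq> negs R" if "x \<in> poss R" for x
      using permutation_self_in_orbit[OF perm2, of x] that H_split(2) by auto
    then show ?thesis by (auto simp: neg_boundaries pos_boundaries)
  qed
  have "card (pos_boundaries R) = n" "card (neg_boundaries R) = 1"
    using bij_betw_same_card[OF lp] bij_betw_same_card[OF ln] by simp_all
  moreover have "finite (pos_boundaries R)" "finite (neg_boundaries R)"
    using finH by (simp_all add: pos_boundaries_def neg_boundaries_def)
  ultimately show "card (boundaries R) = n + 1"
    using disj by (simp add: boundaries card_Un_disjoint)
  have perm0: "permutation (s0 R)" using finH p0 by (rule permutes_finite_permutation)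
  have "H = \<Union> (vertices R)"
    using permutation_self_in_orbit[OF perm0] permutes_orbit_subset[OF p0] by (auto simp: vertices_def)
  moreover have "card (\<Union> (vertices R)) = (\<Sum>C\<in>vertices R. card C)"
  proof (rule card_Union_disjoint)
    show "pairwise disjnt (vertices R)"
    proof (rule pairwiseI)
      fix C D assume "C \<in> vertices R" "D \<in> vertices R" "C \<noteq> D"
      then obtain x y where "C = orbit (s0 R) x" "D = orbit (s0 R) y" "C \<noteq> D" by (auto simp: vertices_def)
      then show "disjnt C D" using orbit_eq_if_in[OF perm0] by (metis disjoint_iff disjnt_def)
    qed
  qed (auto simp: vertices_def finite_orbit_permutes[OF finH p0])
  ultimately have "card H = card (vertices R) * 4" using q4 by simp
  then show "2 * card (vertices R) = N" using cH by simp
qed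

text \<open>The Euler characteristic with \<open>N / 2\<close> vertices, \<open>N\<close> edges and
  \<open>n + 1\<close> boundaries. So the genus is determined by the number of edges and the number
  of boundaries.\<close>

lemma genus_iff: "has_genus R g \<longleftrightarrow> int N = 2 * (2 * int g + int n - 1)"
proof -
  have "int N = 2 * int (card (vertices R))" using counts(4) by linarith
  then show ?thesis unfolding has_genus_def counts(2,3) by (intro iffI) simp_all
qed

text \<open>\<open>opp\<close> is the inverse of \<open>s0\<close> applied twice. On a vertex of
  degree 4 the square of \<open>s0\<close> moves every half-edge, and its fourth power is the
  identity.\<close>

lemma opp_props:
  assumes x: "x \<in> negs R"
  shows "opp x \<noteq> x" "opp (opp x) = x"
proof -
  have xH: "x \<in> H" using x by (rule negs_H)
  have perm0: "permutation (s0 R)" using finH p0 by (rule permutes_finite_permutation)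
  have inv: "s0 R (s0 R (opp y)) = y" for y by (simp add: opp_def s021)
  obtain xs where xs: "distinct xs" "map (s0 R) xs = rotate1 xs" "set xs = orbit (s0 R) x" "xs \<noteq> []" "hd xs = x"
    using ex_cycle_list[OF perm0] by blast
  have "orbit (s0 R) x \<in> vertices R" using xH by (simp add: vertices_def)
  then have l4: "length xs = 4" using q4 distinct_card[OF xs(1)] xs(3) by simp
  have x0: "xs ! 0 = x" using xs(4,5) by (simp add: hd_conv_nth)
  have f: "(s0 R ^^ i) x = xs ! (i mod 4)" for i
    using funpow_rotate1[OF xs(2,4), of i] by (simp add: x0 l4)
  have "xs ! 2 \<noteq> xs ! 0" using xs(1) l4 by (simp add: nth_eq_iff_index_eq)
  then have ne: "s0 R (s0 R x) \<noteq> x" using f[of 2] by (simp add: x0 numeral_2_eq_2)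
  have "(s0 R ^^ 4) x = x" using f[of 4] by (simp add: x0)
  then have four: "s0 R (s0 R (s0 R (s0 R x))) = x" by (simp add: numeral_eq_Suc)
  show "opp x \<noteq> x" using inv[of x] ne by metis
  have inj: "inj (s0 R)" using p0 by (rule permutes_inj)
  have "s0 R (s0 R (s0 R (s0 R (opp (opp x))))) = x" by (simp add: inv)
  then show "opp (opp x) = x" using four inj by (metis injD)
qed

context
  fixes \<theta> assumes \<theta>: "bij_betw \<theta> {..<N} (negs R)"
begin

definition "tk = pull \<theta> N (s2 R)"
definition "rk = pull \<theta> N opp"
definition "nk = pull \<theta> N nu"

lemma \<theta>_negs: "i < N \<Longrightarrow> \<theta> i \<in> negs R" using \<theta> by (auto simp: bij_betw_def)

lemma \<theta>_inj: "i < N \<Longrightarrow> j < N \<Longrightarrow> \<theta> i = \<theta> j \<longleftrightarrow> i = j" using \<theta> by (auto simp: bij_betw_def inj_on_def)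

lemma keyk_apply:
  assumes "i < N"
  shows "\<theta> (tk i) = s2 R (\<theta> i)" "\<theta> (rk i) = opp (\<theta> i)" "\<theta> (nk i) = nu (\<theta> i)" "tk i < N" "rk i < N" "nk i < N"
  unfolding tk_def rk_def nk_def using pull_apply[OF \<theta> _ assms] endo_negs by auto

lemma keyk_permutes: "tk permutes {..<N}" "rk permutes {..<N}" "nk permutes {..<N}"
  unfolding tk_def rk_def nk_def using pull_permutes[OF \<theta>] bij_negs by auto

lemma tk_cycle: "tk \<in> full_cycles {..<N}"
proof -
  have "orbit tk i = {..<N}" if i: "i < N" for i
  proof -
    have "\<theta> ` orbit tk i = negs R"
      unfolding tk_def using pull_orbit[OF \<theta> bij_negs(1) i] negs_orbit[OF \<theta>_negs[OF i]] by simp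
    also have "\<dots> = \<theta> ` {..<N}" using \<theta> by (simp add: bij_betw_def)
    finally show ?thesis
      using inj_on_image_eq_iff[of \<theta> "{..<N}" "orbit tk i" "{..<N}"] \<theta> permutes_orbit_subset[OF keyk_permutes(1), of i] i
      by (simp add: bij_betw_def)
  qed
  then show ?thesis using keyk_permutes(1) by (simp add: full_cycles_def)
qed

lemma rk_matching: "rk \<in> matchings {..<N}"
proof -
  have "rk i \<noteq> i \<and> rk (rk i) = i" if i: "i < N" for i
  proof
    show "rk i \<noteq> i" using opp_props(1)[OF \<theta>_negs[OF i]] keyk_apply(2)[OF i] by metis
    have "\<theta> (rk (rk i)) = \<theta> i"
      using opp_props(2)[OF \<theta>_negs[OF i]] keyk_apply(2,5) i by simp
    then show "rk (rk i) = i" using keyk_apply(5) i by (simp add: \<theta>_inj)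
  qed
  then show ?thesis using keyk_permutes(2) by (simp add: matchings_def)
qed

text \<open>\<open>opp\<close> is \<open>s2\<close> after \<open>nu\<close> by definition;
  cancelling \<open>t\<close> turns \<open>inv t \<circ> r\<close> into the permutation that
  traverses the positive boundaries.\<close>

lemma nk_eq: "inv tk \<circ> rk = nk"
proof -
  have "rk = tk \<circ> nk"
  proof
    fix i show "rk i = (tk \<circ> nk) i"
    proof (cases "i < N")
      case True
      have "\<theta> (tk (nk i)) = \<theta> (rk i)" using True keyk_apply by (simp add: nu_def opp_def)
      then show ?thesis
        using \<theta>_inj[of "rk i" "tk (nk i)"] keyk_apply(4)[of "nk i"] keyk_apply(5,6)[OF True] by simp
    next
      case False then show ?thesis by (simp add: tk_def rk_def nk_def pull_def)
    qed
  qed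
  then have "inv tk \<circ> rk = (inv tk \<circ> tk) \<circ> nk" by (simp add: comp_assoc)
  also have "inv tk \<circ> tk = id" using keyk_permutes(1) by (rule permutes_inv_o(2))
  finally show ?thesis by (simp only: id_comp)
qed

lemma nu_orbit: "x \<in> negs R \<Longrightarrow> s1 R ` orbit nu x = orbit (s2 R) (s1 R x)"
proof -
  assume x: "x \<in> negs R"
  obtain i where i: "i < N" "x = \<theta> i" using x \<theta> by (auto simp: bij_betw_def)
  have sub: "orbit nu x \<subseteq> negs R" using orbit_subset_invariant[OF endo_negs(2) x] .
  have "i \<in> orbit nk i"
    by (rule permutation_self_in_orbit[OF permutes_finite_permutation[OF _ keyk_permutes(3)]]) simp
  then have "x \<in> orbit nu x" using pull_orbit[OF \<theta> bij_negs(2) i(1)] i(2) unfolding nk_def by auto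
  then show ?thesis
  proof (rule orbit_inverse)
    fix y assume "y \<in> orbit nu x"
    then have "y \<in> negs R" using sub by auto
    then show "s2 R (s1 R y) = s1 R (nu y)"
      by (simp add: nu_def s11 in_H negs_H)
  qed
qed

lemma nk_orbit_iff:
  assumes ij: "i < N" "j < N"
  shows "orbit nk i = orbit nk j \<longleftrightarrow> orbit (s2 R) (s1 R (\<theta> i)) = orbit (s2 R) (s1 R (\<theta> j))"
proof -
  have sub: "orbit nk i \<subseteq> {..<N}" "orbit nk j \<subseteq> {..<N}"
    using permutes_orbit_subset[OF keyk_permutes(3)] ij by auto
  have "orbit nk i = orbit nk j \<longleftrightarrow> \<theta> ` orbit nk i = \<theta> ` orbit nk j"
    using inj_on_image_eq_iff[OF _ sub, of \<theta>] \<theta> by (simp add: bij_betw_def)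
  also have "\<dots> \<longleftrightarrow> orbit nu (\<theta> i) = orbit nu (\<theta> j)"
    unfolding nk_def using pull_orbit[OF \<theta> bij_negs(2)] ij by simp
  also have "\<dots> \<longleftrightarrow> s1 R ` orbit nu (\<theta> i) = s1 R ` orbit nu (\<theta> j)"
    using inj_s1 by (simp add: inj_image_eq_iff)
  finally show ?thesis using \<theta>_negs ij by (simp add: nu_orbit)
qed

definition "lk = (\<lambda>i\<in>{..<N}. label R (orbit (s2 R) (s1 R (\<theta> i))))"

lemma lk_labelling: "lk \<in> labellings N n nk"
proof -
  have img: "(\<lambda>i. orbit (s2 R) (s1 R (\<theta> i))) ` {..<N} = pos_boundaries R"
  proof -
    have "(\<lambda>i. orbit (s2 R) (s1 R (\<theta> i))) ` {..<N} = orbit (s2 R) ` s1 R ` \<theta> ` {..<N}" by (simp add: image_image)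
    also have "\<dots> = pos_boundaries R"
      using \<theta> bij_s1 by (simp add: bij_betw_def pos_boundaries)
    finally show ?thesis .
  qed
  have "lk ` {..<N} = label R ` (\<lambda>i. orbit (s2 R) (s1 R (\<theta> i))) ` {..<N}"
    by (simp add: lk_def image_image)
  then have 1: "lk ` {..<N} = {1..n}" using lp by (simp add: img bij_betw_def)
  moreover have "lk i = lk j \<longleftrightarrow> orbit nk i = orbit nk j" if "i < N" "j < N" for i j
  proof -
    have "orbit (s2 R) (s1 R (\<theta> i)) \<in> pos_boundaries R" "orbit (s2 R) (s1 R (\<theta> j)) \<in> pos_boundaries R"
      using img that by auto
    from inj_on_eq_iff[OF bij_betw_imp_inj_on[OF lp] this]
    show ?thesis using that by (simp add: lk_def nk_orbit_iff)
  qed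
  moreover have "lk \<in> {..<N} \<rightarrow>\<^sub>E {1..n}"
    using 1 by (auto simp: lk_def PiE_iff simp del: atLeastAtMost_iff)
  ultimately show ?thesis by (simp add: labellings_def)
qed

lemma key_eq: "key R N \<theta> = (tk, rk, lk)"
  by (simp add: key_def tk_def rk_def lk_def opp_def)

lemma key_in: "key R N \<theta> \<in> all_keys N n"
  by (simp add: key_eq all_keys_def tk_cycle rk_matching nk_eq lk_labelling)

end

end

text \<open>The only candidate for an isomorphism that matches the numbering \<open>\<theta>\<close>
  with \<open>\<eta>\<close>: commutation with \<open>s1\<close> dictates the values on the positive
  halves.\<close>

definition glue :: "'a dribbon \<Rightarrow> 'b dribbon \<Rightarrow> nat \<Rightarrow> (nat \<Rightarrow> 'a) \<Rightarrow> (nat \<Rightarrow> 'b) \<Rightarrow> 'a \<Rightarrow> 'b" where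
  "glue R S N \<theta> \<eta> x = (if x \<in> negs R then \<eta> (inv_into {..<N} \<theta> x)
     else s1 S (\<eta> (inv_into {..<N} \<theta> (s1 R x))))"

lemma is_iso_cong: "(\<And>x. x \<in> half_edges R \<Longrightarrow> \<phi> x = \<psi> x) \<Longrightarrow> ribbon_graph R \<Longrightarrow> is_iso \<phi> R S \<longleftrightarrow> is_iso \<psi> R S"
proof -
  assume eq: "\<And>x. x \<in> half_edges R \<Longrightarrow> \<phi> x = \<psi> x" and R: "ribbon_graph R"
  have "bij_betw \<phi> (half_edges R) (half_edges S) \<longleftrightarrow> bij_betw \<psi> (half_edges R) (half_edges S)"
    using eq by (rule bij_betw_cong)
  moreover have "s0 R x \<in> half_edges R" "s1 R x \<in> half_edges R" "s2 R x \<in> half_edges R" if "x \<in> half_edges R" for x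
    using that R by (auto simp: ribbon_graph_def permutes_in_image)
  moreover have "\<phi> ` \<beta> = \<psi> ` \<beta>" if "\<beta> \<in> boundaries R" for \<beta>
  proof -
    have "\<beta> \<subseteq> half_edges R"
      using that R permutes_orbit_subset[of "s2 R" "half_edges R"] by (auto simp: boundaries_def ribbon_graph_def)
    then show ?thesis using eq by (intro image_cong) auto
  qed
  ultimately show ?thesis using eq by (simp add: is_iso_def cong: ball_cong)
qed

section \<open>Isomorphism of graphs in terms of their keys\<close>

locale two_one_negative = R: one_negative R n + S: one_negative S n
  for R :: "'a dribbon" and S :: "'b dribbon" and n :: nat
begin

lemma iso_orbit:
  assumes "is_iso \<phi> R S" "x \<in> half_edges R"
  shows "\<phi> ` orbit (s2 R) x = orbit (s2 S) (\<phi> x)"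
proof (rule orbit_inverse)
  show "x \<in> orbit (s2 R) x" by (rule permutation_self_in_orbit[OF R.perm2])
  fix y assume "y \<in> orbit (s2 R) x"
  then have "y \<in> half_edges R" using permutes_orbit_subset[OF R.p2 assms(2)] by auto
  then show "s2 S (\<phi> y) = \<phi> (s2 R y)" using assms(1) by (simp add: is_iso_def)
qed

lemma iso_key:
  assumes \<phi>: "is_iso \<phi> R S" and \<theta>: "bij_betw \<theta> {..<R.N} (negs R)"
  shows "S.N = R.N" "bij_betw (\<phi> \<circ> \<theta>) {..<R.N} (negs S)" "key S S.N (\<phi> \<circ> \<theta>) = key R R.N \<theta>"
proof -
  have bij: "bij_betw \<phi> (half_edges R) (half_edges S)" using \<phi> by (simp add: is_iso_def)
  have c: "\<phi> (s1 R x) = s1 S (\<phi> x)" "\<phi> (s2 R x) = s2 S (\<phi> x)" "dir S (\<phi> x) = dir R x" if "x \<in> half_edges R" for x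
    using \<phi> that by (auto simp: is_iso_def)
  have "\<phi> ` negs R = negs S"
  proof -
    have "half_edges S = \<phi> ` half_edges R" using bij by (simp add: bij_betw_def)
    then show ?thesis using c(3) by (auto simp: negs_def)
  qed
  moreover have "inj_on \<phi> (negs R)" using bij by (rule inj_on_subset[OF bij_betw_imp_inj_on]) (auto simp: negs_def)
  ultimately have bn: "bij_betw \<phi> (negs R) (negs S)" by (simp add: bij_betw_def)
  then show N: "S.N = R.N" using bij_betw_same_card by (fastforce simp: R.N_def S.N_def)
  show b: "bij_betw (\<phi> \<circ> \<theta>) {..<R.N} (negs S)" using \<theta> bn by (rule bij_betw_trans)
  have tn: "\<theta> i \<in> negs R" "\<theta> i \<in> half_edges R" if "i < R.N" for i
    using R.\<theta>_negs[OF \<theta> that] by (auto simp: negs_def)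
  note ap = R.keyk_apply[OF \<theta>]
  have "pull (\<phi> \<circ> \<theta>) R.N (s2 S) = R.tk \<theta>"
    using ap c tn by (intro pull_eqI[OF b]) (auto simp: R.tk_def[OF \<theta>] pull_def)
  moreover have "pull (\<phi> \<circ> \<theta>) R.N (\<lambda>x. s2 S (s1 S (s2 S (s1 S x)))) = R.rk \<theta>"
  proof (rule pull_eqI[OF b])
    fix i assume i: "i < R.N"
    show "R.rk \<theta> i < R.N \<and> (\<phi> \<circ> \<theta>) (R.rk \<theta> i) = s2 S (s1 S (s2 S (s1 S ((\<phi> \<circ> \<theta>) i))))"
      using ap[OF i] tn[OF i] by (simp add: R.opp_def c R.in_H)
  qed (simp add: R.rk_def[OF \<theta>] pull_def)
  moreover have "label S (orbit (s2 S) (s1 S (\<phi> (\<theta> i)))) = label R (orbit (s2 R) (s1 R (\<theta> i)))" if i: "i < R.N" for i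
  proof -
    have "s1 R (\<theta> i) \<in> half_edges R" using tn[OF i] by (simp add: R.in_H)
    then have "orbit (s2 S) (s1 S (\<phi> (\<theta> i))) = \<phi> ` orbit (s2 R) (s1 R (\<theta> i))"
      using iso_orbit[OF \<phi>, of "s1 R (\<theta> i)"] c(1) tn[OF i] by simp
    moreover have "orbit (s2 R) (s1 R (\<theta> i)) \<in> boundaries R"
      using \<open>s1 R (\<theta> i) \<in> half_edges R\<close> by (simp add: boundaries_def)
    ultimately show ?thesis using \<phi> by (simp add: is_iso_def)
  qed
  ultimately show "key S S.N (\<phi> \<circ> \<theta>) = key R R.N \<theta>"
    unfolding R.key_eq[OF \<theta>] by (simp add: key_def N R.lk_def[OF \<theta>] cong: restrict_cong)
qed

text \<open>A key determines the whole structure: \<open>t\<close> is \<open>s2\<close> on negative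
  halves, \<open>inv t \<circ> r\<close> is \<open>s2\<close> on positive ones, \<open>s0\<close> is
  then forced by \<open>s2 s1 s0 = id\<close>, and the third component carries the positive labels.
  The single negative boundary has label 1 in both graphs.\<close>

lemma glue_iso:
  assumes \<theta>: "bij_betw \<theta> {..<R.N} (negs R)" and \<eta>: "bij_betw \<eta> {..<R.N} (negs S)" and N: "S.N = R.N"
    and key: "key R R.N \<theta> = key S R.N \<eta>"
  shows "is_iso (glue R S R.N \<theta> \<eta>) R S" "\<And>i. i < R.N \<Longrightarrow> glue R S R.N \<theta> \<eta> (\<theta> i) = \<eta> i"
proof -
  let ?g = "glue R S R.N \<theta> \<eta>"
  have \<eta>': "bij_betw \<eta> {..<S.N} (negs S)" using \<eta> N by simp
  have tn: "\<theta> i \<in> negs R" "\<eta> i \<in> negs S" if "i < R.N" for i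
    using R.\<theta>_negs[OF \<theta> that] S.\<theta>_negs[OF \<eta>'] that N by auto
  have tH: "\<theta> i \<in> half_edges R" "\<eta> i \<in> half_edges S" if "i < R.N" for i
    using tn[OF that] R.negs_H S.negs_H by auto
  have inv: "inv_into {..<R.N} \<theta> (\<theta> i) = i" if "i < R.N" for i
    using \<theta> that by (simp add: bij_betw_def)
  show g1: "?g (\<theta> i) = \<eta> i" if "i < R.N" for i
    using tn[OF that] inv[OF that] by (simp add: glue_def)
  have g2: "?g (s1 R (\<theta> i)) = s1 S (\<eta> i)" if "i < R.N" for i
    using R.s1_negs[OF tn(1)[OF that]] R.H_split(2) tH[OF that] inv[OF that] by (auto simp: glue_def R.s11)
  have tk: "R.tk \<theta> = S.tk \<eta>" and rk: "R.rk \<theta> = S.rk \<eta>" and lk: "R.lk \<theta> = S.lk \<eta>"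
    using key R.key_eq[OF \<theta>] S.key_eq[OF \<eta>'] by (simp_all add: N)
  have nk: "R.nk \<theta> = S.nk \<eta>" using R.nk_eq[OF \<theta>] S.nk_eq[OF \<eta>'] tk rk by metis
  note apR = R.keyk_apply[OF \<theta>] and apS = S.keyk_apply[OF \<eta>', unfolded N]
  have Hcases: "\<exists>i<R.N. x = \<theta> i \<or> x = s1 R (\<theta> i)" if "x \<in> half_edges R" for x
  proof -
    have ex: "\<exists>i<R.N. y = \<theta> i" if "y \<in> negs R" for y using that \<theta> by (auto simp: bij_betw_def)
    show ?thesis
    proof (cases "x \<in> negs R")
      case False
      then have "s1 R x \<in> negs R" using that R.H_split R.s1_poss by blast
      then show ?thesis using ex R.s11(1)[OF that] by metis
    qed (use ex in blast)
  qed
  have c1: "?g (s1 R x) = s1 S (?g x)" if "x \<in> half_edges R" for x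
    using Hcases[OF that] g1 g2 tH by (auto simp: R.s11 S.s11)
  have c2: "?g (s2 R x) = s2 S (?g x)" if xH: "x \<in> half_edges R" for x
  proof -
    obtain i where i: "i < R.N" "x = \<theta> i \<or> x = s1 R (\<theta> i)" using Hcases[OF xH] by blast
    from i(2) show ?thesis
    proof
      assume x: "x = \<theta> i"
      have "?g (s2 R x) = ?g (\<theta> (R.tk \<theta> i))" using i(1) by (simp add: x apR)
      also have "\<dots> = \<eta> (S.tk \<eta> i)" using i(1) apR(4) by (simp add: g1 flip: tk)
      finally show ?thesis using i(1) by (simp add: x g1 apS)
    next
      assume x: "x = s1 R (\<theta> i)"
      have "s2 R x = s1 R (\<theta> (R.nk \<theta> i))"
        using i(1) tH by (simp add: x apR R.nu_def R.s11 R.in_H)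
      then have "?g (s2 R x) = s1 S (\<eta> (S.nk \<eta> i))" using i(1) apR(6) by (simp add: g2 flip: nk)
      also have "\<dots> = s2 S (s1 S (\<eta> i))" using i(1) tH by (simp add: apS S.nu_def S.s11 S.in_H)
      finally show ?thesis using i(1) by (simp add: x g2)
    qed
  qed
  have gH: "?g x \<in> half_edges S" if "x \<in> half_edges R" for x
    using Hcases[OF that] g1 g2 tH S.in_H by auto
  have c0: "?g (s0 R x) = s0 S (?g x)" if x: "x \<in> half_edges R" for x
  proof -
    have "?g x = ?g (s2 R (s1 R (s0 R x)))" by (simp add: R.s210)
    also have "\<dots> = s2 S (s1 S (?g (s0 R x)))" using x by (simp add: c1 c2 R.in_H)
    finally show ?thesis by (simp add: S.s021)
  qed
  have d: "dir S (?g x) = dir R x" if xH: "x \<in> half_edges R" for x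
  proof -
    obtain i where i: "i < R.N" "x = \<theta> i \<or> x = s1 R (\<theta> i)" using Hcases[OF xH] by blast
    then show ?thesis using tn[OF i(1)] tH[OF i(1)] by (auto simp: g1 g2 R.dir_simps S.dir_simps negs_def)
  qed
  have bij: "bij_betw ?g (half_edges R) (half_edges S)"
    unfolding bij_betw_def
  proof
    show inj: "inj_on ?g (half_edges R)"
    proof (rule inj_onI)
      fix x y assume xy: "x \<in> half_edges R" "y \<in> half_edges R" and eq: "?g x = ?g y"
      obtain i where i: "i < R.N" "x = \<theta> i \<or> x = s1 R (\<theta> i)" using Hcases[OF xy(1)] by blast
      obtain j where j: "j < R.N" "y = \<theta> j \<or> y = s1 R (\<theta> j)" using Hcases[OF xy(2)] by blast
      have "dir R x = dir R y" using d xy eq by metis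
      then have "x = \<theta> i \<and> y = \<theta> j \<or> x = s1 R (\<theta> i) \<and> y = s1 R (\<theta> j)"
        using i j tn[OF i(1)] tn[OF j(1)] by (auto simp: negs_def R.dir_simps)
      moreover from this have "\<eta> i = \<eta> j"
        using eq i(1) j(1) by (auto simp: g1 g2 dest: injD[OF S.inj_s1])
      then have "i = j" using S.\<theta>_inj[OF \<eta>'] i j N by simp
      ultimately show "x = y" by auto
    qed
    have "card (half_edges R) = card (half_edges S)" using R.counts(1) S.counts(1) N by simp
    moreover have "?g ` half_edges R \<subseteq> half_edges S" using gH by auto
    ultimately show "?g ` half_edges R = half_edges S"
      using inj S.finH by (metis card_image card_subset_eq)
  qed
  have orb: "?g ` orbit (s2 R) x = orbit (s2 S) (?g x)" if x: "x \<in> half_edges R" for x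
  proof (rule orbit_inverse)
    show "x \<in> orbit (s2 R) x" by (rule permutation_self_in_orbit[OF R.perm2])
    fix y assume "y \<in> orbit (s2 R) x"
    then have "y \<in> half_edges R" using permutes_orbit_subset[OF R.p2 x] by auto
    then show "s2 S (?g y) = ?g (s2 R y)" by (simp add: c2)
  qed
  have lab: "label S (?g ` \<beta>) = label R \<beta>" if \<beta>: "\<beta> \<in> boundaries R" for \<beta>
  proof -
    obtain x where x: "x \<in> half_edges R" "\<beta> = orbit (s2 R) x" using \<beta> by (auto simp: boundaries_def)
    obtain i where i: "i < R.N" "x = \<theta> i \<or> x = s1 R (\<theta> i)" using Hcases[OF x(1)] by blast
    from i(2) show ?thesis
    proof
      assume xi: "x = \<theta> i"
      have "?g ` \<beta> \<in> neg_boundaries S"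
        using tn[OF i(1)] S.negs_orbit unfolding x(2) orb[OF x(1)] by (simp add: S.neg_boundaries xi g1 i(1))
      moreover have "\<beta> \<in> neg_boundaries R"
        using tn[OF i(1)] R.negs_orbit by (simp add: R.neg_boundaries xi x(2))
      ultimately have "label S (?g ` \<beta>) \<in> {1..1}" "label R \<beta> \<in> {1..1}"
        using bij_betw_apply[OF S.ln] bij_betw_apply[OF R.ln] by blast+
      then show ?thesis by simp
    next
      assume xi: "x = s1 R (\<theta> i)"
      have "R.lk \<theta> i = S.lk \<eta> i" using lk by simp
      then show ?thesis using i(1) orb[OF x(1)]
        by (simp add: R.lk_def[OF \<theta>] S.lk_def[OF \<eta>'] N x(2) xi g2)
    qed
  qed
  show "is_iso ?g R S"
    using bij c0 c1 c2 d lab by (simp add: is_iso_def)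
qed

lemma iso_iff_keys: "(\<exists>\<phi>. is_iso \<phi> R S) \<longleftrightarrow> keys_of R \<inter> keys_of S \<noteq> {}"
proof
  obtain \<theta> where \<theta>: "bij_betw \<theta> {..<R.N} (negs R)"
    using ex_bij_betw_nat_finite[OF R.fin_negs] by (auto simp: R.N_def lessThan_atLeast0)
  assume "\<exists>\<phi>. is_iso \<phi> R S"
  then obtain \<phi> where \<phi>: "is_iso \<phi> R S" by blast
  have "key R R.N \<theta> \<in> keys_of R" using \<theta> by (auto simp: keys_of_def R.N_def)
  moreover have "key R R.N \<theta> \<in> keys_of S"
    unfolding keys_of_def S.N_def[symmetric] iso_key(1)[OF \<phi> \<theta>]
    using iso_key[OF \<phi> \<theta>] by (auto intro!: exI[of _ "\<phi> \<circ> \<theta>"])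
  ultimately show "keys_of R \<inter> keys_of S \<noteq> {}" by blast
next
  assume "keys_of R \<inter> keys_of S \<noteq> {}"
  then obtain \<kappa> where \<kappa>: "\<kappa> \<in> keys_of R" "\<kappa> \<in> keys_of S" by blast
  from \<kappa>(1) obtain \<theta> where \<theta>: "bij_betw \<theta> {..<R.N} (negs R)" and 1: "\<kappa> = key R R.N \<theta>"
    by (auto simp: keys_of_def R.N_def)
  from \<kappa>(2) obtain \<eta> where \<eta>: "bij_betw \<eta> {..<S.N} (negs S)" and 2: "\<kappa> = key S S.N \<eta>"
    by (auto simp: keys_of_def S.N_def)
  have key: "key R R.N \<theta> = key S S.N \<eta>" using 1 2 by simp
  have t: "R.tk \<theta> = S.tk \<eta>" using key R.key_eq[OF \<theta>] S.key_eq[OF \<eta>] by simp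
  \<comment> \<open>The number of edges can be read off the key: it is the size of the orbit of 0
    under the first component.\<close>
  have "S.N = R.N"
  proof -
    have "0 < R.N" "0 < S.N"
      using R.negs_nonempty R.fin_negs S.negs_nonempty S.fin_negs by (auto simp: R.N_def S.N_def card_gt_0_iff)
    then have "orbit (R.tk \<theta>) 0 = {..<R.N}" "orbit (S.tk \<eta>) 0 = {..<S.N}"
      using R.tk_cycle[OF \<theta>] S.tk_cycle[OF \<eta>] by (auto simp: full_cycles_def)
    then show ?thesis using t by (metis card_lessThan)
  qed
  then show "\<exists>\<phi>. is_iso \<phi> R S" using glue_iso(1)[OF \<theta>] \<eta> key by metis
qed

lemma iso_keys_subset:
  assumes "is_iso \<phi> R S"
  shows "keys_of R \<subseteq> keys_of S"
proof
  fix \<kappa> assume "\<kappa> \<in> keys_of R"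
  then obtain \<theta> where \<theta>: "bij_betw \<theta> {..<R.N} (negs R)" "\<kappa> = key R R.N \<theta>" by (auto simp: keys_of_def R.N_def)
  show "\<kappa> \<in> keys_of S"
    unfolding keys_of_def S.N_def[symmetric] iso_key(1)[OF assms \<theta>(1)]
    using iso_key[OF assms \<theta>(1)] \<theta>(2) by (auto intro!: exI[of _ "\<phi> \<circ> \<theta>"])
qed

end

context one_negative
begin

text \<open>Orbits and stabilisers: the numberings \<open>\<theta>\<close> with a given key form one free orbit of \<open>Aut R\<close>.\<close>

lemma card_keys_Aut: "card (keys_of R) * card (Aut R) = fact N"
proof -
  interpret RR: two_one_negative R R n ..
  obtain \<theta> where \<theta>: "bij_betw \<theta> {..<N} (negs R)"
    using ex_bij_betw_nat_finite[OF fin_negs] by (auto simp: N_def lessThan_atLeast0)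
  define P where "P = {p. p permutes {..<N}}"
  have finP: "finite P" by (simp add: P_def finite_permutations)
  have b: "bij_betw (\<theta> \<circ> p) {..<N} (negs R)" if "p \<in> P" for p
    using that \<theta> by (intro bij_betw_trans[OF permutes_imp_bij]) (auto simp: P_def)
  let ?K = "\<lambda>p. key R N (\<theta> \<circ> p)"
  have keys: "keys_of R = ?K ` P"
  proof (intro set_eqI iffI)
    fix \<kappa> assume "\<kappa> \<in> keys_of R"
    then obtain \<eta> where \<eta>: "bij_betw \<eta> {..<N} (negs R)" "\<kappa> = key R N \<eta>" by (auto simp: keys_of_def N_def)
    define p where "p = (\<lambda>i. if i < N then inv_into {..<N} \<theta> (\<eta> i) else i)"
    have pp: "p permutes {..<N}"
    proof (rule bij_imp_permutes)
      have "bij_betw (inv_into {..<N} \<theta> \<circ> \<eta>) {..<N} {..<N}"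
        using \<eta>(1) \<theta> by (intro bij_betw_trans bij_betw_inv_into)
      then show "bij_betw p {..<N} {..<N}" by (rule bij_betw_cong[THEN iffD1, rotated]) (simp add: p_def)
    qed (simp add: p_def)
    have eq: "(\<theta> \<circ> p) i = \<eta> i" if "i < N" for i
    proof -
      have "\<eta> i \<in> \<theta> ` {..<N}" using \<theta>_negs[OF \<eta>(1) that] \<theta> by (simp add: bij_betw_def)
      then show ?thesis using that by (simp add: p_def f_inv_into_f)
    qed
    have "inv_into {..<N} (\<theta> \<circ> p) x = inv_into {..<N} \<eta> x" for x
      unfolding inv_into_def using eq by (metis lessThan_iff)
    then have "?K p = key R N \<eta>"
      by (auto simp: key_def pull_def fun_eq_iff eq[unfolded comp_apply])
    then show "\<kappa> \<in> ?K ` P" using pp \<eta>(2) by (intro image_eqI[of _ _ p]) (simp_all add: P_def)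
  next
    fix \<kappa> assume "\<kappa> \<in> ?K ` P"
    then show "\<kappa> \<in> keys_of R" using b by (auto simp: keys_of_def N_def)
  qed
  \<comment> \<open>If \<open>\<theta> \<circ> p\<close> and \<open>\<theta> \<circ> q\<close> have
    the same key, \<open>F q\<close> is the automorphism carrying the first numbering to the second,
    extended by the identity as \<open>permutes\<close> demands. Every automorphism comes from
    exactly one \<open>q\<close>, so all fibres of the key map have the size of
    \<open>Aut R\<close>.\<close>
  have fib: "card {q \<in> P. ?K q = ?K p} = card (Aut R)" if p: "p \<in> P" for p
  proof -
    define F where "F = (\<lambda>q x. if x \<in> H then glue R R N (\<theta> \<circ> p) (\<theta> \<circ> q) x else x)"
    have "bij_betw F {q \<in> P. ?K q = ?K p} (Aut R)"
      unfolding bij_betw_def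
    proof (intro conjI inj_onI set_eqI iffI)
      fix q q' assume q: "q \<in> {q \<in> P. ?K q = ?K p}" "q' \<in> {q \<in> P. ?K q = ?K p}" and eq: "F q = F q'"
      show "q = q'"
      proof
        fix i show "q i = q' i"
        proof (cases "i < N")
          case True
          have Fr: "F r ((\<theta> \<circ> p) i) = (\<theta> \<circ> r) i" if "r \<in> {q \<in> P. ?K q = ?K p}" for r
            using RR.glue_iso(2)[OF b[OF p] b _ _ True, of r] that \<theta>_negs[OF b[OF p] True] negs_H by (simp add: F_def)
          have "(\<theta> \<circ> q) i = (\<theta> \<circ> q') i"
            unfolding Fr[OF q(1), symmetric] Fr[OF q(2), symmetric] eq ..
          then have "\<theta> (q i) = \<theta> (q' i)" by simp
          moreover have "q i < N" "q' i < N" using q True permutes_in_image[of _ "{..<N}" i] by (auto simp: P_def)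
          ultimately show ?thesis using \<theta>_inj[OF \<theta>] by simp
        next
          case False
          then show ?thesis
            using q permutes_not_in[of q "{..<N}" i] permutes_not_in[of q' "{..<N}" i] by (simp add: P_def)
        qed
      qed
    next
      fix \<phi> assume "\<phi> \<in> F ` {q \<in> P. ?K q = ?K p}"
      then obtain q where q: "q \<in> P" "?K p = ?K q" "\<phi> = F q" by auto
      have iso: "is_iso (glue R R N (\<theta> \<circ> p) (\<theta> \<circ> q)) R R"
        using RR.glue_iso(1)[OF b[OF p] b[OF q(1)] refl q(2)] .
      have "is_iso \<phi> R R" using iso rg by (subst is_iso_cong[where \<psi> = "glue R R N (\<theta> \<circ> p) (\<theta> \<circ> q)"]) (auto simp: q(3) F_def)
      moreover from this have "\<phi> permutes H"
        by (intro bij_imp_permutes) (auto simp: is_iso_def q(3) F_def)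
      ultimately show "\<phi> \<in> Aut R" by (simp add: Aut_def)
    next
      fix \<phi> assume "\<phi> \<in> Aut R"
      then have iso: "is_iso \<phi> R R" and pH: "\<phi> permutes H" by (auto simp: Aut_def)
      note ik = RR.iso_key[OF iso b[OF p]]
      define q where "q = (\<lambda>i. if i < N then inv_into {..<N} \<theta> (\<phi> (\<theta> (p i))) else i)"
      have qP: "q \<in> P"
        unfolding P_def mem_Collect_eq
      proof (rule bij_imp_permutes)
        have "bij_betw (inv_into {..<N} \<theta> \<circ> (\<phi> \<circ> (\<theta> \<circ> p))) {..<N} {..<N}"
          using ik(2) \<theta> by (rule bij_betw_trans[OF _ bij_betw_inv_into])
        then show "bij_betw q {..<N} {..<N}" by (rule bij_betw_cong[THEN iffD1, rotated]) (simp add: q_def)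
      qed (simp add: q_def)
      have eq: "(\<theta> \<circ> q) i = (\<phi> \<circ> (\<theta> \<circ> p)) i" if "i < N" for i
      proof -
        have "\<phi> (\<theta> (p i)) \<in> \<theta> ` {..<N}" using \<theta>_negs[OF ik(2) that] \<theta> by (simp add: bij_betw_def)
        then show ?thesis using that by (simp add: q_def f_inv_into_f)
      qed
      have "inv_into {..<N} (\<theta> \<circ> q) x = inv_into {..<N} (\<phi> \<circ> (\<theta> \<circ> p)) x" for x
        unfolding inv_into_def using eq by (metis lessThan_iff)
      then have "?K q = key R N (\<phi> \<circ> (\<theta> \<circ> p))"
        by (auto simp: key_def pull_def fun_eq_iff eq[unfolded comp_apply])
      then have Kq: "?K q = ?K p" using ik(3) by simp
      have "F q = \<phi>"
      proof
        fix x show "F q x = \<phi> x"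
        proof (cases "x \<in> H")
          case True
          have g: "glue R R N (\<theta> \<circ> p) (\<theta> \<circ> q) y = \<phi> y" if "y \<in> negs R" for y
          proof -
            obtain i where "i < N" "y = (\<theta> \<circ> p) i" using \<open>y \<in> negs R\<close> b[OF p] by (auto simp: bij_betw_def)
            then show ?thesis using RR.glue_iso(2)[OF b[OF p] b[OF qP] refl Kq[symmetric]] eq by simp
          qed
          show ?thesis
          proof (cases "x \<in> negs R")
            case False
            then have sx: "s1 R x \<in> negs R" using True H_split s1_poss by blast
            have "glue R R N (\<theta> \<circ> p) (\<theta> \<circ> q) (s1 R (s1 R x)) = s1 R (glue R R N (\<theta> \<circ> p) (\<theta> \<circ> q) (s1 R x))"
              using RR.glue_iso(1)[OF b[OF p] b[OF qP] refl Kq[symmetric]] True in_H by (simp add: is_iso_def)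
            also have "\<dots> = s1 R (\<phi> (s1 R x))" by (simp add: g sx)
            also have "\<dots> = \<phi> (s1 R (s1 R x))" using iso True in_H by (simp add: is_iso_def)
            finally show ?thesis using True by (simp add: F_def s11)
          qed (use g True in \<open>simp add: F_def\<close>)
        next
          case False
          then show ?thesis using pH by (simp add: F_def permutes_not_in)
        qed
      qed
      then show "\<phi> \<in> F ` {q \<in> P. ?K q = ?K p}" using qP Kq by blast
    qed
    then show ?thesis by (rule bij_betw_same_card)
  qed
  have "card P = (\<Sum>\<kappa>\<in>?K ` P. card {q \<in> P. ?K q = \<kappa>})"
    using finP card_UN_disjoint[of "?K ` P" "\<lambda>\<kappa>. {q \<in> P. ?K q = \<kappa>}"]
    by (subst card_UN_disjoint[symmetric]) (auto intro!: arg_cong[where f = card])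
  also have "\<dots> = (\<Sum>\<kappa>\<in>?K ` P. card (Aut R))"
    by (rule sum.cong[OF refl]) (elim imageE, simp only: fib)
  also have "\<dots> = card (?K ` P) * card (Aut R)" by simp
  finally show ?thesis by (simp add: keys P_def card_permutations)
qed

end

section \<open>Volumes and isomorphism classes\<close>

definition weight :: "nat \<Rightarrow> nat \<Rightarrow> (nat \<Rightarrow> real) \<Rightarrow> (nat \<Rightarrow> nat) \<Rightarrow> real" where
  "weight N n L l = (\<Prod>c\<in>{1..n}. L c ^ (card {i \<in> {..<N}. l i = c} - 1) / fact (card {i \<in> {..<N}. l i = c} - 1))"

section \<open>The volume of the space of metrics on one graph\<close>

context one_negative
begin

text \<open>The label of the positive boundary that contains the edge. The choice is unambiguous,
  because an edge has exactly one positive half.\<close>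

definition "blk e = label R (orbit (s2 R) (SOME x. x \<in> poss R \<and> x \<in> e))"

lemma blk_edge: "x \<in> poss R \<Longrightarrow> blk (orbit (s1 R) x) = label R (orbit (s2 R) x)"
proof -
  assume x: "x \<in> poss R"
  have "(SOME y. y \<in> poss R \<and> y \<in> orbit (s1 R) x) = x"
  proof (rule some_equality)
    show "x \<in> poss R \<and> x \<in> orbit (s1 R) x" using x by (simp add: edge_eq poss_H)
    fix y assume y: "y \<in> poss R \<and> y \<in> orbit (s1 R) x"
    have "y \<noteq> s1 R x" using y s1_poss[OF x] H_split(2) by auto
    then show "y = x" using y x by (simp add: edge_eq poss_H)
  qed
  then show ?thesis by (simp add: blk_def)
qed

lemma edges_poss: "bij_betw (orbit (s1 R)) (poss R) (edges R)"
proof -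
  have "bij_betw (orbit (s1 R) \<circ> s1 R) (negs R) (edges R)"
    using edges_negs by (rule bij_betw_cong[THEN iffD1, rotated]) (simp add: edge_s1 negs_H)
  then have "bij_betw (orbit (s1 R) \<circ> s1 R \<circ> s1 R) (poss R) (edges R)"
    using bij_betw_trans[of "s1 R" "poss R" "negs R"] bij_betwI[of "s1 R" "poss R" "negs R" "s1 R"]
    by (auto simp: s1_negs s1_poss s11 negs_H poss_H)
  then show ?thesis by (rule bij_betw_cong[THEN iffD1, rotated]) (simp add: s11 poss_H)
qed

lemma finE: "finite (edges R)" using finH by (simp add: edges_def)

text \<open>All negative halves lie on one boundary, and each edge has exactly one of them, so the
  negative length is the total length. Its condition follows from the positive ones as soon as the
  prescribed lengths balance.\<close>

lemma blength_neg: "blength R m (negs R) = (\<Sum>e\<in>edges R. m e)"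
proof -
  have "{x. x \<in> H \<and> orbit (s2 R) x = negs R} = negs R"
    using negs_orbit negs_H permutation_self_in_orbit[OF perm2] by blast
  then have "blength R m (negs R) = (\<Sum>x\<in>negs R. m (orbit (s1 R) x))" by (simp add: blength_def)
  also have "\<dots> = (\<Sum>e\<in>edges R. m e)" by (rule sum.reindex_bij_betw[OF edges_negs])
  finally show ?thesis .
qed

text \<open>Each edge has exactly one positive half, so the positive boundaries partition the edges
  and their length conditions involve disjoint sets of coordinates. Hence the product of
  simplices.\<close>

lemma blength_pos:
  assumes \<beta>: "\<beta> \<in> pos_boundaries R"
  shows "blength R m \<beta> = (\<Sum>e | e \<in> edges R \<and> blk e = label R \<beta>. m e)"
proof -
  obtain y where y: "y \<in> poss R" "\<beta> = orbit (s2 R) y" using \<beta> by (auto simp: pos_boundaries)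
  have orb: "x \<in> poss R" if "orbit (s2 R) x = \<beta>" for x
    using that permutation_self_in_orbit[OF perm2, of x] orbit2_sub(2)[OF y(1)] y(2) by auto
  have "orbit (s2 R) x = \<beta> \<longleftrightarrow> label R (orbit (s2 R) x) = label R \<beta>" if "x \<in> poss R" for x
    using inj_on_eq_iff[OF bij_betw_imp_inj_on[OF lp], of "orbit (s2 R) x" \<beta>] \<beta> that by (simp add: pos_boundaries)
  then have eq: "{x. x \<in> H \<and> orbit (s2 R) x = \<beta>} = {x \<in> poss R. blk (orbit (s1 R) x) = label R \<beta>}"
    by (intro Collect_cong) (metis blk_edge orb poss_H)
  have "bij_betw (orbit (s1 R)) {x \<in> poss R. blk (orbit (s1 R) x) = label R \<beta>} {e. e \<in> edges R \<and> blk e = label R \<beta>}"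
    using bij_betw_Collect[OF edges_poss, of "\<lambda>e. blk e = label R \<beta>" "\<lambda>x. blk (orbit (s1 R) x) = label R \<beta>"] by simp
  from sum.reindex_bij_betw[OF this, of m] show ?thesis by (simp add: blength_def eq)
qed

lemma label_pos: "label R ` pos_boundaries R = {1..n}"
  using lp by (simp add: bij_betw_def)

lemma blk_img: "blk ` edges R = {1..n}"
proof -
  have "blk ` edges R = blk ` orbit (s1 R) ` poss R" using edges_poss by (simp add: bij_betw_def)
  also have "\<dots> = (\<lambda>x. label R (orbit (s2 R) x)) ` poss R" by (simp add: image_image blk_edge cong: image_cong)
  also have "\<dots> = label R ` pos_boundaries R" by (simp add: pos_boundaries image_image)
  finally show ?thesis by (simp only: label_pos)
qed

lemma sum_blocks: "(\<Sum>e\<in>edges R. m e) = (\<Sum>c\<in>{1..n}. \<Sum>e | e \<in> edges R \<and> blk e = c. m e)" for m :: "'a set \<Rightarrow> real"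
  using blk_img finE by (intro sum.group[symmetric]) auto

lemma pos_lengths_iff:
  "(\<forall>\<beta>\<in>pos_boundaries R. blength R m \<beta> = f (label R \<beta>)) \<longleftrightarrow>
   (\<forall>c\<in>blk ` edges R. (\<Sum>e | e \<in> edges R \<and> blk e = c. m e) = f c)"
proof -
  have "(\<forall>\<beta>\<in>pos_boundaries R. blength R m \<beta> = f (label R \<beta>)) \<longleftrightarrow>
    (\<forall>c\<in>label R ` pos_boundaries R. (\<Sum>e | e \<in> edges R \<and> blk e = c. m e) = f c)"
    by (simp add: blength_pos)
  then show ?thesis by (simp only: label_pos blk_img)
qed

lemma length_kernel_eq: "length_kernel R = {m. (\<forall>e. e \<notin> edges R \<longrightarrow> m e = 0) \<and>
    (\<forall>c\<in>blk ` edges R. (\<Sum>e | e \<in> edges R \<and> blk e = c. m e) = 0)}"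
proof -
  have "(\<forall>\<beta>\<in>boundaries R. blength R m \<beta> = 0) \<longleftrightarrow> (\<forall>c\<in>blk ` edges R. (\<Sum>e | e \<in> edges R \<and> blk e = c. m e) = 0)" for m
  proof -
    have "blength R m (negs R) = 0" if "\<forall>c\<in>blk ` edges R. (\<Sum>e | e \<in> edges R \<and> blk e = c. m e) = 0"
      using that by (simp add: blength_neg sum_blocks blk_img)
    then show ?thesis
      using pos_lengths_iff[of m "\<lambda>_. 0"] by (auto simp: boundaries neg_boundaries)
  qed
  then show ?thesis by (auto simp: length_kernel_def edge_vectors_def)
qed

lemma affine_Met_eq:
  assumes "Lm 1 = (\<Sum>c\<in>{1..n}. L c)"
  shows "affine_Met R L Lm = {m. (\<forall>e. e \<notin> edges R \<longrightarrow> m e = 0) \<and>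
    (\<forall>c\<in>blk ` edges R. (\<Sum>e | e \<in> edges R \<and> blk e = c. m e) = L c)}"
proof -
  have "label R (negs R) = 1" using ln by (auto simp: neg_boundaries bij_betw_def)
  then have "(\<forall>\<beta>\<in>neg_boundaries R. blength R m \<beta> = Lm (label R \<beta>))"
    if "\<forall>c\<in>blk ` edges R. (\<Sum>e | e \<in> edges R \<and> blk e = c. m e) = L c" for m
    using that assms by (simp add: neg_boundaries blength_neg sum_blocks blk_img)
  then show ?thesis
    unfolding affine_Met_def pos_lengths_iff[of _ L] by (auto simp: edge_vectors_def)
qed

lemma vol_Met_eq:
  assumes L: "\<And>c. c \<in> {1..n} \<Longrightarrow> 0 < L c" and Lm: "Lm 1 = (\<Sum>c\<in>{1..n}. L c)"
  shows "vol_Met R L Lm = (\<Prod>c\<in>{1..n}. L c ^ (card {e \<in> edges R. blk e = c} - 1) / fact (card {e \<in> edges R. blk e = c} - 1))"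
proof -
  note bl = block_lattice_basis_and_volume[OF finE, of blk, folded length_kernel_eq, folded integer_kernel_def, folded lattice_basis_def]
  obtain d b where db: "(SOME (d, b). lattice_basis R d b) = (d, b)" by (cases "SOME (d, b). lattice_basis R d b")
  have lb: "lattice_basis R d b"
    using someI_ex[of "\<lambda>(d, b). lattice_basis R d b"] bl by (simp add: db)
  define m where "m = (SOME m. m \<in> affine_Met R L Lm)"
  \<comment> \<open>Putting the whole length \<open>L c\<close> on one edge of each block and 0 on
    the others gives a point of the affine space, so the chosen base point does lie in it.\<close>
  have "\<exists>m. m \<in> affine_Met R L Lm"
  proof -
    define rep where "rep = (\<lambda>c. SOME e. e \<in> edges R \<and> blk e = c)"
    have rep: "rep c \<in> edges R \<and> blk (rep c) = c" if "c \<in> blk ` edges R" for c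
      unfolding rep_def by (rule someI_ex) (use that in auto)
    have "(\<Sum>e | e \<in> edges R \<and> blk e = c. if e \<in> edges R \<and> e = rep (blk e) then L (blk e) else 0) = L c"
      if c: "c \<in> blk ` edges R" for c
    proof -
      have "(\<Sum>e | e \<in> edges R \<and> blk e = c. if e \<in> edges R \<and> e = rep (blk e) then L (blk e) else 0)
        = (\<Sum>e | e \<in> edges R \<and> blk e = c. if e = rep c then L c else 0)" by (intro sum.cong) auto
      then show ?thesis using rep[OF c] finE by simp
    qed
    then show ?thesis
      unfolding affine_Met_eq[where L = L and Lm = Lm, OF Lm]
      by (intro exI[of _ "\<lambda>e. if e \<in> edges R \<and> e = rep (blk e) then L (blk e) else 0"]) simp
  qed
  then have m: "m \<in> affine_Met R L Lm" unfolding m_def by (rule someI_ex)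
  have bK: "b i \<in> length_kernel R" if "i < d" for i
    using lb that by (auto simp: lattice_basis_def integer_kernel_def)
  \<comment> \<open>Kernel vectors do not change lengths, so membership in \<open>Met\<close>
    reduces to positivity of the coordinates.\<close>
  have "(\<lambda>e. m e + (\<Sum>i<d. x i * b i e)) \<in> affine_Met R L Lm" for x
  proof -
    have "(\<Sum>e | e \<in> edges R \<and> blk e = c. m e + (\<Sum>i<d. x i * b i e)) = L c" if c: "c \<in> blk ` edges R" for c
    proof -
      have "(\<Sum>e | e \<in> edges R \<and> blk e = c. m e) = L c"
        using m c unfolding affine_Met_eq[where L = L and Lm = Lm, OF Lm] by blast
      moreover have "(\<Sum>e | e \<in> edges R \<and> blk e = c. \<Sum>i<d. x i * b i e)
          = (\<Sum>i<d. x i * (\<Sum>e | e \<in> edges R \<and> blk e = c. b i e))"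
        by (subst sum.swap) (simp add: sum_distrib_left)
      ultimately have "(\<Sum>e | e \<in> edges R \<and> blk e = c. m e + (\<Sum>i<d. x i * b i e))
          = L c + (\<Sum>i<d. x i * (\<Sum>e | e \<in> edges R \<and> blk e = c. b i e))"
        by (simp only: sum.distrib)
      also have "(\<Sum>i<d. x i * (\<Sum>e | e \<in> edges R \<and> blk e = c. b i e)) = 0"
        using bK c unfolding length_kernel_eq by (intro sum.neutral) auto
      finally show ?thesis by simp
    qed
    moreover have "m e + (\<Sum>i<d. x i * b i e) = 0" if "e \<notin> edges R" for e
    proof -
      have "(\<Sum>i<d. x i * b i e) = 0" using bK that unfolding length_kernel_eq by (intro sum.neutral) auto
      then show ?thesis using m that unfolding affine_Met_eq[where L = L and Lm = Lm, OF Lm] by simp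
    qed
    ultimately show ?thesis unfolding affine_Met_eq[where L = L and Lm = Lm, OF Lm] by simp
  qed
  then have "vol_Met R L Lm = measure (\<Pi>\<^sub>M i\<in>{..<d}. lborel)
      {x \<in> {..<d} \<rightarrow>\<^sub>E UNIV. \<forall>e\<in>edges R. 0 < m e + (\<Sum>i<d. x i * b i e)}"
    by (simp add: vol_Met_def db Met_def flip: m_def)
  also have "\<dots> = (\<Prod>c\<in>blk ` edges R. L c ^ (card {e \<in> edges R. blk e = c} - 1) / fact (card {e \<in> edges R. blk e = c} - 1))"
    using bl lb m L unfolding affine_Met_eq[where L = L and Lm = Lm, OF Lm] blk_img by simp
  finally show ?thesis by (simp only: blk_img)
qed

lemma vol_Met_key:
  assumes \<theta>: "bij_betw \<theta> {..<N} (negs R)"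
    and L: "\<And>c. c \<in> {1..n} \<Longrightarrow> 0 < L c" and Lm: "Lm 1 = (\<Sum>c\<in>{1..n}. L c)"
  shows "vol_Met R L Lm = weight N n L (lk \<theta>)"
proof -
  have "card {e \<in> edges R. blk e = c} = card {i \<in> {..<N}. lk \<theta> i = c}" for c
  proof -
    have b: "bij_betw (orbit (s1 R) \<circ> \<theta>) {..<N} (edges R)" using \<theta> edges_negs by (rule bij_betw_trans)
    have "blk ((orbit (s1 R) \<circ> \<theta>) i) = lk \<theta> i" if "i < N" for i
    proof -
      have "orbit (s1 R) (\<theta> i) = orbit (s1 R) (s1 R (\<theta> i))"
        using \<theta>_negs[OF \<theta> that] by (simp add: edge_s1 negs_H)
      then show ?thesis using that s1_negs[OF \<theta>_negs[OF \<theta> that]] by (simp add: blk_edge lk_def[OF \<theta>])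
    qed
    then have "bij_betw (orbit (s1 R) \<circ> \<theta>) {i \<in> {..<N}. lk \<theta> i = c} {e \<in> edges R. blk e = c}"
      by (intro bij_betw_Collect[OF b]) auto
    then show ?thesis by (rule bij_betw_same_card[symmetric])
  qed
  then show ?thesis using vol_Met_eq[where L = L and Lm = Lm, OF L Lm] by (simp add: weight_def)
qed

end

text \<open>A triple \<open>(t, r, l)\<close> is realised on the half-edges \<open>0, \<dots>, 2 N - 1\<close>, with \<open>i < N\<close> the negative half
  and \<open>i + N\<close> the positive half of the same edge.\<close>

definition key_graph :: "nat \<Rightarrow> (nat \<Rightarrow> nat) \<Rightarrow> (nat \<Rightarrow> nat) \<Rightarrow> (nat \<Rightarrow> nat) \<Rightarrow> nat dribbon" where
  "key_graph N t r l =
    (let f = (\<lambda>i. if i < N then i + N else if i < 2 * N then i - N else i);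
         h = (\<lambda>i. if i < N then t i else if i < 2 * N then inv t (r (i - N)) + N else i)
     in \<lparr>half_edges = {..<2 * N}, s0 = inv (h \<circ> f), s1 = f, s2 = h,
         dir = (\<lambda>i. if i < N then -1 else 1),
         label = (\<lambda>\<beta>. if \<exists>x\<in>\<beta>. x < N then 1 else l ((SOME x. x \<in> \<beta>) - N))\<rparr>)"

section \<open>Every triple comes from a graph\<close>

context
  fixes N n :: nat and t r l :: "nat \<Rightarrow> nat"
  assumes key: "(t, r, l) \<in> all_keys N n" and N: "0 < N"
begin

definition "pos_perm = inv t \<circ> r"
definition "realisation = key_graph N t r l"

lemma key_cycle_permutes: "t permutes {..<N}" and key_matching_permutes: "r permutes {..<N}" and pos_perm_permutes: "pos_perm permutes {..<N}"
  and key_cycle_orbit: "\<And>i. i < N \<Longrightarrow> orbit t i = {..<N}"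
  and key_matching_involution: "\<And>i. i < N \<Longrightarrow> r i \<noteq> i" "\<And>i. i < N \<Longrightarrow> r (r i) = i"
  using key pair_permutes[of t "{..<N}" r] by (auto simp: all_keys_def full_cycles_def matchings_def pos_perm_def)

lemma key_labelling: "l \<in> labellings N n pos_perm"
  using key by (simp add: all_keys_def pos_perm_def)

lemma key_less_iff: "t i < N \<longleftrightarrow> i < N" "r i < N \<longleftrightarrow> i < N" "pos_perm i < N \<longleftrightarrow> i < N"
  using permutes_in_image[OF key_cycle_permutes, of i] permutes_in_image[OF key_matching_permutes, of i] permutes_in_image[OF pos_perm_permutes, of i] by auto

lemma cycle_pos_perm: "t (pos_perm i) = r i"
  using permutes_inverses(1)[OF key_cycle_permutes] by (simp add: pos_perm_def)

lemma realisation_half: "half_edges realisation = {..<2 * N}"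
  and realisation_s1: "s1 realisation = (\<lambda>i. if i < N then i + N else if i < 2 * N then i - N else i)"
  and realisation_s2: "s2 realisation = (\<lambda>i. if i < N then t i else if i < 2 * N then pos_perm (i - N) + N else i)"
  and realisation_s0: "s0 realisation = inv (s2 realisation \<circ> s1 realisation)"
  and realisation_dir: "dir realisation = (\<lambda>i. if i < N then -1 else 1)"
  and realisation_label: "label realisation = (\<lambda>\<beta>. if \<exists>x\<in>\<beta>. x < N then 1 else l ((SOME x. x \<in> \<beta>) - N))"
  by (simp_all add: realisation_def key_graph_def Let_def pos_perm_def fun_eq_iff)

lemma realisation_p1: "s1 realisation permutes {..<2 * N}"
proof (rule bij_imp_permutes)
  show "bij_betw (s1 realisation) {..<2 * N} {..<2 * N}"
    by (rule bij_betwI[where g = "s1 realisation"]) (auto simp: realisation_s1)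
qed (auto simp: realisation_s1)

lemma realisation_p2: "s2 realisation permutes {..<2 * N}"
proof (rule bij_imp_permutes)
  have "inj_on (s2 realisation) {..<2 * N}"
  proof (rule inj_onI)
    fix x y assume "x \<in> {..<2 * N}" "y \<in> {..<2 * N}" "s2 realisation x = s2 realisation y"
    moreover have "t x = t y \<Longrightarrow> x = y" by (rule injD[OF permutes_inj[OF key_cycle_permutes]])
    moreover have "pos_perm (x - N) = pos_perm (y - N) \<Longrightarrow> x - N = y - N" by (rule injD[OF permutes_inj[OF pos_perm_permutes]])
    moreover have "t z < N" if "z < N" for z using that key_less_iff by simp
    ultimately show "x = y" by (fastforce simp: realisation_s2 split: if_splits)
  qed
  moreover have "s2 realisation i < 2 * N" if "i < 2 * N" for i
  proof (cases "i < N")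
    case True then show ?thesis using key_less_iff(1)[of i] by (simp add: realisation_s2)
  next
    case False then show ?thesis using that key_less_iff(3)[of "i - N"] by (simp add: realisation_s2)
  qed
  ultimately show "bij_betw (s2 realisation) {..<2 * N} {..<2 * N}"
    by (simp add: bij_betw_def endo_inj_surj image_subset_iff)
qed (auto simp: realisation_s2)

lemma realisation_p0: "s0 realisation permutes {..<2 * N}"
  unfolding realisation_s0 by (intro permutes_inv permutes_compose realisation_p1 realisation_p2)

lemma realisation_q: "i < N \<Longrightarrow> s2 realisation (s1 realisation i) = pos_perm i + N" "i < N \<Longrightarrow> s2 realisation (s1 realisation (i + N)) = t i"
  by (auto simp: realisation_s1 realisation_s2)

lemma realisation_ribbon: "ribbon_graph realisation"
proof -
  have "s2 realisation \<circ> s1 realisation \<circ> s0 realisation = id"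
    unfolding realisation_s0 by (rule permutes_inv_o(1)[OF permutes_compose[OF realisation_p1 realisation_p2]])
  moreover have "\<forall>x\<in>{..<2 * N}. s1 realisation (s1 realisation x) = x \<and> s1 realisation x \<noteq> x"
    using N by (auto simp: realisation_s1)
  ultimately show ?thesis
    unfolding ribbon_graph_def realisation_half using realisation_p0 realisation_p1 realisation_p2 by blast
qed

lemma realisation_direction: "direction realisation"
  by (auto simp: direction_def realisation_half realisation_s1 realisation_s2 realisation_dir key_less_iff)

lemma realisation_negs: "negs realisation = {..<N}" and realisation_poss: "poss realisation = {N..<2 * N}"
  by (auto simp: negs_def poss_def realisation_half realisation_dir split: if_splits)

lemma realisation_orbit_neg: "i < N \<Longrightarrow> orbit (s2 realisation) i = {..<N}"
proof -
  assume i: "i < N"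
  have "orbit (s2 realisation) i = orbit t i"
    by (rule orbit_cong0[where A = "{..<N}"]) (use i key_less_iff in \<open>auto simp: realisation_s2\<close>)
  then show ?thesis using key_cycle_orbit[OF i] by simp
qed

lemma realisation_orbit_pos: "i < N \<Longrightarrow> orbit (s2 realisation) (i + N) = (\<lambda>j. j + N) ` orbit pos_perm i"
proof -
  assume i: "i < N"
  show ?thesis
  proof (rule orbit_inverse[symmetric])
    show "i \<in> orbit pos_perm i" by (rule permutation_self_in_orbit[OF permutes_finite_permutation[OF _ pos_perm_permutes]]) simp
    fix x assume "x \<in> orbit pos_perm i"
    then have "x < N" using permutes_orbit_subset[OF pos_perm_permutes, of i] i by auto
    then show "s2 realisation (x + N) = pos_perm x + N" by (simp add: realisation_s2)
  qed
qed

text \<open>The label is read at an arbitrarily chosen point of the boundary; the choice does not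
  matter because \<open>l\<close> is constant on the cycles of \<open>pos_perm\<close>.\<close>

lemma realisation_label_pos: "i < N \<Longrightarrow> label realisation (orbit (s2 realisation) (i + N)) = l i"
proof -
  assume i: "i < N"
  have perm: "permutation pos_perm" by (rule permutes_finite_permutation[OF _ pos_perm_permutes]) simp
  let ?B = "(\<lambda>j. j + N) ` orbit pos_perm i"
  have "?B \<noteq> {}" using orbit_nonempty[of pos_perm i] by simp
  then have "(SOME x. x \<in> ?B) \<in> ?B" by (rule some_in_eq[THEN iffD2])
  then obtain j where j: "j \<in> orbit pos_perm i" "(SOME x. x \<in> ?B) = j + N" by blast
  have jN: "j < N" using j(1) permutes_orbit_subset[OF pos_perm_permutes, of i] i by auto
  have "l j = l i"
    using key_labelling orbit_eq_if_in[OF perm j(1)] jN i by (simp add: labellings_def)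
  moreover have "\<not> (\<exists>x\<in>?B. x < N)" by auto
  ultimately show ?thesis unfolding realisation_orbit_pos[OF i] realisation_label using j(2) by simp
qed

lemma realisation_lp: "bij_betw (label realisation) (pos_boundaries realisation) {1..n}"
proof -
  have pb: "pos_boundaries realisation = (\<lambda>i. orbit (s2 realisation) (i + N)) ` {..<N}"
  proof -
    have "pos_boundaries realisation = orbit (s2 realisation) ` {N..<2 * N}"
      by (simp add: pos_boundaries_def flip: poss_def realisation_poss)
    also have "{N..<2 * N} = (\<lambda>i. i + N) ` {..<N}"
    proof (intro set_eqI iffI)
      fix x assume "x \<in> {N..<2 * N}"
      then show "x \<in> (\<lambda>i. i + N) ` {..<N}" by (intro image_eqI[of _ _ "x - N"]) auto
    qed auto
    finally show ?thesis by (simp add: image_image)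
  qed
  have "inj_on (label realisation) (pos_boundaries realisation)"
  proof (rule inj_onI)
    fix \<beta> \<gamma> assume "\<beta> \<in> pos_boundaries realisation" "\<gamma> \<in> pos_boundaries realisation" and eq: "label realisation \<beta> = label realisation \<gamma>"
    then obtain i j where ij: "i < N" "\<beta> = orbit (s2 realisation) (i + N)" "j < N" "\<gamma> = orbit (s2 realisation) (j + N)"
      by (auto simp: pb)
    then have "l i = l j" using eq by (simp add: realisation_label_pos)
    then have "orbit pos_perm i = orbit pos_perm j" using key_labelling ij by (simp add: labellings_def)
    then show "\<beta> = \<gamma>" using ij by (simp add: realisation_orbit_pos)
  qed
  moreover have "label realisation ` pos_boundaries realisation = l ` {..<N}"
    by (simp add: pb image_image realisation_label_pos cong: image_cong_simp)
  ultimately show ?thesis using key_labelling by (simp add: bij_betw_def labellings_def)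
qed

lemma realisation_ln: "bij_betw (label realisation) (neg_boundaries realisation) {1..1}"
proof -
  have "neg_boundaries realisation = orbit (s2 realisation) ` {..<N}" by (simp add: neg_boundaries_def flip: negs_def realisation_negs)
  also have "\<dots> = {{..<N}}" using N realisation_orbit_neg by auto
  finally show ?thesis using N by (auto simp: bij_betw_def realisation_label)
qed

text \<open>A vertex is a cycle of \<open>s2 \<circ> s1\<close>, the inverse of \<open>s0\<close>.
  Starting from a negative half \<open>i\<close> it runs through \<open>i\<close>,
  \<open>pos_perm i + N\<close>, \<open>r i\<close>, \<open>pos_perm (r i) + N\<close> and closes up
  because \<open>t\<close> after \<open>pos_perm\<close> is the involution \<open>r\<close>. Every
  cycle contains a negative half, since \<open>s2 \<circ> s1\<close> changes the sign.\<close>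

lemma realisation_quartic: "\<forall>v\<in>vertices realisation. card v = 4"
proof
  let ?q = "s2 realisation \<circ> s1 realisation"
  have qp: "?q permutes {..<2 * N}" by (intro permutes_compose realisation_p1 realisation_p2)
  have perm: "permutation ?q" by (rule permutes_finite_permutation[OF _ qp]) simp
  have sub: "orbit ?q i = set [i, pos_perm i + N, r i, pos_perm (r i) + N] \<and> distinct [i, pos_perm i + N, r i, pos_perm (r i) + N]" if i: "i < N" for i
  proof
    have b: "pos_perm i < N" "r i < N" "pos_perm (r i) < N" using i key_less_iff by auto
    have "map ?q [i, pos_perm i + N, r i, pos_perm (r i) + N] = rotate1 [i, pos_perm i + N, r i, pos_perm (r i) + N]"
      using i b by (simp add: realisation_q cycle_pos_perm key_matching_involution)
    from orbit_eq_set[OF this, of i] show "orbit ?q i = set [i, pos_perm i + N, r i, pos_perm (r i) + N]" by simp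
    have "pos_perm i \<noteq> pos_perm (r i)" using key_matching_involution(1)[OF i] inj_eq[OF permutes_inj[OF pos_perm_permutes], of i "r i"] by metis
    then show "distinct [i, pos_perm i + N, r i, pos_perm (r i) + N]" using i b key_matching_involution(1)[OF i] by auto
  qed
  fix v assume "v \<in> vertices realisation"
  then obtain x where x: "x < 2 * N" "v = orbit ?q x"
    by (auto simp: vertices_def realisation_half realisation_s0 orbit_inv_eq[OF perm])
  obtain i where i: "i < N" "v = orbit ?q i"
  proof (cases "x < N")
    case True then show ?thesis using x that by blast
  next
    case False
    then have xN: "x = (x - N) + N" "x - N < N" using x by auto
    then have "?q x = t (x - N)" using realisation_q(2)[of "x - N"] by simp
    moreover have "orbit ?q (?q x) = orbit ?q x" by (rule permutation_orbit_step[OF perm])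
    ultimately show ?thesis using that[of "t (x - N)"] x xN key_less_iff by simp
  qed
  have "card v = length [i, pos_perm i + N, r i, pos_perm (r i) + N]"
    using sub[OF i(1)] i(2) distinct_card[of "[i, pos_perm i + N, r i, pos_perm (r i) + N]"] by simp
  then show "card v = 4" by simp
qed

lemma realisation_one_negative: "one_negative realisation n"
  by unfold_locales (rule realisation_ribbon realisation_direction realisation_lp realisation_ln realisation_quartic)+

text \<open>The negative halves form a single orbit of \<open>s2\<close>, and \<open>s1\<close>
  attaches each positive half to one of them. One negative boundary therefore makes the graph
  connected.\<close>

lemma realisation_connected: "connected_ribbon realisation"
proof -
  let ?M = "moves realisation \<union> (moves realisation)\<inverse>"
  have m1: "(x, s1 realisation x) \<in> ?M" and m2: "(x, s2 realisation x) \<in> ?M" if "x < 2 * N" for x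
    using that by (auto simp: moves_def realisation_half)
  have neg: "(0, y) \<in> ?M\<^sup>*" if "y < N" for y
  proof -
    have "y \<in> orbit (s2 realisation) 0" using that realisation_orbit_neg[OF N] by simp
    then show ?thesis
    proof induction
      case base then show ?case using m2[of 0] N by auto
    next
      case (step y)
      have "y < N" using step(1) realisation_orbit_neg[OF N] by simp
      then show ?case using m2[of y] step(2) by (auto intro: rtrancl_into_rtrancl)
    qed
  qed
  have all: "(0, y) \<in> ?M\<^sup>*" if y: "y < 2 * N" for y
  proof (cases "y < N")
    case False
    then have "y - N < N" "s1 realisation (y - N) = y" using y by (auto simp: realisation_s1)
    then show ?thesis using neg[of "y - N"] m1[of "y - N"] by (auto intro: rtrancl_into_rtrancl)
  qed (rule neg)
  have "sym (?M\<^sup>*)" by (intro sym_rtrancl sym_Un_converse)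
  then show ?thesis
    using all unfolding connected_ribbon_def realisation_half by (meson lessThan_iff rtrancl_trans symD)
qed

text \<open>Numbering each negative half by itself gives back the triple. The genus is
  \<open>g\<close> because \<open>N\<close> is the number of edges that Euler's relation assigns to
  \<open>g\<close> and \<open>n\<close>.\<close>

lemma key_graph_quartic:
  assumes g: "N = 2 * (2 * g + n - 1)" "1 \<le> 2 * g + n"
  shows "realisation \<in> quartic_graphs g n 1" "(t, r, l) \<in> keys_of realisation"
proof -
  interpret one_negative realisation n by (rule realisation_one_negative)
  have GN: "one_negative.N realisation = N" by (simp add: N_def realisation_negs)
  have "has_genus realisation g" unfolding genus_iff GN using g by (simp add: of_nat_diff)
  then show "realisation \<in> quartic_graphs g n 1"
    using realisation_ribbon realisation_direction realisation_connected realisation_lp realisation_ln realisation_quartic by (simp add: quartic_graphs_def has_type_def)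
  have b: "bij_betw id {..<N} (negs realisation)" by (simp add: realisation_negs)
  have "pull id N (s2 realisation) = t"
    by (rule pull_eqI[OF b]) (auto simp: realisation_s2 key_less_iff permutes_not_in[OF key_cycle_permutes])
  moreover have "pull id N (\<lambda>x. s2 realisation (s1 realisation (s2 realisation (s1 realisation x)))) = r"
    by (rule pull_eqI[OF b]) (auto simp: realisation_q key_less_iff cycle_pos_perm permutes_not_in[OF key_matching_permutes])
  moreover have "(\<lambda>i\<in>{..<N}. label realisation (orbit (s2 realisation) (s1 realisation (id i)))) = l"
  proof
    fix i show "(\<lambda>i\<in>{..<N}. label realisation (orbit (s2 realisation) (s1 realisation (id i)))) i = l i"
      using key_labelling realisation_label_pos[of i] by (auto simp: realisation_s1 labellings_def PiE_iff extensional_def)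
  qed
  ultimately have "key realisation N id = (t, r, l)" by (simp add: key_def)
  then show "(t, r, l) \<in> keys_of realisation"
    unfolding keys_of_def using b by (auto simp: realisation_negs intro!: exI[of _ id])
qed

end

section \<open>The total volume as a sum over triples\<close>

lemma finite_all_keys: "finite (all_keys N n)"
proof (rule finite_subset)
  show "all_keys N n \<subseteq> full_cycles {..<N} \<times> matchings {..<N} \<times> ({..<N} \<rightarrow>\<^sub>E {1..n})"
    by (auto simp: all_keys_def labellings_def)
  show "finite (full_cycles {..<N} \<times> matchings {..<N} \<times> ({..<N} \<rightarrow>\<^sub>E {1..n}))"
    by (intro finite_cartesian_product finite_full_cycles finite_matchings finite_PiE) auto
qed

lemma quartic_one_negative: "R \<in> quartic_graphs g n 1 \<Longrightarrow> one_negative R n"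
  by unfold_locales (auto simp: quartic_graphs_def has_type_def)

text \<open>The sets \<open>keys_of R\<close> partition \<open>all_keys N n\<close>, one part for
  each isomorphism class. The part of \<open>R\<close> has \<open>N! / #Aut R\<close> elements, all
  of weight equal to the volume of \<open>R\<close>, so the sum over all keys divided by
  \<open>N!\<close> weights each class by \<open>1 / #Aut R\<close>.\<close>

lemma V_eq_sum_keys:
  fixes g n :: nat and L :: "nat \<Rightarrow> real"
  assumes adm: "1 \<le> n" "2 \<le> 2 * g + n"
    and L: "\<And>c. c \<in> {1..n} \<Longrightarrow> 0 < L c" and Lm: "Lm 1 = (\<Sum>c\<in>{1..n}. L c)"
  defines "N \<equiv> 2 * (2 * g + n - 1)"
  shows "V g n 1 L Lm = (\<Sum>(t, r, l)\<in>all_keys N n. weight N n L l) / fact N"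
proof -
  let ?Q = "quartic_graphs g n 1" and ?rel = "iso_rel g n 1"
  have RN: "one_negative.N R = N" if "R \<in> ?Q" for R
  proof -
    interpret one_negative R n using that by (rule quartic_one_negative)
    have "int (one_negative.N R) = 2 * (2 * int g + int n - 1)"
      using genus_iff[of g] that by (simp add: quartic_graphs_def has_type_def)
    then show ?thesis using adm unfolding assms(5) by arith
  qed
  have keys_sub: "keys_of R \<subseteq> all_keys N n" if "R \<in> ?Q" for R
  proof -
    interpret one_negative R n using that by (rule quartic_one_negative)
    show ?thesis using key_in RN[OF that] by (auto simp: keys_of_def simp flip: N_def)
  qed
  have iso: "(\<exists>\<phi>. is_iso \<phi> R S) \<longleftrightarrow> keys_of R \<inter> keys_of S \<noteq> {}" if "R \<in> ?Q" "S \<in> ?Q" for R S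
  proof -
    interpret two_one_negative R S n
      using that by (intro two_one_negative.intro quartic_one_negative)
    show ?thesis by (rule iso_iff_keys)
  qed
  have sub: "keys_of R \<subseteq> keys_of S" if RS: "R \<in> ?Q" "S \<in> ?Q" "keys_of R \<inter> keys_of S \<noteq> {}" for R S
  proof -
    interpret two_one_negative R S n
      using that by (intro two_one_negative.intro quartic_one_negative)
    show ?thesis using iso[OF RS(1,2)] RS(3) iso_keys_subset by blast
  qed
  have keys_eq: "keys_of R = keys_of S" if "R \<in> ?Q" "S \<in> ?Q" "keys_of R \<inter> keys_of S \<noteq> {}" for R S
    using sub[OF that] sub[OF that(2,1)] that(3) by (simp add: Int_commute subset_antisym)
  have ne: "keys_of R \<noteq> {}" if "R \<in> ?Q" for R
  proof -
    interpret one_negative R n using that by (rule quartic_one_negative)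
    obtain \<theta> where "bij_betw \<theta> {..<card (negs R)} (negs R)"
      using ex_bij_betw_nat_finite[OF fin_negs] by (auto simp: lessThan_atLeast0)
    then have "key R (card (negs R)) \<theta> \<in> keys_of R" unfolding keys_of_def by blast
    then show ?thesis by blast
  qed
  \<comment> \<open>Key sets that meet coincide, so isomorphism is equality of key sets, and a class
    may be replaced by its key set.\<close>
  have rel: "?rel = {(R, S). R \<in> ?Q \<and> S \<in> ?Q \<and> keys_of R = keys_of S}"
    using iso keys_eq ne by (auto simp: iso_rel_def) blast+
  define pick where "pick = (\<lambda>C :: nat dribbon set. SOME R. R \<in> C)"
  have cls: "\<exists>R\<in>?Q. C = {S \<in> ?Q. keys_of S = keys_of R}" if "C \<in> ?Q // ?rel" for C
  proof -
    obtain R where R: "R \<in> ?Q" "C = ?rel `` {R}" using \<open>C \<in> ?Q // ?rel\<close> by (elim quotientE)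
    then have "C = {S \<in> ?Q. keys_of S = keys_of R}" unfolding rel by blast
    then show ?thesis using R(1) by blast
  qed
  have pick: "pick C \<in> ?Q \<and> C = {S \<in> ?Q. keys_of S = keys_of (pick C)}" if C: "C \<in> ?Q // ?rel" for C
  proof -
    obtain R where R: "R \<in> ?Q" "C = {S \<in> ?Q. keys_of S = keys_of R}" using cls[OF C] by blast
    then have "pick C \<in> C" unfolding pick_def by (intro someI[of "\<lambda>R. R \<in> C" R]) simp
    then show ?thesis using R by auto
  qed
  let ?\<Phi> = "\<lambda>C. keys_of (pick C)"
  have inj: "inj_on ?\<Phi> (?Q // ?rel)"
  proof (rule inj_onI)
    fix C D assume C: "C \<in> ?Q // ?rel" and D: "D \<in> ?Q // ?rel" and eq: "?\<Phi> C = ?\<Phi> D"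
    have "C = {S \<in> ?Q. keys_of S = ?\<Phi> C}" using pick[OF C] by (rule conjunct2)
    also have "\<dots> = {S \<in> ?Q. keys_of S = ?\<Phi> D}" unfolding eq ..
    also have "\<dots> = D" by (rule conjunct2[OF pick[OF D], symmetric])
    finally show "C = D" .
  qed
  have img: "?\<Phi> ` (?Q // ?rel) = keys_of ` ?Q"
  proof (intro set_eqI iffI)
    fix A assume "A \<in> ?\<Phi> ` (?Q // ?rel)" then show "A \<in> keys_of ` ?Q" using pick by blast
  next
    fix A assume "A \<in> keys_of ` ?Q"
    then obtain R where R: "R \<in> ?Q" "A = keys_of R" by blast
    have C: "?rel `` {R} \<in> ?Q // ?rel" using R(1) by (rule quotientI)
    have "R \<in> ?rel `` {R}" unfolding rel using R(1) by blast
    then have "keys_of R = ?\<Phi> (?rel `` {R})" using pick[OF C] by blast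
    then show "A \<in> ?\<Phi> ` (?Q // ?rel)" using C R(2) by blast
  qed
  have Union: "\<Union> (keys_of ` ?Q) = all_keys N n"
  proof (intro set_eqI iffI)
    fix \<kappa> assume "\<kappa> \<in> \<Union> (keys_of ` ?Q)" then show "\<kappa> \<in> all_keys N n" using keys_sub by blast
  next
    fix \<kappa> assume "\<kappa> \<in> all_keys N n"
    then obtain t r l where \<kappa>: "\<kappa> = (t, r, l)" "(t, r, l) \<in> all_keys N n" by (cases \<kappa>) auto
    have "0 < N" "1 \<le> 2 * g + n" using adm by (auto simp: N_def)
    then show "\<kappa> \<in> \<Union> (keys_of ` ?Q)"
      using key_graph_quartic[OF \<kappa>(2) _ N_def[THEN meta_eq_to_obj_eq]] \<kappa>(1) by blast
  qed
  have summand: "1 / real (card (Aut R)) * vol_Met R L Lm = (\<Sum>(t, r, l)\<in>keys_of R. weight N n L l) / fact N"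
    if R: "R \<in> ?Q" for R
  proof -
    interpret one_negative R n using R by (rule quartic_one_negative)
    have w: "weight N n L l = vol_Met R L Lm" if trl: "(t, r, l) \<in> keys_of R" for t r l
    proof -
      obtain \<theta> where "(t, r, l) = key R (card (negs R)) \<theta>" "bij_betw \<theta> {..<card (negs R)} (negs R)"
        using trl unfolding keys_of_def by blast
      then have \<theta>: "bij_betw \<theta> {..<one_negative.N R} (negs R)" "key R (one_negative.N R) \<theta> = (t, r, l)"
        by (simp_all only: N_def)
      have "lk \<theta> = l" using \<theta>(2) key_eq[OF \<theta>(1)] by simp
      then show ?thesis using vol_Met_key[where L = L and Lm = Lm, OF \<theta>(1) L Lm] RN[OF R] by simp
    qed
    have "(\<Sum>(t, r, l)\<in>keys_of R. weight N n L l) = (\<Sum>\<kappa>\<in>keys_of R. vol_Met R L Lm)"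
      by (intro sum.cong refl) (auto simp: w)
    then have s: "(\<Sum>(t, r, l)\<in>keys_of R. weight N n L l) = real (card (keys_of R)) * vol_Met R L Lm" by simp
    have c: "real (card (keys_of R)) * real (card (Aut R)) = fact N"
      using card_keys_Aut RN[OF R] by (metis of_nat_fact of_nat_mult)
    have "fact N \<noteq> (0::real)" by simp
    then have "real (card (keys_of R)) \<noteq> 0" "real (card (Aut R)) \<noteq> 0" unfolding c[symmetric] by simp_all
    then show ?thesis unfolding s c[symmetric] by simp
  qed
  have "V g n 1 L Lm = (\<Sum>C\<in>?Q // ?rel. 1 / real (card (Aut (pick C))) * vol_Met (pick C) L Lm)"
    by (simp add: V_def Let_def pick_def)
  also have "\<dots> = (\<Sum>C\<in>?Q // ?rel. (\<Sum>(t, r, l)\<in>?\<Phi> C. weight N n L l) / fact N)"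
    using pick by (intro sum.cong refl summand) blast
  also have "\<dots> = (\<Sum>C\<in>?Q // ?rel. \<Sum>(t, r, l)\<in>?\<Phi> C. weight N n L l) / fact N"
    by (rule sum_divide_distrib[symmetric])
  also have "(\<Sum>C\<in>?Q // ?rel. \<Sum>(t, r, l)\<in>?\<Phi> C. weight N n L l)
      = (\<Sum>A\<in>keys_of ` ?Q. \<Sum>(t, r, l)\<in>A. weight N n L l)"
    unfolding img[symmetric] sum.reindex[OF inj] comp_def ..
  also have "\<dots> = (\<Sum>(t, r, l)\<in>\<Union> (keys_of ` ?Q). weight N n L l)"
  proof (subst sum.Union_disjoint)
    show "\<forall>A\<in>keys_of ` ?Q. finite A" using keys_sub finite_all_keys finite_subset by blast
    show "\<forall>A\<in>keys_of ` ?Q. \<forall>B\<in>keys_of ` ?Q. A \<noteq> B \<longrightarrow> A \<inter> B = {}" using keys_eq by blast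
  qed simp
  finally show ?thesis by (simp only: Union)
qed

text \<open>Induction on \<open>A\<close>: a new element \<open>a\<close> goes to any element of
  \<open>B\<close> of the same colour, and removing both leaves one element fewer of that colour. It
  is applied with \<open>A\<close> the cycles, \<open>B\<close> the labels and the exponent as
  colour.\<close>

lemma card_fibre_bijections:
  fixes f :: "'a \<Rightarrow> nat" and h :: "'b \<Rightarrow> nat"
  assumes "finite A" "finite B" "\<And>i. card {a \<in> A. f a = i} = card {b \<in> B. h b = i}" "finite S" "f ` A \<subseteq> S"
  shows "card {\<phi> \<in> A \<rightarrow>\<^sub>E B. bij_betw \<phi> A B \<and> (\<forall>a\<in>A. h (\<phi> a) = f a)} = (\<Prod>i\<in>S. fact (card {a \<in> A. f a = i}))"
  using assms(1,2,3,5)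
proof (induction A arbitrary: B rule: finite_induct)
  case empty
  have "B = {}"
  proof (rule ccontr)
    assume "B \<noteq> {}"
    then obtain b where "b \<in> B" by blast
    then have "card {b' \<in> B. h b' = h b} \<noteq> 0" using empty.prems(1) by auto
    then show False using empty.prems(2)[of "h b"] by simp
  qed
  then show ?case by (simp add: bij_betw_def)
next
  case (insert a A)
  define W where "W = (\<lambda>A B. {\<phi> \<in> A \<rightarrow>\<^sub>E B. bij_betw \<phi> A B \<and> (\<forall>a\<in>A. h (\<phi> a) = f a)})"
  have finW: "finite (W A' B')" if "finite A'" "finite B'" for A' B'
    unfolding W_def by (rule finite_subset[OF _ finite_PiE[OF that(1)]]) (use that in auto)
  let ?Ba = "{b \<in> B. h b = f a}"
  have split: "card {\<phi> \<in> W (insert a A) B. \<phi> a = b} = card (W A (B - {b}))" if b: "b \<in> ?Ba" for b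
  proof (rule bij_betw_same_card[of "\<lambda>\<phi>. restrict \<phi> A"], rule bij_betwI[where g = "\<lambda>\<phi>. \<phi>(a := b)"])
    show "(\<lambda>\<phi>. restrict \<phi> A) \<in> {\<phi> \<in> W (insert a A) B. \<phi> a = b} \<rightarrow> W A (B - {b})"
    proof
      fix \<phi> assume \<phi>: "\<phi> \<in> {\<phi> \<in> W (insert a A) B. \<phi> a = b}"
      then have bij: "bij_betw \<phi> (insert a A) B" and "\<phi> a = b" and hf: "\<forall>x\<in>A. h (\<phi> x) = f x" by (auto simp: W_def)
      then have "bij_betw \<phi> A (B - {b})"
      proof -
        have "insert b (\<phi> ` A) = B" "b \<notin> \<phi> ` A" "inj_on \<phi> A"
          using bij \<open>\<phi> a = b\<close> insert.hyps(2) by (auto simp: bij_betw_def)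
        then show ?thesis unfolding bij_betw_def by blast
      qed
      then have r: "bij_betw (restrict \<phi> A) A (B - {b})" by (rule bij_betw_cong[THEN iffD1, rotated]) simp
      then have "restrict \<phi> A \<in> A \<rightarrow>\<^sub>E B - {b}"
        using bij_betw_apply[OF r] by (intro PiE_I) simp_all
      then show "restrict \<phi> A \<in> W A (B - {b})" using hf r by (simp add: W_def)
    qed
    show "(\<lambda>\<phi>. \<phi>(a := b)) \<in> W A (B - {b}) \<rightarrow> {\<phi> \<in> W (insert a A) B. \<phi> a = b}"
    proof
      fix \<phi> assume \<phi>: "\<phi> \<in> W A (B - {b})"
      have same: "(\<phi>(a := b)) x = \<phi> x" if "x \<in> A" for x using that insert.hyps(2) by auto
      have bij: "bij_betw \<phi> A (B - {b})" using \<phi> by (simp add: W_def)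
      have "inj_on (\<phi>(a := b)) A" "(\<phi>(a := b)) ` A = B - {b}"
        using bij same by (simp_all add: bij_betw_def inj_on_def cong: image_cong_simp)
      moreover have "insert b (B - {b}) = B" using b by auto
      moreover have "A - {a} = A" using insert.hyps(2) by auto
      ultimately have "bij_betw (\<phi>(a := b)) (insert a A) B"
        unfolding bij_betw_def inj_on_insert image_insert by simp
      then show "\<phi>(a := b) \<in> {\<phi> \<in> W (insert a A) B. \<phi> a = b}"
        using \<phi> b insert.hyps(2) by (auto simp: W_def PiE_iff extensional_def)
    qed
    show "(restrict \<phi> A)(a := b) = \<phi>" if "\<phi> \<in> {\<phi> \<in> W (insert a A) B. \<phi> a = b}" for \<phi>
      using that by (auto simp: W_def fun_eq_iff PiE_iff extensional_def)
    show "restrict (\<phi>(a := b)) A = \<phi>" if "\<phi> \<in> W A (B - {b})" for \<phi>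
      using that insert.hyps(2) by (auto simp: W_def fun_eq_iff PiE_iff extensional_def)
  qed
  have cnt: "card {x \<in> insert a A. f x = i} = card {x \<in> A. f x = i} + of_bool (i = f a)" for i
  proof -
    have "{x \<in> insert a A. f x = i} = (if i = f a then insert a {x \<in> A. f x = i} else {x \<in> A. f x = i})" by auto
    then show ?thesis using insert.hyps by simp
  qed
  have IH: "card (W A (B - {b})) = (\<Prod>i\<in>S. fact (card {x \<in> A. f x = i}))" if b: "b \<in> ?Ba" for b
    unfolding W_def
  proof (rule insert.IH)
    show "card {x \<in> A. f x = i} = card {b' \<in> B - {b}. h b' = i}" for i
    proof -
      have "{b' \<in> B. h b' = i} = (if i = f a then insert b {b' \<in> B - {b}. h b' = i} else {b' \<in> B - {b}. h b' = i})"
        using b by auto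
      then have "card {b' \<in> B. h b' = i} = card {b' \<in> B - {b}. h b' = i} + of_bool (i = f a)"
        using insert.prems(1) by simp
      then show ?thesis using insert.prems(2)[of i] cnt[of i] by simp
    qed
  qed (use insert.prems in auto)
  have "card (W (insert a A) B) = (\<Sum>b\<in>?Ba. card {\<phi> \<in> W (insert a A) B. \<phi> a = b})"
  proof -
    have "W (insert a A) B = (\<Union>b\<in>?Ba. {\<phi> \<in> W (insert a A) B. \<phi> a = b})"
      by (auto simp: W_def)
    then have "card (W (insert a A) B) = card (\<Union>b\<in>?Ba. {\<phi> \<in> W (insert a A) B. \<phi> a = b})" by simp
    also have "\<dots> = (\<Sum>b\<in>?Ba. card {\<phi> \<in> W (insert a A) B. \<phi> a = b})"
      using insert.prems(1) insert.hyps finW by (intro card_UN_disjoint) auto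
    finally show ?thesis .
  qed
  also have "\<dots> = card ?Ba * (\<Prod>i\<in>S. fact (card {x \<in> A. f x = i}))"
    by (simp add: split IH)
  also have "card ?Ba = Suc (card {x \<in> A. f x = f a})"
    using insert.prems(2)[of "f a"] cnt[of "f a"] by simp
  also have "Suc (card {x \<in> A. f x = f a}) * (\<Prod>i\<in>S. fact (card {x \<in> A. f x = i}))
      = (\<Prod>i\<in>S. fact (card {x \<in> insert a A. f x = i}))"
  proof -
    have fa: "f a \<in> S" using insert.prems(3) by simp
    have "(\<Prod>i\<in>S. fact (card {x \<in> insert a A. f x = i}) :: nat)
        = (\<Prod>i\<in>S. (if i = f a then Suc (card {x \<in> A. f x = f a}) else 1) * fact (card {x \<in> A. f x = i}))"
      unfolding cnt by (intro prod.cong) auto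
    also have "\<dots> = Suc (card {x \<in> A. f x = f a}) * (\<Prod>i\<in>S. fact (card {x \<in> A. f x = i}))"
      using fa \<open>finite S\<close> by (simp add: prod.distrib)
    finally show ?thesis by simp
  qed
  finally show ?case by (simp add: W_def)
qed

section \<open>Coefficients of the volume polynomials\<close>

text \<open>The multiplicity function of an exponent vector, written as a sum of unit vectors like
  \<open>cycle_type\<close>, with which it is compared.\<close>

definition count_type :: "nat \<Rightarrow> (nat \<Rightarrow> nat) \<Rightarrow> (nat \<Rightarrow>\<^sub>0 nat)" where
  "count_type n \<alpha> = (\<Sum>c\<in>{1..n}. Poly_Mapping.single (\<alpha> c) 1)"

lemma lookup_count_type: "Poly_Mapping.lookup (count_type n \<alpha>) i = card {c \<in> {1..n}. \<alpha> c = i}"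
proof -
  have "Poly_Mapping.lookup (count_type n \<alpha>) i = (\<Sum>c\<in>{1..n}. if \<alpha> c = i then 1 else 0)"
    unfolding count_type_def lookup_sum by (intro sum.cong refl) (simp add: lookup_single when_def)
  also have "\<dots> = card {c \<in> {1..n}. \<alpha> c = i}" by (simp add: sum.If_cases Int_def)
  finally show ?thesis .
qed

lemma eq_count_type_iff: "\<mu> = count_type n \<alpha> \<longleftrightarrow> (\<forall>i. Poly_Mapping.lookup \<mu> i = card {c \<in> {1..n}. \<alpha> c = i})"
  by (auto simp: lookup_count_type intro!: poly_mapping_eqI)

lemma n_mu_sum_single: "n_mu (\<Sum>x\<in>A. Poly_Mapping.single (f x) 1) = card A"
proof (induction A rule: infinite_finite_induct)
  case (insert x F)
  then show ?case by (simp only: sum.insert[OF insert.hyps] n_mu_add n_mu_single card_insert_disjoint[OF insert.hyps] plus_1_eq_Suc)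
qed (simp_all add: n_mu_def)

lemma d_mu_add: "d_mu (\<mu> + \<nu>) = d_mu \<mu> + d_mu \<nu>"
proof -
  let ?S = "Poly_Mapping.keys \<mu> \<union> Poly_Mapping.keys \<nu>"
  have "Poly_Mapping.keys (\<mu> + \<nu>) \<subseteq> ?S" by (rule Poly_Mapping.keys_add)
  then show ?thesis by (simp add: d_mu_superset[of ?S] lookup_add sum.distrib distrib_left)
qed

lemma d_mu_single: "d_mu (Poly_Mapping.single i 1) = i"
  by (simp add: d_mu_def)

lemma d_mu_sum_single: "d_mu (\<Sum>x\<in>A. Poly_Mapping.single (f x) 1) = (\<Sum>x\<in>A. f x)"
proof (induction A rule: infinite_finite_induct)
  case (insert x F)
  then show ?case by (simp only: sum.insert[OF insert.hyps] d_mu_add d_mu_single)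
qed (simp_all add: d_mu_def)

text \<open>Such a labelling amounts to a bijection from cycles to labels under which label
  \<open>c\<close> names a cycle of length \<open>\<alpha> c + 1\<close>. There is none unless the
  cycle type is that of \<open>\<alpha>\<close>; otherwise the labels can be permuted among cycles
  of equal length. The resulting factorials cancel the denominator \<open>\<Prod> \<mu> i!\<close>
  of the series.\<close>

lemma card_labellings:
  fixes s :: "nat \<Rightarrow> nat" and \<alpha> :: "nat \<Rightarrow> nat"
  assumes s: "s permutes {..<N}"
  shows "card {l \<in> labellings N n s. \<forall>c\<in>{1..n}. card {i \<in> {..<N}. l i = c} = Suc (\<alpha> c)}
    = of_bool (cycle_type {..<N} s = count_type n \<alpha>) *
      (\<Prod>i\<in>Poly_Mapping.keys (count_type n \<alpha>). fact (Poly_Mapping.lookup (count_type n \<alpha>) i))"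
proof -
  let ?A = "{..<N}"
  define Os where "Os = orbit s ` ?A"
  define W where "W = {\<phi> \<in> Os \<rightarrow>\<^sub>E {1..n}. bij_betw \<phi> Os {1..n} \<and> (\<forall>C\<in>Os. \<alpha> (\<phi> C) = card C - 1)}"
  define LL where "LL = {l \<in> labellings N n s. \<forall>c\<in>{1..n}. card {i \<in> {..<N}. l i = c} = Suc (\<alpha> c)}"
  have perm: "permutation s" by (rule permutes_finite_permutation[OF _ s]) simp
  have finOs: "finite Os" by (simp add: Os_def)
  have self: "i \<in> orbit s i" for i by (rule permutation_self_in_orbit[OF perm])
  have same: "orbit s j = orbit s i \<longleftrightarrow> j \<in> orbit s i" for i j
    using orbit_eq_if_in[OF perm] self by metis
  have cell: "{j \<in> ?A. orbit s j = orbit s i} = orbit s i" if "i < N" for i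
    using permutes_orbit_subset[OF s, of i] that by (auto simp: same)
  have pos: "0 < card C" if "C \<in> Os" for C
    using that card_orbit_pos[OF _ s] by (auto simp: Os_def)
  have cntO: "card {C \<in> Os. card C - 1 = i} = Poly_Mapping.lookup (cycle_type ?A s) i" for i
  proof -
    have "card C - 1 = i \<longleftrightarrow> card C = Suc i" if "C \<in> Os" for C using pos[OF that] by linarith
    then have "{C \<in> Os. card C - 1 = i} = {C \<in> Os. card C = Suc i}" by blast
    then show ?thesis using s by (simp add: lookup_cycle_type Os_def)
  qed
  define \<Psi> where "\<Psi> = (\<lambda>\<phi>. \<lambda>i\<in>?A. \<phi> (orbit s i) :: nat)"
  have "bij_betw \<Psi> W LL"
  proof (rule bij_betw_imageI)
    show "inj_on \<Psi> W"
    proof (rule inj_onI)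
      fix \<phi> \<phi>' assume "\<phi> \<in> W" "\<phi>' \<in> W" and eq: "\<Psi> \<phi> = \<Psi> \<phi>'"
      then have "\<phi> \<in> extensional Os" "\<phi>' \<in> extensional Os" by (auto simp: W_def PiE_iff)
      moreover have "\<phi> C = \<phi>' C" if "C \<in> Os" for C
      proof -
        obtain i where "i < N" "C = orbit s i" using \<open>C \<in> Os\<close> by (auto simp: Os_def)
        then show ?thesis using fun_cong[OF eq, of i] by (simp add: \<Psi>_def)
      qed
      ultimately show "\<phi> = \<phi>'" by (rule extensionalityI)
    qed
    show "\<Psi> ` W = LL"
    proof (intro set_eqI iffI)
      fix l assume "l \<in> \<Psi> ` W"
      then obtain \<phi> where \<phi>: "\<phi> \<in> W" "l = \<Psi> \<phi>" by blast
      have bij: "bij_betw \<phi> Os {1..n}" and \<alpha>: "\<And>C. C \<in> Os \<Longrightarrow> \<alpha> (\<phi> C) = card C - 1" using \<phi> by (auto simp: W_def)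
      have li: "l i = \<phi> (orbit s i)" if "i < N" for i using that by (simp add: \<phi>(2) \<Psi>_def)
      have iff: "l i = l j \<longleftrightarrow> orbit s i = orbit s j" if "i < N" "j < N" for i j
        using inj_on_eq_iff[OF bij_betw_imp_inj_on[OF bij], of "orbit s i" "orbit s j"] that
        by (simp add: li Os_def)
      have img: "l ` ?A = {1..n}"
      proof -
        have "l ` ?A = \<phi> ` Os" unfolding Os_def image_image by (intro image_cong refl) (simp add: li)
        then show ?thesis using bij by (simp add: bij_betw_def)
      qed
      have "l \<in> ?A \<rightarrow>\<^sub>E {1..n}"
      proof (rule PiE_I)
        show "l i \<in> {1..n}" if "i \<in> ?A" for i using that img by blast
      qed (simp add: \<phi>(2) \<Psi>_def)
      then have "l \<in> labellings N n s" using img iff by (simp add: labellings_def)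
      moreover have "card {i \<in> {..<N}. l i = c} = Suc (\<alpha> c)" if c: "c \<in> {1..n}" for c
      proof -
        obtain i where i: "i < N" "c = l i" using c img by (metis imageE lessThan_iff)
        have "{j \<in> {..<N}. l j = c} = {j \<in> ?A. orbit s j = orbit s i}"
          using i iff by auto
        then have "{j \<in> {..<N}. l j = c} = orbit s i" by (simp only: cell[OF i(1)])
        moreover have "\<alpha> c = card (orbit s i) - 1" using \<alpha>[of "orbit s i"] i by (simp add: li Os_def)
        moreover have "0 < card (orbit s i)" using i(1) by (intro pos) (simp add: Os_def)
        ultimately show ?thesis by simp
      qed
      ultimately show "l \<in> LL" by (simp add: LL_def)
    next
      fix l assume l: "l \<in> LL"
      then have lab: "l \<in> ?A \<rightarrow>\<^sub>E {1..n}" "l ` ?A = {1..n}"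
        and iff: "\<And>i j. i < N \<Longrightarrow> j < N \<Longrightarrow> l i = l j \<longleftrightarrow> orbit s i = orbit s j"
        and sz: "\<And>c. c \<in> {1..n} \<Longrightarrow> card {i \<in> {..<N}. l i = c} = Suc (\<alpha> c)"
        by (simp_all add: LL_def labellings_def)
      define \<phi> where "\<phi> = (\<lambda>C\<in>Os. l (SOME x. x \<in> C))"
      have \<phi>: "\<phi> (orbit s i) = l i" if i: "i < N" for i
      proof -
        have x: "(SOME x. x \<in> orbit s i) \<in> orbit s i" using self[of i] by (rule someI)
        then have "(SOME x. x \<in> orbit s i) < N" using permutes_orbit_subset[OF s, of i] i by auto
        then have "l (SOME x. x \<in> orbit s i) = l i" using iff i x by (simp add: same)
        then show ?thesis using i by (simp add: \<phi>_def Os_def)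
      qed
      have "\<phi> ` Os = l ` ?A" unfolding Os_def image_image by (intro image_cong refl) (simp add: \<phi>)
      then have img: "\<phi> ` Os = {1..n}" using lab by simp
      have "inj_on \<phi> Os"
        unfolding Os_def by (intro inj_onI) (auto simp: \<phi> iff)
      then have "bij_betw \<phi> Os {1..n}" using img by (simp add: bij_betw_def)
      moreover have "\<phi> \<in> Os \<rightarrow>\<^sub>E {1..n}"
      proof (rule PiE_I)
        show "\<phi> C \<in> {1..n}" if "C \<in> Os" for C using that img by blast
      qed (simp add: \<phi>_def)
      moreover have "\<alpha> (\<phi> C) = card C - 1" if C: "C \<in> Os" for C
      proof -
        obtain i where i: "i < N" "C = orbit s i" using C by (auto simp: Os_def)
        have "l i \<in> {1..n}" using lab i by blast
        then have "card {j \<in> {..<N}. l j = l i} = Suc (\<alpha> (l i))" by (rule sz)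
        moreover have "{j \<in> {..<N}. l j = l i} = {j \<in> ?A. orbit s j = orbit s i}"
          using i iff by auto
        then have "{j \<in> {..<N}. l j = l i} = orbit s i" by (simp only: cell[OF i(1)])
        ultimately show ?thesis using i by (simp add: \<phi>)
      qed
      ultimately have "\<phi> \<in> W" by (simp add: W_def)
      moreover have "\<Psi> \<phi> = l"
        using lab(1) by (auto simp: \<Psi>_def \<phi> fun_eq_iff PiE_iff extensional_def)
      ultimately show "l \<in> \<Psi> ` W" by blast
    qed
  qed
  then have "card LL = card W" by (rule bij_betw_same_card[symmetric])
  also have "card W = of_bool (cycle_type ?A s = count_type n \<alpha>) *
      (\<Prod>i\<in>Poly_Mapping.keys (count_type n \<alpha>). fact (Poly_Mapping.lookup (count_type n \<alpha>) i))"
  proof (cases "cycle_type ?A s = count_type n \<alpha>")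
    case True
    have cnt: "card {C \<in> Os. card C - 1 = i} = Poly_Mapping.lookup (count_type n \<alpha>) i" for i
      using cntO True by simp
    have "card W = (\<Prod>i\<in>Poly_Mapping.keys (count_type n \<alpha>). fact (card {C \<in> Os. card C - 1 = i}))"
      unfolding W_def
    proof (rule card_fibre_bijections)
      show "card {C \<in> Os. card C - 1 = i} = card {c \<in> {1..n}. \<alpha> c = i}" for i
        unfolding cnt lookup_count_type ..
      show "(\<lambda>C. card C - 1) ` Os \<subseteq> Poly_Mapping.keys (count_type n \<alpha>)"
      proof
        fix i assume "i \<in> (\<lambda>C. card C - 1) ` Os"
        then have "{C \<in> Os. card C - 1 = i} \<noteq> {}" by auto
        then have "card {C \<in> Os. card C - 1 = i} \<noteq> 0" using finOs by simp
        then show "i \<in> Poly_Mapping.keys (count_type n \<alpha>)" unfolding cnt by (simp add: in_keys_iff)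
      qed
    qed (use finOs in auto)
    then show ?thesis using True unfolding cnt by simp
  next
    case False
    have "W = {}"
    proof (rule ccontr)
      assume "W \<noteq> {}"
      then obtain \<phi> where bij: "bij_betw \<phi> Os {1..n}" and \<alpha>: "\<And>C. C \<in> Os \<Longrightarrow> \<alpha> (\<phi> C) = card C - 1"
        by (auto simp: W_def)
      have "card {C \<in> Os. card C - 1 = i} = card {c \<in> {1..n}. \<alpha> c = i}" for i
        by (rule bij_betw_same_card, rule bij_betw_Collect[OF bij]) (simp add: \<alpha>)
      then have "\<forall>i. Poly_Mapping.lookup (cycle_type ?A s) i = card {c \<in> {1..n}. \<alpha> c = i}"
        unfolding cntO by (rule allI)
      then show False using False unfolding eq_count_type_iff by (rule notE[rotated])
    qed
    then show ?thesis using False by simp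
  qed
  finally show ?thesis by (simp add: LL_def)
qed

section \<open>The volume polynomial and the uniqueness of its coefficients\<close>

lemma finite_exponents: "finite (exponents g n)"
proof (rule finite_subset)
  show "exponents g n \<subseteq> {1..n} \<rightarrow>\<^sub>E {..4 * g + n}"
  proof
    fix \<alpha> assume a: "\<alpha> \<in> exponents g n"
    then have s: "int (\<Sum>i=1..n. \<alpha> i) = 4 * int g - 2 + int n" and e: "\<alpha> \<in> {1..n} \<rightarrow>\<^sub>E UNIV" by (auto simp: exponents_def)
    have "\<alpha> i \<le> 4 * g + n" if "i \<in> {1..n}" for i
    proof -
      have "\<alpha> i \<le> (\<Sum>i=1..n. \<alpha> i)" using that by (intro member_le_sum) auto
      then show ?thesis using s by linarith
    qed
    then show "\<alpha> \<in> {1..n} \<rightarrow>\<^sub>E {..4 * g + n}" using e by (auto simp: PiE_iff)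
  qed
qed (auto intro!: finite_PiE)

text \<open>The coefficient that the count of keys yields: pairs of the right type times their
  labellings, over \<open>N!\<close> for the numberings of the edges and over the factorials of the
  simplex volumes. The value 0 off \<open>exponents g n\<close> is what \<open>Vo_coeff\<close>
  prescribes.\<close>

definition vol_coeff :: "nat \<Rightarrow> nat \<Rightarrow> (nat \<Rightarrow> nat) \<Rightarrow> real" where
  "vol_coeff g n \<alpha> = (if \<alpha> \<in> exponents g n then
     real (pair_count (2 * g + n - 1) (count_type n \<alpha>)) *
       (\<Prod>i\<in>Poly_Mapping.keys (count_type n \<alpha>). fact (Poly_Mapping.lookup (count_type n \<alpha>) i)) /
       (fact (2 * (2 * g + n - 1)) * (\<Prod>c\<in>{1..n}. fact (\<alpha> c))) else 0)"

text \<open>The \<open>N\<close> edges fall into \<open>n\<close> non-empty blocks, so the block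
  sizes minus one add up to \<open>N - n = 4 g - 2 + n\<close>, the degree of the
  polynomial.\<close>

lemma labellings_exponents:
  assumes adm: "1 \<le> n" "2 \<le> 2 * g + n" and l: "l \<in> labellings N n s" and N: "N = 2 * (2 * g + n - 1)"
  shows "(\<lambda>c\<in>{1..n}. card {i \<in> {..<N}. l i = c} - 1) \<in> exponents g n"
    and "\<And>c. c \<in> {1..n} \<Longrightarrow> 0 < card {i \<in> {..<N}. l i = c}"
proof -
  show pos: "0 < card {i \<in> {..<N}. l i = c}" if "c \<in> {1..n}" for c
  proof -
    have "c \<in> l ` {..<N}" using l that by (simp add: labellings_def)
    then show ?thesis by (auto simp: card_gt_0_iff)
  qed
  have "N = (\<Sum>c\<in>{1..n}. \<Sum>i | i \<in> {..<N} \<and> l i = c. 1)"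
    using l by (subst sum.group) (auto simp: labellings_def)
  also have "\<dots> = (\<Sum>c\<in>{1..n}. (card {i \<in> {..<N}. l i = c} - 1) + 1)"
    using pos by (intro sum.cong) auto
  also have "\<dots> = (\<Sum>c\<in>{1..n}. card {i \<in> {..<N}. l i = c} - 1) + n" unfolding sum.distrib by simp
  finally have "int (\<Sum>c\<in>{1..n}. card {i \<in> {..<N}. l i = c} - 1) = 4 * int g - 2 + int n"
    using adm N by linarith
  then show "(\<lambda>c\<in>{1..n}. card {i \<in> {..<N}. l i = c} - 1) \<in> exponents g n"
    by (simp add: exponents_def)
qed

lemma Vo_polynomial:
  assumes adm: "admissible g n" and L: "\<And>c. c \<in> {1..n} \<Longrightarrow> 0 < L c"
  shows "Vo g n L = (\<Sum>\<alpha>\<in>exponents g n. vol_coeff g n \<alpha> * (\<Prod>c=1..n. L c ^ \<alpha> c))"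
proof -
  have a: "1 \<le> n" "2 \<le> 2 * g + n" using adm by (auto simp: admissible_def)
  define N where "N = 2 * (2 * g + n - 1)"
  let ?E = "exponents g n"
  let ?mon = "\<lambda>\<alpha>. \<Prod>c\<in>{1..n}. L c ^ \<alpha> c / fact (\<alpha> c)"
  let ?ex = "\<lambda>l. \<lambda>c\<in>{1..n}. card {i \<in> {..<N}. l i = c} - 1"
  let ?lab = "\<lambda>s \<alpha>. {l \<in> labellings N n s. \<forall>c\<in>{1..n}. card {i \<in> {..<N}. l i = c} = Suc (\<alpha> c)}"
  have finlab: "finite (labellings N n s)" for s
    by (rule finite_subset[of _ "{..<N} \<rightarrow>\<^sub>E {1..n}"]) (auto simp: labellings_def intro!: finite_PiE)
  \<comment> \<open>The weight of a labelling depends only on its block sizes. Grouped by exponent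
    vector, the labellings contribute their number times one monomial with factorial
    denominators.\<close>
  have inner: "(\<Sum>l\<in>labellings N n s. weight N n L l) = (\<Sum>\<alpha>\<in>?E. real (card (?lab s \<alpha>)) * ?mon \<alpha>)" for s
  proof -
    have "(\<Sum>l\<in>labellings N n s. weight N n L l) = (\<Sum>\<alpha>\<in>?E. \<Sum>l | l \<in> labellings N n s \<and> ?ex l = \<alpha>. weight N n L l)"
      using labellings_exponents(1)[OF a _ N_def] finlab finite_exponents by (intro sum.group[symmetric]) auto
    also have "\<dots> = (\<Sum>\<alpha>\<in>?E. real (card (?lab s \<alpha>)) * ?mon \<alpha>)"
    proof (intro sum.cong refl)
      fix \<alpha> assume \<alpha>: "\<alpha> \<in> ?E"
      have "(?ex l = \<alpha>) \<longleftrightarrow> (\<forall>c\<in>{1..n}. card {i \<in> {..<N}. l i = c} = Suc (\<alpha> c))" if l: "l \<in> labellings N n s" for l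
      proof
        assume e: "?ex l = \<alpha>"
        show "\<forall>c\<in>{1..n}. card {i \<in> {..<N}. l i = c} = Suc (\<alpha> c)"
        proof
          fix c assume c: "c \<in> {1..n}"
          show "card {i \<in> {..<N}. l i = c} = Suc (\<alpha> c)"
            using fun_cong[OF e, of c] c labellings_exponents(2)[OF a l N_def c] by simp
        qed
      next
        assume "\<forall>c\<in>{1..n}. card {i \<in> {..<N}. l i = c} = Suc (\<alpha> c)"
        then show "?ex l = \<alpha>" using \<alpha> by (auto simp: exponents_def fun_eq_iff PiE_iff extensional_def)
      qed
      then have "{l. l \<in> labellings N n s \<and> ?ex l = \<alpha>} = ?lab s \<alpha>" by blast
      moreover have "weight N n L l = ?mon \<alpha>" if "l \<in> ?lab s \<alpha>" for l
        using that unfolding weight_def by (intro prod.cong) auto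
      ultimately show "(\<Sum>l | l \<in> labellings N n s \<and> ?ex l = \<alpha>. weight N n L l) = real (card (?lab s \<alpha>)) * ?mon \<alpha>"
        by (simp cong: sum.cong_simp)
    qed
    finally show ?thesis .
  qed
  have keys: "all_keys N n = (SIGMA t:full_cycles {..<N}. SIGMA r:matchings {..<N}. labellings N n (inv t \<circ> r))"
    by (auto simp: all_keys_def)
  have "Vo g n L = (\<Sum>(t, r, l)\<in>all_keys N n. weight N n L l) / fact N"
    unfolding Vo_def N_def using a L by (intro V_eq_sum_keys) auto
  also have "(\<Sum>(t, r, l)\<in>all_keys N n. weight N n L l)
      = (\<Sum>t\<in>full_cycles {..<N}. \<Sum>r\<in>matchings {..<N}. \<Sum>l\<in>labellings N n (inv t \<circ> r). weight N n L l)"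
    unfolding keys using finlab
    by (simp add: sum.Sigma[symmetric] finite_full_cycles finite_matchings split_def[symmetric])
  also have "\<dots> = (\<Sum>t\<in>full_cycles {..<N}. \<Sum>r\<in>matchings {..<N}. \<Sum>\<alpha>\<in>?E. real (card (?lab (inv t \<circ> r) \<alpha>)) * ?mon \<alpha>)"
    by (simp only: inner)
  also have "\<dots> = (\<Sum>\<alpha>\<in>?E. (\<Sum>t\<in>full_cycles {..<N}. \<Sum>r\<in>matchings {..<N}. real (card (?lab (inv t \<circ> r) \<alpha>))) * ?mon \<alpha>)"
    by (simp add: sum_distrib_right sum.swap[of _ ?E])
  also have "\<dots> = (\<Sum>\<alpha>\<in>?E. fact N * (vol_coeff g n \<alpha> * (\<Prod>c=1..n. L c ^ \<alpha> c)))"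
  proof (intro sum.cong refl)
    fix \<alpha> assume \<alpha>: "\<alpha> \<in> ?E"
    let ?P = "\<Prod>i\<in>Poly_Mapping.keys (count_type n \<alpha>). fact (Poly_Mapping.lookup (count_type n \<alpha>) i) :: nat"
    have "(\<Sum>t\<in>full_cycles {..<N}. \<Sum>r\<in>matchings {..<N}. card (?lab (inv t \<circ> r) \<alpha>))
      = (\<Sum>t\<in>full_cycles {..<N}. \<Sum>r\<in>matchings {..<N}. of_bool (cycle_type {..<N} (inv t \<circ> r) = count_type n \<alpha>) * ?P)"
      by (intro sum.cong refl card_labellings pair_permutes)
    also have "\<dots> = pair_count (2 * g + n - 1) (count_type n \<alpha>) * ?P"
      by (simp only: pair_count_def sum_distrib_right N_def)
    finally have "(\<Sum>t\<in>full_cycles {..<N}. \<Sum>r\<in>matchings {..<N}. real (card (?lab (inv t \<circ> r) \<alpha>)))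
      = real (pair_count (2 * g + n - 1) (count_type n \<alpha>) * ?P)"
      by (metis (no_types, lifting) of_nat_sum sum.cong)
    then show "(\<Sum>t\<in>full_cycles {..<N}. \<Sum>r\<in>matchings {..<N}. real (card (?lab (inv t \<circ> r) \<alpha>))) * ?mon \<alpha>
      = fact N * (vol_coeff g n \<alpha> * (\<Prod>c=1..n. L c ^ \<alpha> c))"
      using \<alpha> by (simp add: vol_coeff_def N_def prod_dividef)
  qed
  also have "\<dots> / fact N = (\<Sum>\<alpha>\<in>?E. vol_coeff g n \<alpha> * (\<Prod>c=1..n. L c ^ \<alpha> c))"
    by (simp flip: sum_distrib_left)
  finally show ?thesis .
qed

text \<open>The uniqueness behind the definite description \<open>Vo_coeff\<close>. For fixed
  positive values of the other variables the sum is a polynomial in \<open>L i\<close> that vanishes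
  on all positive reals, so its coefficients vanish; these are sums of the same kind in fewer
  variables.\<close>

lemma polynomial_zero_on_positive:
  fixes c :: "('i \<Rightarrow> nat) \<Rightarrow> real"
  assumes "finite I" "finite A" "A \<subseteq> I \<rightarrow>\<^sub>E UNIV"
    and "\<And>L. (\<forall>i\<in>I. 0 < L i) \<Longrightarrow> (\<Sum>\<alpha>\<in>A. c \<alpha> * (\<Prod>i\<in>I. L i ^ \<alpha> i)) = 0"
    and "\<alpha> \<in> A"
  shows "c \<alpha> = 0"
  using assms
proof (induction I arbitrary: A c \<alpha> rule: finite_induct)
  case empty
  then have "A = {\<alpha>}" by auto
  then show ?case using empty.prems(3)[of "\<lambda>_. 1"] by simp
next
  case (insert i I)
  define A' where "A' = (\<lambda>k. {\<beta> \<in> A. \<beta> i = k})"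
  define K where "K = Max ((\<lambda>\<beta>. \<beta> i) ` A)"
  have K: "\<beta> i \<le> K" if "\<beta> \<in> A" for \<beta> using that insert.prems(1) by (simp add: K_def)
  have zero: "(\<Sum>\<beta>\<in>A' k. c \<beta> * (\<Prod>j\<in>I. L j ^ \<beta> j)) = 0" if L: "\<forall>j\<in>I. 0 < L j" and k: "k \<le> K" for L k
  proof (rule ccontr)
    define p where "p = (\<lambda>k. \<Sum>\<beta>\<in>A' k. c \<beta> * (\<Prod>j\<in>I. L j ^ \<beta> j))"
    assume "(\<Sum>\<beta>\<in>A' k. c \<beta> * (\<Prod>j\<in>I. L j ^ \<beta> j)) \<noteq> 0"
    then have "\<exists>k\<le>K. p k \<noteq> 0" using k by (auto simp: p_def)
    then have fin: "finite {x. (\<Sum>k\<le>K. p k * x ^ k) = 0}" by (simp add: polyfun_finite_roots)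
    have "(\<Sum>k\<le>K. p k * x ^ k) = 0" if x: "0 < x" for x
    proof -
      have "(\<Sum>k\<le>K. p k * x ^ k) = (\<Sum>k\<le>K. \<Sum>\<beta>\<in>A' k. c \<beta> * (\<Prod>j\<in>I. L j ^ \<beta> j) * x ^ \<beta> i)"
        by (simp add: p_def sum_distrib_right A'_def)
      also have "\<dots> = (\<Sum>\<beta>\<in>A. c \<beta> * (\<Prod>j\<in>I. L j ^ \<beta> j) * x ^ \<beta> i)"
        unfolding A'_def using insert.prems(1) K by (intro sum.group) auto
      also have "\<dots> = (\<Sum>\<beta>\<in>A. c \<beta> * (\<Prod>j\<in>insert i I. (L(i := x)) j ^ \<beta> j))"
      proof (intro sum.cong refl)
        fix \<beta>
        have "(\<Prod>j\<in>I. (L(i := x)) j ^ \<beta> j) = (\<Prod>j\<in>I. L j ^ \<beta> j)"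
          using insert.hyps(2) by (intro prod.cong) auto
        then show "c \<beta> * (\<Prod>j\<in>I. L j ^ \<beta> j) * x ^ \<beta> i = c \<beta> * (\<Prod>j\<in>insert i I. (L(i := x)) j ^ \<beta> j)"
          using insert.hyps by simp
      qed
      also have "\<dots> = 0" using L x by (intro insert.prems(3)) auto
      finally show ?thesis .
    qed
    then have "{0<..} \<subseteq> {x. (\<Sum>k\<le>K. p k * x ^ k) = 0}" by auto
    then show False using fin infinite_Ioi finite_subset by blast
  qed
  define k where "k = \<alpha> i"
  define B where "B = (\<lambda>\<beta>. restrict \<beta> I) ` A' k"
  have res: "(restrict \<beta> I)(i := k) = \<beta>" if "\<beta> \<in> A' k" for \<beta>
    using that insert.prems(2) by (auto simp: A'_def fun_eq_iff PiE_iff extensional_def)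
  have inj: "inj_on (\<lambda>\<beta>. restrict \<beta> I) (A' k)" by (rule inj_onI) (metis res)
  have "c ((restrict \<alpha> I)(i := k)) = 0"
  proof (rule insert.IH[of B "\<lambda>\<beta>. c (\<beta>(i := k))"])
    show "finite B" using insert.prems(1) by (simp add: B_def A'_def)
    show "B \<subseteq> I \<rightarrow>\<^sub>E UNIV" by (auto simp: B_def)
    show "restrict \<alpha> I \<in> B" using insert.prems(4) by (auto simp: B_def A'_def k_def)
    fix L :: "'i \<Rightarrow> real" assume L: "\<forall>j\<in>I. 0 < L j"
    have "(\<Sum>\<beta>\<in>B. c (\<beta>(i := k)) * (\<Prod>j\<in>I. L j ^ \<beta> j)) = (\<Sum>\<beta>\<in>A' k. c \<beta> * (\<Prod>j\<in>I. L j ^ \<beta> j))"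
      unfolding B_def sum.reindex[OF inj] by (intro sum.cong refl) (simp add: res)
    also have "\<dots> = 0" using zero[OF L] K[OF insert.prems(4)] by (simp add: k_def)
    finally show "(\<Sum>\<beta>\<in>B. c (\<beta>(i := k)) * (\<Prod>j\<in>I. L j ^ \<beta> j)) = 0" .
  qed
  then show ?case using res[of \<alpha>] insert.prems(4) by (simp add: A'_def k_def)
qed

lemma Vo_coeff_eq:
  assumes adm: "admissible g n"
  shows "Vo_coeff g n = vol_coeff g n"
  unfolding Vo_coeff_def
proof (rule the_equality)
  show "(\<forall>\<alpha>. \<alpha> \<notin> exponents g n \<longrightarrow> vol_coeff g n \<alpha> = 0) \<and>
        (\<forall>L. (\<forall>i\<in>{1..n}. L i > 0) \<longrightarrow>
           Vo g n L = (\<Sum>\<alpha>\<in>exponents g n. vol_coeff g n \<alpha> * (\<Prod>i=1..n. L i ^ \<alpha> i)))"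
    using Vo_polynomial[OF adm] by (simp add: vol_coeff_def)
next
  fix c assume c: "(\<forall>\<alpha>. \<alpha> \<notin> exponents g n \<longrightarrow> c \<alpha> = 0) \<and>
        (\<forall>L. (\<forall>i\<in>{1..n}. L i > 0) \<longrightarrow>
           Vo g n L = (\<Sum>\<alpha>\<in>exponents g n. c \<alpha> * (\<Prod>i=1..n. L i ^ \<alpha> i)))"
  show "c = vol_coeff g n"
  proof
    fix \<alpha> show "c \<alpha> = vol_coeff g n \<alpha>"
    proof (cases "\<alpha> \<in> exponents g n")
      case True
      have "c \<alpha> - vol_coeff g n \<alpha> = 0"
      proof (rule polynomial_zero_on_positive[where I = "{1..n}" and A = "exponents g n" and c = "\<lambda>\<alpha>. c \<alpha> - vol_coeff g n \<alpha>"])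
        fix L :: "nat \<Rightarrow> real" assume L: "\<forall>i\<in>{1..n}. 0 < L i"
        then have "(\<Sum>\<alpha>\<in>exponents g n. c \<alpha> * (\<Prod>i=1..n. L i ^ \<alpha> i))
          = (\<Sum>\<alpha>\<in>exponents g n. vol_coeff g n \<alpha> * (\<Prod>i=1..n. L i ^ \<alpha> i))"
          using c Vo_polynomial[OF adm, of L] by simp
        then show "(\<Sum>\<alpha>\<in>exponents g n. (c \<alpha> - vol_coeff g n \<alpha>) * (\<Prod>i\<in>{1..n}. L i ^ \<alpha> i)) = 0"
          by (simp add: left_diff_distrib sum_subtractf)
      qed (use True finite_exponents in \<open>auto simp: exponents_def\<close>)
      then show ?thesis by simp
    next
      case False
      then show ?thesis using c by (simp add: vol_coeff_def)
    qed
  qed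
qed

section \<open>The series in terms of the numbers of pairs\<close>

lemma arises_count_type: "arises \<mu> g n \<alpha> \<Longrightarrow> \<mu> = count_type n \<alpha>"
  by (simp add: arises_def eq_count_type_iff)

text \<open>The degree \<open>4 g - 2 + n\<close> and the number \<open>n\<close> of variables add
  up to twice \<open>2 g + n - 1\<close>, the number of vertices. So the power of \<open>q\<close>
  counts vertices, and it is at least 1.\<close>

lemma arises_size:
  assumes "arises \<mu> g n \<alpha>"
  shows "d_mu \<mu> + n_mu \<mu> = 2 * (2 * g + n - 1)" "1 \<le> 2 * g + n - 1"
proof -
  have adm: "1 \<le> n" "2 \<le> 2 * g + n" and s: "int (\<Sum>i=1..n. \<alpha> i) = 4 * int g - 2 + int n"
    using assms by (auto simp: arises_def admissible_def exponents_def)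
  have "d_mu \<mu> = (\<Sum>i=1..n. \<alpha> i)" "n_mu \<mu> = n"
    unfolding arises_count_type[OF assms] count_type_def d_mu_sum_single n_mu_sum_single by simp_all
  then show "d_mu \<mu> + n_mu \<mu> = 2 * (2 * g + n - 1)" using s adm by linarith
  show "1 \<le> 2 * g + n - 1" using adm by simp
qed

lemma prod_fact_count_type:
  "(\<Prod>c\<in>{1..n}. fact (\<alpha> c) :: real) =
    (\<Prod>i\<in>Poly_Mapping.keys (count_type n \<alpha>). fact i ^ Poly_Mapping.lookup (count_type n \<alpha>) i)"
proof -
  have "(\<Prod>c\<in>{1..n}. fact (\<alpha> c) :: real)
      = (\<Prod>i\<in>Poly_Mapping.keys (count_type n \<alpha>). \<Prod>c | c \<in> {1..n} \<and> \<alpha> c = i. fact (\<alpha> c))"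
  proof (rule prod.group[symmetric])
    show "\<alpha> ` {1..n} \<subseteq> Poly_Mapping.keys (count_type n \<alpha>)"
    proof
      fix i assume "i \<in> \<alpha> ` {1..n}"
      then have "{c \<in> {1..n}. \<alpha> c = i} \<noteq> {}" by blast
      then have "card {c \<in> {1..n}. \<alpha> c = i} \<noteq> 0" by (simp only: card_eq_0_iff) simp
      then show "i \<in> Poly_Mapping.keys (count_type n \<alpha>)" by (simp only: in_keys_iff lookup_count_type not_False_eq_True)
    qed
  qed auto
  also have "\<dots> = (\<Prod>i\<in>Poly_Mapping.keys (count_type n \<alpha>). fact i ^ Poly_Mapping.lookup (count_type n \<alpha>) i)"
    unfolding lookup_count_type by (intro prod.cong refl) simp
  finally show ?thesis .
qed

text \<open>This matches the convention that \<open>c_mu\<close> is 0 where \<open>\<mu>\<close>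
  does not arise: a cycle type that occurs does belong to some \<open>g\<close> and
  \<open>n\<close>. The genus is supplied by \<open>pair_count_genus\<close>, the exponent vector by
  numbering the cycles.\<close>

lemma pair_count_arises:
  assumes k: "1 \<le> k" and nz: "pair_count k \<mu> \<noteq> 0"
  shows "\<exists>g n \<alpha>. arises \<mu> g n \<alpha>"
proof -
  obtain s where s: "s permutes {..<2 * k}" "cycle_type {..<2 * k} s = \<mu>" using nz by (rule pair_count_witness)
  obtain g where g: "k + 1 = n_mu \<mu> + 2 * g" using pair_count_genus[OF k nz] by blast
  define n where "n = n_mu \<mu>"
  define Os where "Os = orbit s ` {..<2 * k}"
  have finOs: "finite Os" by (simp add: Os_def)
  have \<mu>: "\<mu> = (\<Sum>C\<in>Os. Poly_Mapping.single (card C - 1) 1)"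
    using s(2) by (simp add: cycle_type_def Os_def)
  have cO: "card Os = n" unfolding n_def \<mu> n_mu_sum_single ..
  then obtain h where h: "bij_betw h {1..n} Os" using ex_bij_betw_nat_finite_1[OF finOs] by blast
  define \<alpha> where "\<alpha> = (\<lambda>c\<in>{1..n}. card (h c) - 1)"
  have "\<mu> = (\<Sum>c\<in>{1..n}. Poly_Mapping.single (card (h c) - 1) 1)"
    unfolding \<mu> by (rule sum.reindex_bij_betw[OF h, symmetric])
  also have "\<dots> = count_type n \<alpha>" unfolding count_type_def by (intro sum.cong) (auto simp: \<alpha>_def)
  finally have ct: "\<mu> = count_type n \<alpha>" .
  have d: "d_mu \<mu> + n = 2 * k" using pair_count_size[OF nz] by (simp add: n_def)
  have sum: "d_mu \<mu> = (\<Sum>i=1..n. \<alpha> i)" unfolding ct count_type_def d_mu_sum_single ..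
  have "0 < n"
  proof (rule ccontr)
    assume "\<not> 0 < n"
    then show False using d sum k by simp
  qed
  then have "admissible g n" using g k by (simp add: admissible_def n_def)
  moreover have "\<alpha> \<in> exponents g n"
  proof -
    have "int (\<Sum>i=1..n. \<alpha> i) = 4 * int g - 2 + int n" using d g sum unfolding n_def[symmetric] by linarith
    then show ?thesis by (simp add: exponents_def \<alpha>_def)
  qed
  ultimately have "arises \<mu> g n \<alpha>" using ct by (simp add: arises_def eq_count_type_iff)
  then show ?thesis by blast
qed

text \<open>The factors of the series cancel those of \<open>vol_coeff\<close>, leaving the
  factorial for numberings. The formula fails at \<open>q ^ 0\<close>: on zero points the identity
  pair counts once for type 0, while \<open>Zo 0\<close> vanishes.\<close>

lemma Zo_Suc: "Zo (Suc k) \<mu> = real (pair_count (Suc k) \<mu>) / fact (2 * Suc k)"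
proof (cases "\<exists>g n \<alpha>. arises \<mu> g n \<alpha>")
  case True
  obtain g n \<alpha> where gna: "(SOME (g, n, \<alpha>). arises \<mu> g n \<alpha>) = (g, n, \<alpha>)" by (metis prod_cases3)
  have ar: "arises \<mu> g n \<alpha>"
    using someI_ex[of "\<lambda>(g, n, \<alpha>). arises \<mu> g n \<alpha>"] True by (simp add: gna)
  have adm: "admissible g n" and ex: "\<alpha> \<in> exponents g n" using ar by (auto simp: arises_def)
  have c: "c_mu \<mu> = vol_coeff g n \<alpha>"
    using True by (simp add: c_mu_def gna Vo_coeff_eq[OF adm])
  note ct = arises_count_type[OF ar]
  show ?thesis
  proof (cases "2 * Suc k = d_mu \<mu> + n_mu \<mu>")
    case eq: True
    then have k: "2 * g + n - 1 = Suc k" using arises_size[OF ar] by simp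
    let ?F = "\<Prod>i\<in>Poly_Mapping.keys \<mu>. fact (Poly_Mapping.lookup \<mu> i) :: real"
    let ?G = "\<Prod>i\<in>Poly_Mapping.keys \<mu>. fact i ^ Poly_Mapping.lookup \<mu> i :: real"
    have nz: "?F \<noteq> 0" "?G \<noteq> 0" by simp_all
    have "c_mu \<mu> = real (pair_count (Suc k) \<mu>) * ?F / (fact (2 * Suc k) * ?G)"
      unfolding c vol_coeff_def if_P[OF ex] k prod_fact_count_type ct[symmetric] ..
    then show ?thesis unfolding Zo_def if_P[OF eq] using nz by simp
  next
    case False
    then have "pair_count (Suc k) \<mu> = 0" using pair_count_size[of "Suc k" \<mu>] by auto
    then show ?thesis using False by (simp add: Zo_def)
  qed
next
  case False
  then have "pair_count (Suc k) \<mu> = 0" using pair_count_arises[of "Suc k" \<mu>] by auto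
  then show ?thesis using False by (simp add: Zo_def c_mu_def)
qed

lemma Zo_0: "Zo 0 = (\<lambda>\<mu>. 0)"
proof
  fix \<mu> show "Zo 0 \<mu> = 0"
  proof (cases "\<exists>g n \<alpha>. arises \<mu> g n \<alpha>")
    case True
    then obtain g n \<alpha> where "arises \<mu> g n \<alpha>" by blast
    then have "d_mu \<mu> + n_mu \<mu> \<noteq> 0" using arises_size by fastforce
    then show ?thesis by (auto simp: Zo_def)
  qed (simp add: Zo_def c_mu_def)
qed

section \<open>The differential equation, coefficient by coefficient\<close>

abbreviation (input) "e1 i \<equiv> Poly_Mapping.single i (1::nat)"

lemma lookup_e1: "Poly_Mapping.lookup (e1 i) j = (if i = j then 1 else 0)"
    "Poly_Mapping.lookup (Poly_Mapping.single i (Suc 0)) j = (if i = j then 1 else 0)"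
  by (simp_all add: lookup_single when_def)

lemma minus_single_plus: "Poly_Mapping.lookup \<mu> i \<noteq> 0 \<Longrightarrow> \<mu> = (\<mu> - e1 i) + e1 i" for \<mu> :: "nat \<Rightarrow>\<^sub>0 nat"
  by (rule poly_mapping_eqI) (auto simp: lookup_add lookup_minus lookup_e1)

text \<open>The effect on the monomial with exponents \<open>\<nu>\<close>: differentiation brings
  down \<open>\<nu> m\<close>, and the new exponents are given by an equation between sums, which
  avoids truncated subtraction and matches \<open>split_ways\<close>. The indicator is constant in
  \<open>k\<close> because these operators do not touch the power of \<open>q\<close>.\<close>

lemma times_t_times_t_d_t_indicator:
  fixes \<nu> \<mu> :: "nat \<Rightarrow>\<^sub>0 nat"
  shows "times_t i (times_t j (d_t m (\<lambda>k \<mu>. of_bool (\<nu> = \<mu>)))) k \<mu>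
    = real (Poly_Mapping.lookup \<nu> m * of_bool (\<mu> + e1 m = \<nu> + e1 i + e1 j))"
proof (cases "Poly_Mapping.lookup \<mu> i \<noteq> 0 \<and> Poly_Mapping.lookup (\<mu> - e1 i) j \<noteq> 0")
  case True
  define \<kappa> where "\<kappa> = \<mu> - e1 i - e1 j"
  have "\<mu> = \<kappa> + e1 j + e1 i"
    using minus_single_plus[of \<mu> i] minus_single_plus[of "\<mu> - e1 i" j] True by (simp add: \<kappa>_def)
  then have "\<mu> + e1 m = \<nu> + e1 i + e1 j \<longleftrightarrow> (\<kappa> + e1 m) + (e1 i + e1 j) = \<nu> + (e1 i + e1 j)"
    by (simp add: ac_simps)
  then have iff: "\<mu> + e1 m = \<nu> + e1 i + e1 j \<longleftrightarrow> \<nu> = \<kappa> + e1 m" by auto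
  have "times_t i (times_t j (d_t m (\<lambda>k \<mu>. of_bool (\<nu> = \<mu>)))) k \<mu>
      = real (Poly_Mapping.lookup \<kappa> m + 1) * of_bool (\<nu> = \<kappa> + e1 m)"
    using True by (simp add: times_t_def d_t_def \<kappa>_def)
  also have "\<dots> = real (Poly_Mapping.lookup \<nu> m * of_bool (\<nu> = \<kappa> + e1 m))"
    by (auto simp: lookup_add lookup_e1)
  finally show ?thesis unfolding iff .
next
  case False
  \<comment> \<open>The left side is 0 because \<open>t_i t_j\<close> does not divide the monomial
    of \<open>\<mu>\<close>. On the right, \<open>\<nu> m \<noteq> 0\<close> allows
    \<open>e1 m\<close> to be cancelled from the equation, which would force this
    divisibility.\<close>
  have "Poly_Mapping.lookup \<nu> m * of_bool (\<mu> + e1 m = \<nu> + e1 i + e1 j) = 0"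
  proof (rule ccontr)
    assume "\<not> ?thesis"
    then have nz: "Poly_Mapping.lookup \<nu> m \<noteq> 0" and eq: "\<mu> + e1 m = \<nu> + e1 i + e1 j" by (auto split: if_splits)
    have "\<mu> + e1 m = ((\<nu> - e1 m) + e1 m) + e1 i + e1 j" using eq minus_single_plus[OF nz] by simp
    then have "\<mu> + e1 m = (\<nu> - e1 m + e1 j + e1 i) + e1 m" by (simp add: ac_simps)
    then have "\<mu> = \<nu> - e1 m + e1 j + e1 i" by (rule add_right_imp_eq)
    then show False using False by (simp add: lookup_add lookup_e1)
  qed
  then show ?thesis using False by (auto simp: times_t_def)
qed

text \<open>The second derivative brings down \<open>\<nu> i * \<nu> j\<close> for distinct indices
  and \<open>\<nu> i * (\<nu> i - 1)\<close> for equal ones: the number of ordered pairs of distinct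
  cycles of indices \<open>i\<close> and \<open>j\<close>, as in \<open>join_ways\<close>.\<close>

lemma times_t_d_t_d_t_indicator:
  fixes \<nu> \<mu> :: "nat \<Rightarrow>\<^sub>0 nat"
  shows "times_t m (d_t i (d_t j (\<lambda>k \<mu>. of_bool (\<nu> = \<mu>)))) k \<mu>
    = real ((Poly_Mapping.lookup \<nu> i * (Poly_Mapping.lookup \<nu> j - of_bool (j = i))) * of_bool (\<mu> + e1 i + e1 j = \<nu> + e1 m))"
proof (cases "Poly_Mapping.lookup \<mu> m \<noteq> 0")
  case True
  define \<kappa> where "\<kappa> = \<mu> - e1 m"
  have "\<mu> = \<kappa> + e1 m" using minus_single_plus[OF True] by (simp add: \<kappa>_def)
  then have "\<mu> + e1 i + e1 j = \<nu> + e1 m \<longleftrightarrow> (\<kappa> + e1 i + e1 j) + e1 m = \<nu> + e1 m" by (simp add: ac_simps)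
  then have iff: "\<mu> + e1 i + e1 j = \<nu> + e1 m \<longleftrightarrow> \<nu> = \<kappa> + e1 i + e1 j" by auto
  have "times_t m (d_t i (d_t j (\<lambda>k \<mu>. of_bool (\<nu> = \<mu>)))) k \<mu>
      = real (Poly_Mapping.lookup \<kappa> i + 1) * (real (Poly_Mapping.lookup (\<kappa> + e1 i) j + 1) * of_bool (\<nu> = \<kappa> + e1 i + e1 j))"
    using True by (simp add: times_t_def d_t_def \<kappa>_def)
  also have "\<dots> = real ((Poly_Mapping.lookup \<nu> i * (Poly_Mapping.lookup \<nu> j - of_bool (j = i))) * of_bool (\<nu> = \<kappa> + e1 i + e1 j))"
    by (auto simp: lookup_add lookup_e1 algebra_simps)
  finally show ?thesis unfolding iff .
next
  case False
  have "(Poly_Mapping.lookup \<nu> i * (Poly_Mapping.lookup \<nu> j - of_bool (j = i))) * of_bool (\<mu> + e1 i + e1 j = \<nu> + e1 m) = 0"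
  proof (rule ccontr)
    assume "\<not> ?thesis"
    then have nz: "Poly_Mapping.lookup \<nu> i \<noteq> 0" "Poly_Mapping.lookup \<nu> j - of_bool (j = i) \<noteq> 0"
      and eq: "\<mu> + e1 i + e1 j = \<nu> + e1 m" by (auto split: if_splits)
    have nz2: "Poly_Mapping.lookup (\<nu> - e1 i) j \<noteq> 0" using nz(2) by (auto simp: lookup_minus lookup_e1 split: if_splits)
    have "\<nu> = (\<nu> - e1 i - e1 j) + e1 j + e1 i" using minus_single_plus[OF nz(1)] minus_single_plus[OF nz2] by simp
    then have "\<mu> + e1 i + e1 j = ((\<nu> - e1 i - e1 j) + e1 j + e1 i) + e1 m" using eq by simp
    then have "\<mu> + (e1 i + e1 j) = (\<nu> - e1 i - e1 j + e1 m) + (e1 i + e1 j)" by (simp add: ac_simps)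
    then have "\<mu> = \<nu> - e1 i - e1 j + e1 m" by (rule add_right_imp_eq)
    then show False using False by (simp add: lookup_add lookup_e1)
  qed
  then show ?thesis using False by (auto simp: times_t_def)
qed

lemma lookup_cycle_type_large:
  assumes s: "s permutes {..<N}" and i: "N \<le> i"
  shows "Poly_Mapping.lookup (cycle_type {..<N} s) i = 0"
proof -
  have "{x \<in> {..<N}. card (orbit s x) = Suc i} = {}"
  proof (rule ccontr)
    assume "{x \<in> {..<N}. card (orbit s x) = Suc i} \<noteq> {}"
    then obtain x where x: "x < N" "card (orbit s x) = Suc i" by blast
    then show False using card_mono[OF _ permutes_orbit_subset[OF s, of x]] i by simp
  qed
  moreover have "card {x \<in> {..<N}. card (orbit s x) = Suc i} = Suc i * Poly_Mapping.lookup (cycle_type {..<N} s) i"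
    by (rule card_points_in_cycles[OF _ s]) simp
  ultimately have "Suc i * Poly_Mapping.lookup (cycle_type {..<N} s) i = 0" by (simp only: card.empty)
  then show ?thesis by simp
qed

text \<open>A pair with \<open>i + j = m + 1\<close> stands for a cycle of index \<open>m\<close>,
  that is of length \<open>m + 1\<close>, cut into cycles of indices \<open>i\<close> and
  \<open>j\<close>; so the sum is taken along antidiagonals. The antidiagonal 0 drops out through
  its factor \<open>i + j = 0\<close>, which also makes the truncated index \<open>i + j - 1\<close>
  harmless there.\<close>

lemma sum_split_ways:
  fixes \<nu> \<mu> :: "nat \<Rightarrow>\<^sub>0 nat"
  assumes M: "\<And>i. M < i \<Longrightarrow> Poly_Mapping.lookup \<nu> i = 0"
  shows "(\<Sum>(i, j)\<in>{(i, j). i + j < M + 2}. (i + j) * (Poly_Mapping.lookup \<nu> (i + j - 1) *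
      of_bool (\<mu> + e1 (i + j - 1) = \<nu> + e1 i + e1 j))) = split_ways M \<nu> \<mu>"
proof -
  let ?f = "\<lambda>i j. (i + j) * (Poly_Mapping.lookup \<nu> (i + j - 1) * of_bool (\<mu> + e1 (i + j - 1) = \<nu> + e1 i + e1 j))"
  have "(\<Sum>(i, j)\<in>{(i, j). i + j < M + 2}. ?f i j) = (\<Sum>m<M + 2. \<Sum>i\<le>m. ?f i (m - i))"
    by (rule sum.triangle_reindex)
  also have "\<dots> = (\<Sum>m\<in>{..<Suc (Suc M)}. \<Sum>i\<le>m. ?f i (m - i))" by simp
  also have "\<dots> = (\<Sum>m\<le>M. \<Sum>i\<le>Suc m. ?f i (Suc m - i))"
    by (subst sum.lessThan_Suc_shift) (simp add: lessThan_Suc_atMost del: sum.atMost_Suc)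
  also have "\<dots> = split_ways M \<nu> \<mu>"
    unfolding split_ways_def by (intro sum.cong refl) auto
  finally show ?thesis .
qed

text \<open>Linearity reduces the operator to monomials. The bound \<open>M\<close> on cycle indices
  confines the non-zero terms to a finite triangle, which turns \<open>Sum_any\<close> into an
  ordinary sum.\<close>

lemma ser_sum_split:
  assumes f: "f = (\<lambda>k \<mu>. \<Sum>p\<in>P. w * of_bool (ty p = \<mu>))" and P: "finite P"
    and M: "\<And>p i. p \<in> P \<Longrightarrow> M < i \<Longrightarrow> Poly_Mapping.lookup (ty p) i = 0"
  shows "ser_sum (\<lambda>i j. real (i + j) \<odot> times_t i (times_t j (d_t (i + j - 1) f))) k \<mu>
    = (\<Sum>p\<in>P. w * real (split_ways M (ty p) \<mu>))"
proof -
  let ?h = "\<lambda>p i j. (i + j) * (Poly_Mapping.lookup (ty p) (i + j - 1) * of_bool (\<mu> + e1 (i + j - 1) = ty p + e1 i + e1 j))"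
  have lin: "times_t i (times_t j (d_t m f)) k \<mu> =
      (\<Sum>p\<in>P. w * times_t i (times_t j (d_t m (\<lambda>k \<mu>. of_bool (ty p = \<mu>)))) k \<mu>)" for i j m
    by (simp add: f times_t_def d_t_def sum_distrib_left mult.left_commute)
  have val: "(real (i + j) \<odot> times_t i (times_t j (d_t (i + j - 1) f))) k \<mu> = (\<Sum>p\<in>P. w * real (?h p i j))" for i j
    unfolding ser_scale_def lin times_t_times_t_d_t_indicator
    by (simp only: sum_distrib_left of_nat_mult mult.assoc mult.left_commute)
  let ?T = "{(i, j). i + j < M + 2}"
  have finT: "finite ?T" by (rule finite_subset[of _ "{..<M + 2} \<times> {..<M + 2}"]) auto
  have "ser_sum (\<lambda>i j. real (i + j) \<odot> times_t i (times_t j (d_t (i + j - 1) f))) k \<mu>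
      = Sum_any (\<lambda>(i, j). \<Sum>p\<in>P. w * real (?h p i j))"
    unfolding ser_sum_def val ..
  also have "\<dots> = (\<Sum>(i, j)\<in>?T. \<Sum>p\<in>P. w * real (?h p i j))"
  proof (rule Sum_any.expand_superset[OF finT])
    show "{a. (case a of (i, j) \<Rightarrow> \<Sum>p\<in>P. w * real (?h p i j)) \<noteq> 0} \<subseteq> ?T"
    proof clarify
      fix i j assume nz: "(\<Sum>p\<in>P. w * real (?h p i j)) \<noteq> 0"
      then obtain p where "p \<in> P" "w * real (?h p i j) \<noteq> 0" by (rule sum.not_neutral_contains_not_neutral)
      then have "\<not> M < i + j - 1" using M[of p "i + j - 1"] by auto
      then show "i + j < M + 2" by linarith
    qed
  qed
  also have "\<dots> = (\<Sum>p\<in>P. \<Sum>(i, j)\<in>?T. w * real (?h p i j))"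
    unfolding split_def by (rule sum.swap)
  also have "\<dots> = (\<Sum>p\<in>P. w * real (\<Sum>(i, j)\<in>?T. ?h p i j))"
    unfolding split_def by (simp only: sum_distrib_left of_nat_sum)
  also have "\<dots> = (\<Sum>p\<in>P. w * real (split_ways M (ty p) \<mu>))"
    by (intro sum.cong refl) (simp only: sum_split_ways[OF M])
  finally show ?thesis .
qed

text \<open>A non-zero term requires cycles of both indices \<open>i\<close> and \<open>j\<close>,
  so both are at most \<open>M\<close> and the sum is finite; the rest is linearity as for
  splitting.\<close>

lemma ser_sum_join:
  assumes f: "f = (\<lambda>k \<mu>. \<Sum>p\<in>P. w * of_bool (ty p = \<mu>))" and P: "finite P"
    and M: "\<And>p i. p \<in> P \<Longrightarrow> M < i \<Longrightarrow> Poly_Mapping.lookup (ty p) i = 0"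
  shows "ser_sum (\<lambda>i j. real ((i + 1) * (j + 1)) \<odot> times_t (i + j + 3) (d_t i (d_t j f))) k \<mu>
    = (\<Sum>p\<in>P. w * real (join_ways M (ty p) \<mu>))"
proof -
  let ?h = "\<lambda>p i j. Suc i * Suc j * (Poly_Mapping.lookup (ty p) i * (Poly_Mapping.lookup (ty p) j - of_bool (j = i))) *
     of_bool (\<mu> + e1 i + e1 j = ty p + e1 (i + j + 3))"
  have lin: "times_t m (d_t i (d_t j f)) k \<mu> =
      (\<Sum>p\<in>P. w * times_t m (d_t i (d_t j (\<lambda>k \<mu>. of_bool (ty p = \<mu>)))) k \<mu>)" for i j m
    by (simp add: f times_t_def d_t_def sum_distrib_left mult.left_commute)
  have val: "(real ((i + 1) * (j + 1)) \<odot> times_t (i + j + 3) (d_t i (d_t j f))) k \<mu> = (\<Sum>p\<in>P. w * real (?h p i j))" for i j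
    unfolding ser_scale_def lin times_t_d_t_d_t_indicator
    by (simp only: sum_distrib_left of_nat_mult mult.assoc mult.left_commute Suc_eq_plus1)
  let ?T = "{..M} \<times> {..M}"
  have "ser_sum (\<lambda>i j. real ((i + 1) * (j + 1)) \<odot> times_t (i + j + 3) (d_t i (d_t j f))) k \<mu>
      = Sum_any (\<lambda>(i, j). \<Sum>p\<in>P. w * real (?h p i j))"
    unfolding ser_sum_def val ..
  also have "\<dots> = (\<Sum>(i, j)\<in>?T. \<Sum>p\<in>P. w * real (?h p i j))"
  proof (rule Sum_any.expand_superset)
    show "{a. (case a of (i, j) \<Rightarrow> \<Sum>p\<in>P. w * real (?h p i j)) \<noteq> 0} \<subseteq> ?T"
    proof clarify
      fix i j assume nz: "(\<Sum>p\<in>P. w * real (?h p i j)) \<noteq> 0"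
      then obtain p where p: "p \<in> P" "w * real (?h p i j) \<noteq> 0" by (rule sum.not_neutral_contains_not_neutral)
      have "Poly_Mapping.lookup (ty p) i \<noteq> 0"
      proof
        assume "Poly_Mapping.lookup (ty p) i = 0"
        then show False using p(2) by simp
      qed
      moreover have "Poly_Mapping.lookup (ty p) j \<noteq> 0"
      proof
        assume "Poly_Mapping.lookup (ty p) j = 0"
        then show False using p(2) by simp
      qed
      ultimately have "\<not> M < i" "\<not> M < j" using M[OF p(1)] by auto
      then show "i \<in> {..M} \<and> j \<in> {..M}" by simp
    qed
  qed simp
  also have "\<dots> = (\<Sum>p\<in>P. \<Sum>(i, j)\<in>?T. w * real (?h p i j))"
    unfolding split_def by (rule sum.swap)
  also have "\<dots> = (\<Sum>p\<in>P. w * real (\<Sum>(i, j)\<in>?T. ?h p i j))"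
    unfolding split_def by (simp only: sum_distrib_left of_nat_sum)
  also have "\<dots> = (\<Sum>p\<in>P. w * real (join_ways M (ty p) \<mu>))"
    by (simp only: join_ways_def sum.cartesian_product)
  finally show ?thesis .
qed

theorem corollary1:
  shows "d_q Zo =
           (1 / 2) \<odot> ser_sum (\<lambda>i j. real (i + j) \<odot> times_t i (times_t j (d_t (i + j - 1) Zo)))
         \<oplus> (1 / 2) \<odot> ser_sum (\<lambda>i j. real ((i + 1) * (j + 1)) \<odot> times_t (i + j + 3) (d_t i (d_t j Zo)))
         \<oplus> (1 / 2) \<odot> times_t 0 (times_t 0 ser_one)
       \<and> Zo 0 = (\<lambda>\<mu>. 0)"
proof
  show "Zo 0 = (\<lambda>\<mu>. 0)" by (rule Zo_0)
  \<comment> \<open>The operators on the right act on the variables \<open>t\<close> only, so the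
    coefficient of \<open>q ^ k\<close> depends only on the slice \<open>Zo k\<close>. Repeating
    this slice in every degree gives the form that \<open>ser_sum_split\<close> expects.\<close>
  have slice1: "ser_sum (\<lambda>i j. real (i + j) \<odot> times_t i (times_t j (d_t (i + j - 1) Zo))) k \<mu>
      = ser_sum (\<lambda>i j. real (i + j) \<odot> times_t i (times_t j (d_t (i + j - 1) (\<lambda>_. Zo k)))) k \<mu>" for k \<mu>
    by (simp add: ser_sum_def ser_scale_def times_t_def d_t_def)
  have slice2: "ser_sum (\<lambda>i j. real ((i + 1) * (j + 1)) \<odot> times_t (i + j + 3) (d_t i (d_t j Zo))) k \<mu>
      = ser_sum (\<lambda>i j. real ((i + 1) * (j + 1)) \<odot> times_t (i + j + 3) (d_t i (d_t j (\<lambda>_. Zo k)))) k \<mu>" for k \<mu>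
    by (simp add: ser_sum_def ser_scale_def times_t_def d_t_def)
  show "d_q Zo =
           (1 / 2) \<odot> ser_sum (\<lambda>i j. real (i + j) \<odot> times_t i (times_t j (d_t (i + j - 1) Zo)))
         \<oplus> (1 / 2) \<odot> ser_sum (\<lambda>i j. real ((i + 1) * (j + 1)) \<odot> times_t (i + j + 3) (d_t i (d_t j Zo)))
         \<oplus> (1 / 2) \<odot> times_t 0 (times_t 0 ser_one)"
    (is "_ = (1 / 2) \<odot> ?A \<oplus> (1 / 2) \<odot> ?B \<oplus> (1 / 2) \<odot> ?C")
  proof (intro ext)
    fix k \<mu>
    show "d_q Zo k \<mu> = ((1 / 2) \<odot> ?A \<oplus> (1 / 2) \<odot> ?B \<oplus> (1 / 2) \<odot> ?C) k \<mu>"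
    proof (cases k)
      case 0
      \<comment> \<open>\<open>Zo 0\<close> is a sum over an empty index set, so both sums vanish
        here, and the inhomogeneous term alone gives the coefficient of \<open>q\<close> in the
        series.\<close>
      have "(\<lambda>_. Zo 0) = (\<lambda>k \<mu>. \<Sum>p\<in>({} :: nat set). 0 * of_bool ((\<lambda>_. 0) p = \<mu>))" by (simp add: Zo_0)
      note Z0 = this
      have "?A k \<mu> = 0" unfolding slice1 0 using ser_sum_split[OF Z0] by simp
      moreover have "?B k \<mu> = 0" unfolding slice2 0 using ser_sum_join[OF Z0] by simp
      moreover have "?C k \<mu> = of_bool (\<mu> = e1 0 + e1 0)"
      proof (cases "Poly_Mapping.lookup \<mu> 0 \<noteq> 0 \<and> Poly_Mapping.lookup (\<mu> - e1 0) 0 \<noteq> 0")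
        case True
        then have "\<mu> = (\<mu> - e1 0 - e1 0) + e1 0 + e1 0"
          using minus_single_plus[of \<mu> 0] minus_single_plus[of "\<mu> - e1 0" 0] by simp
        then have "\<mu> = e1 0 + e1 0 \<longleftrightarrow> (\<mu> - e1 0 - e1 0) + (e1 0 + e1 0) = 0 + (e1 0 + e1 0)"
          by (simp only: add.assoc add_0)
        then have "\<mu> = e1 0 + e1 0 \<longleftrightarrow> \<mu> - e1 0 - e1 0 = 0" by (simp only: add_right_cancel)
        then show ?thesis using True 0 by (simp add: times_t_def ser_one_def)
      next
        case False
        have "\<mu> \<noteq> e1 0 + e1 0"
        proof
          assume "\<mu> = e1 0 + e1 0"
          then show False using False by (simp only: lookup_add lookup_minus lookup_e1) simp
        qed
        then show ?thesis using False by (auto simp: times_t_def)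
      qed
      moreover have "d_q Zo k \<mu> = of_bool (\<mu> = e1 0 + e1 0) / 2"
        using pair_count_1[of \<mu>] 0 by (simp add: d_q_def Zo_Suc numeral_2_eq_2)
      ultimately show ?thesis by (simp add: ser_add_def ser_scale_def)
    next
      case (Suc k')
      then have k: "1 \<le> k" by simp
      define P where "P = full_cycles {..<2 * k} \<times> matchings {..<2 * k}"
      define ty where "ty = (\<lambda>(t, r :: nat \<Rightarrow> nat). cycle_type {..<2 * k} (inv t \<circ> r))"
      have finP: "finite P" by (simp add: P_def finite_full_cycles finite_matchings)
      have M: "Poly_Mapping.lookup (ty p) i = 0" if "p \<in> P" "2 * k < i" for p i
        using that pair_permutes by (auto simp: P_def ty_def intro!: lookup_cycle_type_large)
      have "real (pair_count k \<nu>) = (\<Sum>p\<in>P. of_bool (ty p = \<nu>))" for \<nu>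
        by (simp add: pair_count_def P_def ty_def sum.cartesian_product split_def del: sum_of_bool_eq)
      then have Zk: "(\<lambda>_. Zo k) = (\<lambda>k' \<nu>. \<Sum>p\<in>P. 1 / fact (2 * k) * of_bool (ty p = \<nu>))"
        by (intro ext) (simp only: Suc Zo_Suc sum_distrib_left[symmetric], simp)
      have A: "?A k \<mu> = (\<Sum>p\<in>P. 1 / fact (2 * k) * real (split_ways (2 * k) (ty p) \<mu>))"
        unfolding slice1 by (rule ser_sum_split[OF Zk finP M])
      have B: "?B k \<mu> = (\<Sum>p\<in>P. 1 / fact (2 * k) * real (join_ways (2 * k) (ty p) \<mu>))"
        unfolding slice2 by (rule ser_sum_join[OF Zk finP M])
      have C: "?C k \<mu> = 0" using k by (auto simp: times_t_def ser_one_def)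
      have pc: "pair_count (Suc k) \<mu> = (2 * k + 1) * (\<Sum>p\<in>P. split_ways (2 * k) (ty p) \<mu> + join_ways (2 * k) (ty p) \<mu>)"
        using pair_count_recursion[OF k, of "2 * k" \<mu>]
        by (simp add: P_def ty_def sum.cartesian_product split_def)
      have "?A k \<mu> + ?B k \<mu> = real (\<Sum>p\<in>P. split_ways (2 * k) (ty p) \<mu> + join_ways (2 * k) (ty p) \<mu>) / fact (2 * k)"
        unfolding A B by (simp add: sum.distrib sum_divide_distrib add_divide_distrib)
      moreover have "d_q Zo k \<mu> = real (k + 1) * (real (pair_count (Suc k) \<mu>) / fact (2 * Suc k))"
        by (simp only: d_q_def Zo_Suc Suc_eq_plus1[symmetric])
      \<comment> \<open>Of the factors \<open>(2 k + 2) (2 k + 1)\<close> by which the two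
        factorials differ, the second cancels the number of partners and the first leaves
        \<open>1/2\<close> against \<open>k + 1\<close>.\<close>
      moreover have "real (k + 1) * (real (pair_count (Suc k) \<mu>) / fact (2 * Suc k))
        = (1 / 2) * (real (\<Sum>p\<in>P. split_ways (2 * k) (ty p) \<mu> + join_ways (2 * k) (ty p) \<mu>) / fact (2 * k))"
      proof -
        have "fact (2 * Suc k) = (2 * real (k + 1)) * real (2 * k + 1) * fact (2 * k)"
          by (simp add: algebra_simps)
        moreover have "x * (real (a * b) / (2 * x * real a * F)) = 1 / 2 * (real b / F)"
          if "x \<noteq> 0" "0 < a" for x F :: real and a b :: nat
          using that by simp
        ultimately show ?thesis unfolding pc by (simp only:)
      qed
      ultimately show ?thesis using C by (simp add: ser_add_def ser_scale_def)
    qed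
  qed
qed

end
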